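(* The following inequalities hold (in ZFC): (a) $\aleph_1\le\mathfrak{u}$, $\aleph_1\le\mathfrak{d}$, and $\aleph_1\le\mathrm{non}(\mathcal{N})$; (b) $\mathfrak{d}\le\mathrm{cof}(\mathcal{N})$ and $\mathrm{non}(\mathcal{N})\le\mathrm{cof}(\mathcal{N})$; (c) $\mathfrak{u}\le\mathfrak{u}(\mathbb{C}_\omega)$ and $\mathfrak{u}\le\mathfrak{u}(\mathbb{B}_\omega)$; (d) $\mathfrak{d}\le\mathfrak{u}(\mathbb{C}_\omega)$; (e) $\mathrm{cof}(\mathcal{N})\le\mathfrak{u}(\mathbb{B}_\omega)$; (f) $\mathfrak{u}(\mathbb{C}_\omega)\le\mathfrak{u}(\mathbb{C}_{\omega_1})\le 2^{\aleph_0}$ and $\mathfrak{u}(\mathbb{B}_\omega)\le\mathfrak{u}(\mathbb{B}_{\omega_1})\le 2^{\aleph_0}$.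
   Context: $\mathcal{M}$ is the ideal of meagre subsets of ${}^\omega 2$, and $\mathcal{N}$ is the ideal of subsets of ${}^\omega 2$ that are null for the standard product measure. For $I\in\{\mathcal{M},\mathcal{N}\}$ and an infinite ordinal $\alpha$, let $I(\alpha)$ be the family of all $X\subseteq{}^\alpha 2$ for which there exist an injective $\Delta\colon\omega\to\alpha$ and $Y\in I$ such that $f\circ\Delta\in Y$ for all $f\in X$ (this is a $\sigma$-ideal over ${}^\alpha 2$). Let $\mathcal{B}({}^\alpha 2)$ be the $\sigma$-algebra of subsets of ${}^\alpha 2$ generated by the clopen subsets of the Cantor space ${}^\alpha 2$. The Cohen algebra is $\mathbb{C}_\alpha=\mathcal{B}({}^\alpha 2)/\mathcal{M}(\alpha)$ and the random algebra is $\mathbb{B}_\alpha=\mathcal{B}({}^\alpha 2)/\mathcal{N}(\alpha)$. For a directed set $D$, $\mathrm{cof}(D)$ is the least cardinality of a cofinal subset of $D$; $\mathrm{cof}(\mathcal{N})$ is taken with respect to inclusion. For an infinite Boolean algebra $\mathbb{B}$, the ultrafilter number is $\mathfrak{u}(\mathbb{B})=\min\{\mathrm{cof}(\langle U,\ge\rangle) : U\subset\mathbb{B}\text{ is a non-principal ultrafilter}\}$, where $\langle U,\ge\rangle$ is $U$ with the reverse Boolean order (so a cofinal subset is a base of $U$); $\mathfrak{u}=\mathfrak{u}(\mathcal{P}(\omega)/\mathrm{fin})$. $\mathfrak{d}$ is the dominating number and $\mathrm{non}(\mathcal{N})$ is the least size of a subset of ${}^\omega 2$ not in $\mathcal{N}$.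 *)

theory Defs
  imports "HOL-Probability.Probability" "HOL-Algebra.Lattice"
begin

unbundle cardinal_syntax

section \<open>Cardinal minima\<close>

text \<open>
  Cardinals are the cardinal orders of the library, compared by \<open>\<le>o\<close>.
  Cardinals are only unique up to \<open>=o\<close>, so the minimum of a nonempty set of
  cardinals is one of its \<open>\<le>o\<close>-least members.
\<close>

definition min_card :: "'a rel set \<Rightarrow> 'a rel" where
  "min_card S = (SOME r. r \<in> S \<and> (\<forall>r'\<in>S. r \<le>o r'))"

lemma min_card:
  assumes "S \<noteq> {}" and "\<And>r. r \<in> S \<Longrightarrow> Card_order r"
  shows "min_card S \<in> S" and "\<And>r. r \<in> S \<Longrightarrow> min_card S \<le>o r"
proof -
  have "\<exists>r. r \<in> S \<and> (\<forall>r'\<in>S. r \<le>o r')"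
    using exists_minim_Card_order[of S] assms by blast
  then have "min_card S \<in> S \<and> (\<forall>r'\<in>S. min_card S \<le>o r')"
    unfolding min_card_def by (rule someI_ex)
  then show "min_card S \<in> S" and "\<And>r. r \<in> S \<Longrightarrow> min_card S \<le>o r"
    by auto
qed

definition cofinal_in :: "'a set \<Rightarrow> ('a \<Rightarrow> 'a \<Rightarrow> bool) \<Rightarrow> 'a set \<Rightarrow> bool" where
  "cofinal_in D R C \<longleftrightarrow> C \<subseteq> D \<and> (\<forall>d\<in>D. \<exists>c\<in>C. R d c)"

definition cof :: "'a set \<Rightarrow> ('a \<Rightarrow> 'a \<Rightarrow> bool) \<Rightarrow> 'a rel" where
  "cof D R = min_card { |C| | C. cofinal_in D R C}"


section \<open>Ultrafilters on Boolean algebras\<close>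

text \<open>A Boolean algebra is given by its underlying bounded lattice.\<close>

definition proper_filter :: "('b, 'c) gorder_scheme \<Rightarrow> 'b set \<Rightarrow> bool" where
  "proper_filter L F \<longleftrightarrow>
     F \<subseteq> carrier L \<and> \<top>\<^bsub>L\<^esub> \<in> F \<and> \<bottom>\<^bsub>L\<^esub> \<notin> F \<and>
     (\<forall>x\<in>F. \<forall>y\<in>F. x \<sqinter>\<^bsub>L\<^esub> y \<in> F) \<and>
     (\<forall>x\<in>F. \<forall>y\<in>carrier L. x \<sqsubseteq>\<^bsub>L\<^esub> y \<longrightarrow> y \<in> F)"

definition ultrafilter :: "('b, 'c) gorder_scheme \<Rightarrow> 'b set \<Rightarrow> bool" where
  "ultrafilter L U \<longleftrightarrow>
     proper_filter L U \<and> (\<forall>F. proper_filter L F \<and> U \<subseteq> F \<longrightarrow> F = U)"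

definition principal :: "('b, 'c) gorder_scheme \<Rightarrow> 'b set \<Rightarrow> bool" where
  "principal L U \<longleftrightarrow> (\<exists>a\<in>carrier L. U = {x \<in> carrier L. a \<sqsubseteq>\<^bsub>L\<^esub> x})"

definition ultrafilter_number :: "('b, 'c) gorder_scheme \<Rightarrow> 'b rel" where
  "ultrafilter_number L =
     min_card {cof U (\<lambda>x y. y \<sqsubseteq>\<^bsub>L\<^esub> x) | U. ultrafilter L U \<and> \<not> principal L U}"


section \<open>Quotients of algebras of sets\<close>

definition mod_ideal :: "'a set set \<Rightarrow> 'a set set \<Rightarrow> 'a set rel" where
  "mod_ideal A I = {(X, Y). X \<in> A \<and> Y \<in> A \<and> (X - Y) \<union> (Y - X) \<in> I}"

definition quotient_algebra :: "'a set set \<Rightarrow> 'a set set \<Rightarrow> 'a set set gorder" where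
  "quotient_algebra A I =
     \<lparr>carrier = A // mod_ideal A I, eq = (=),
      le = (\<lambda>x y. \<exists>X\<in>x. \<exists>Y\<in>y. X - Y \<in> I)\<rparr>"

text \<open>
  For an ideal \<open>I\<close> the quotient is a bounded lattice whose operations are induced by the
  set operations.
\<close>

locale set_algebra_ideal = algebra S A for S :: "'a set" and A +
  fixes I :: "'a set set"
  assumes ideal_empty: "{} \<in> I"
    and ideal_Un: "\<And>X Y. X \<in> I \<Longrightarrow> Y \<in> I \<Longrightarrow> X \<union> Y \<in> I"
    and ideal_subset: "\<And>X Y. X \<in> I \<Longrightarrow> Y \<subseteq> X \<Longrightarrow> Y \<in> I"
begin

abbreviation Q :: "'a set set gorder" where "Q \<equiv> quotient_algebra A I"
abbreviation cls :: "'a set \<Rightarrow> 'a set set" where "cls X \<equiv> mod_ideal A I `` {X}"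

lemma mod_idealD: "(X, Y) \<in> mod_ideal A I \<Longrightarrow> X \<in> A \<and> Y \<in> A \<and> X - Y \<in> I \<and> Y - X \<in> I"
  unfolding mod_ideal_def using ideal_subset[of "(X - Y) \<union> (Y - X)"] by simp

lemma mod_idealI: "X \<in> A \<Longrightarrow> Y \<in> A \<Longrightarrow> X - Y \<in> I \<Longrightarrow> Y - X \<in> I \<Longrightarrow> (X, Y) \<in> mod_ideal A I"
  unfolding mod_ideal_def by (simp add: ideal_Un)

lemma diff_trans: "X - Y \<in> I \<Longrightarrow> Y - Z \<in> I \<Longrightarrow> X - Z \<in> I"
  using ideal_subset[OF ideal_Un, of "X - Y" "Y - Z" "X - Z"] by blast

lemma equiv_mod_ideal: "equiv A (mod_ideal A I)"
proof (rule equivI)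
  show "mod_ideal A I \<subseteq> A \<times> A" by (auto simp: mod_ideal_def)
  show "refl_on A (mod_ideal A I)"
    by (auto simp: refl_on_def mod_ideal_def ideal_empty)
  show "sym (mod_ideal A I)"
    by (auto simp: sym_def mod_ideal_def Un_commute)
  show "trans (mod_ideal A I)"
  proof (rule transI)
    fix X Y Z assume "(X, Y) \<in> mod_ideal A I" "(Y, Z) \<in> mod_ideal A I"
    then show "(X, Z) \<in> mod_ideal A I"
      using diff_trans[of X Y Z] diff_trans[of Z Y X]
      by (intro mod_idealI) (auto dest!: mod_idealD)
  qed
qed

lemma carrier_Q: "x \<in> carrier Q \<longleftrightarrow> (\<exists>X\<in>A. x = cls X)"
  by (auto simp: quotient_algebra_def quotient_def)

lemma cls_self: "X \<in> A \<Longrightarrow> X \<in> cls X"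
  using equiv_class_self[OF equiv_mod_ideal] .

lemma cls_eq_iff:
  assumes "X \<in> A" "Y \<in> A"
  shows "cls X = cls Y \<longleftrightarrow> X - Y \<in> I \<and> Y - X \<in> I"
  unfolding eq_equiv_class_iff[OF equiv_mod_ideal assms]
  using assms mod_idealD[of X Y] mod_idealI[of X Y] by blast

lemma le_Q:
  assumes "X \<in> A" "Y \<in> A"
  shows "cls X \<sqsubseteq>\<^bsub>Q\<^esub> cls Y \<longleftrightarrow> X - Y \<in> I"
proof
  assume "cls X \<sqsubseteq>\<^bsub>Q\<^esub> cls Y"
  then obtain X' Y' where "(X, X') \<in> mod_ideal A I" "(Y, Y') \<in> mod_ideal A I" "X' - Y' \<in> I"
    by (auto simp: quotient_algebra_def)
  then show "X - Y \<in> I"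
    using diff_trans[of X X' Y'] diff_trans[of X Y' Y] mod_idealD[of X X'] mod_idealD[of Y Y']
    by simp
next
  assume "X - Y \<in> I"
  then show "cls X \<sqsubseteq>\<^bsub>Q\<^esub> cls Y"
    using assms[THEN cls_self] by (auto simp: quotient_algebra_def)
qed

lemma cls_carrier: "X \<in> A \<Longrightarrow> cls X \<in> carrier Q"
  unfolding carrier_Q by blast

lemma cls_mono: "X \<in> A \<Longrightarrow> Y \<in> A \<Longrightarrow> X \<subseteq> Y \<Longrightarrow> cls X \<sqsubseteq>\<^bsub>Q\<^esub> cls Y"
  by (simp add: le_Q ideal_empty Diff_eq_empty_iff[THEN iffD2])

lemma greatest_Q:
  assumes "X \<in> A" "Y \<in> A"
  shows "greatest Q (cls (X \<inter> Y)) (Lower Q {cls X, cls Y})"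
proof -
  have XY: "X \<inter> Y \<in> A" using assms by (rule Int)
  have "z \<sqsubseteq>\<^bsub>Q\<^esub> cls (X \<inter> Y)"
    if z: "z \<in> carrier Q" "z \<sqsubseteq>\<^bsub>Q\<^esub> cls X" "z \<sqsubseteq>\<^bsub>Q\<^esub> cls Y" for z
  proof -
    obtain Z where Z: "Z \<in> A" "z = cls Z" using z(1) unfolding carrier_Q by blast
    then have "Z - X \<in> I" "Z - Y \<in> I" using z assms by (simp_all add: le_Q)
    then have "Z - X \<inter> Y \<in> I" unfolding Diff_Int by (rule ideal_Un)
    then show ?thesis using Z XY by (simp add: le_Q)
  qed
  then show ?thesis
    using assms[THEN cls_carrier] cls_carrier[OF XY]
      cls_mono[OF XY assms(1)] cls_mono[OF XY assms(2)]
    by (auto simp: greatest_def Lower_def)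
qed

lemma least_Q:
  assumes "X \<in> A" "Y \<in> A"
  shows "least Q (cls (X \<union> Y)) (Upper Q {cls X, cls Y})"
proof -
  have XY: "X \<union> Y \<in> A" using assms by (rule Un)
  have "cls (X \<union> Y) \<sqsubseteq>\<^bsub>Q\<^esub> z"
    if z: "z \<in> carrier Q" "cls X \<sqsubseteq>\<^bsub>Q\<^esub> z" "cls Y \<sqsubseteq>\<^bsub>Q\<^esub> z" for z
  proof -
    obtain Z where Z: "Z \<in> A" "z = cls Z" using z(1) unfolding carrier_Q by blast
    then have "X - Z \<in> I" "Y - Z \<in> I" using z assms by (simp_all add: le_Q)
    then have "X \<union> Y - Z \<in> I" unfolding Un_Diff by (rule ideal_Un)
    then show ?thesis using Z XY by (simp add: le_Q)
  qed
  then show ?thesis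
    using assms[THEN cls_carrier] cls_carrier[OF XY]
      cls_mono[OF assms(1) XY] cls_mono[OF assms(2) XY]
    by (auto simp: least_def Upper_def)
qed

lemma least_carrier_Q: "least Q (cls {}) (carrier Q)"
  using cls_mono[of "{}"] by (auto simp: least_def carrier_Q)

lemma greatest_carrier_Q: "greatest Q (cls S) (carrier Q)"
  using cls_mono[of _ S] sets_into_space by (auto simp: greatest_def carrier_Q)

lemma partial_order_Q: "partial_order Q"
proof unfold_locales
  have "x = y" if "x \<sqsubseteq>\<^bsub>Q\<^esub> y" "y \<sqsubseteq>\<^bsub>Q\<^esub> x" "x \<in> carrier Q" "y \<in> carrier Q" for x y
  proof -
    obtain X Y where "X \<in> A" "Y \<in> A" "x = cls X" "y = cls Y"
      using \<open>x \<in> carrier Q\<close> \<open>y \<in> carrier Q\<close> unfolding carrier_Q by blast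
    with that show ?thesis by (simp add: le_Q cls_eq_iff)
  qed
  then show "x .=\<^bsub>Q\<^esub> y" if "x \<sqsubseteq>\<^bsub>Q\<^esub> y" "y \<sqsubseteq>\<^bsub>Q\<^esub> x" "x \<in> carrier Q" "y \<in> carrier Q" for x y
    using that by (simp add: quotient_algebra_def)
  show "x \<sqsubseteq>\<^bsub>Q\<^esub> z" if xyz: "x \<sqsubseteq>\<^bsub>Q\<^esub> y" "y \<sqsubseteq>\<^bsub>Q\<^esub> z"
      "x \<in> carrier Q" "y \<in> carrier Q" "z \<in> carrier Q" for x y z
  proof -
    obtain X Y Z where "X \<in> A" "Y \<in> A" "Z \<in> A" "x = cls X" "y = cls Y" "z = cls Z"
      using xyz(3-5) unfolding carrier_Q by blast
    with xyz show ?thesis using diff_trans[of X Y Z] by (simp add: le_Q)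
  qed
  show "x \<sqsubseteq>\<^bsub>Q\<^esub> x" if "x \<in> carrier Q" for x
    using that cls_mono unfolding carrier_Q by blast
qed (simp_all add: quotient_algebra_def)

lemma bounded_lattice_Q: "Lattice.bounded_lattice Q"
proof -
  interpret partial_order Q by (rule partial_order_Q)
  show ?thesis
  proof unfold_locales
    fix x y assume "x \<in> carrier Q" "y \<in> carrier Q"
    then obtain X Y where "X \<in> A" "Y \<in> A" "x = cls X" "y = cls Y"
      unfolding carrier_Q by blast
    then show "\<exists>s. least Q s (Upper Q {x, y})" "\<exists>s. greatest Q s (Lower Q {x, y})"
      using least_Q greatest_Q by blast+
  qed (use least_carrier_Q greatest_carrier_Q in blast)+
qed


sublocale Q: Lattice.bounded_lattice Q
  by (rule bounded_lattice_Q)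

lemma meet_Q: "X \<in> A \<Longrightarrow> Y \<in> A \<Longrightarrow> cls X \<sqinter>\<^bsub>Q\<^esub> cls Y = cls (X \<inter> Y)"
  unfolding Lattice.meet_def Lattice.inf_def
  by (rule some_equality, (rule greatest_Q; assumption), rule Q.greatest_unique, assumption, (rule greatest_Q; assumption))

lemma join_Q: "X \<in> A \<Longrightarrow> Y \<in> A \<Longrightarrow> cls X \<squnion>\<^bsub>Q\<^esub> cls Y = cls (X \<union> Y)"
  unfolding Lattice.join_def Lattice.sup_def
  by (rule some_equality, (rule least_Q; assumption), rule Q.least_unique, assumption, (rule least_Q; assumption))

lemma bottom_Q: "\<bottom>\<^bsub>Q\<^esub> = cls {}"
  unfolding bottom_def
  by (rule some_equality, rule least_carrier_Q, rule Q.least_unique, assumption, rule least_carrier_Q)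

lemma top_Q: "\<top>\<^bsub>Q\<^esub> = cls S"
  unfolding top_def
  by (rule some_equality, rule greatest_carrier_Q, rule Q.greatest_unique, assumption, rule greatest_carrier_Q)


end


section \<open>The Cantor space and its ideals\<close>

text \<open>
  An ordinal is identified with the set of its elements, here an arbitrary index set \<open>A\<close>;
  none of the notions below depends on the ordering. The points of the space are the
  functions on \<open>A\<close>, extended by \<^term>\<open>undefined\<close> outside \<open>A\<close>.
\<close>

definition cantor_space :: "'i set \<Rightarrow> ('i \<Rightarrow> bool) topology" where
  "cantor_space A = product_topology (\<lambda>_. discrete_topology UNIV) A"

definition cantor_measure :: "(nat \<Rightarrow> bool) measure" where
  "cantor_measure = PiM UNIV (\<lambda>_. uniform_count_measure UNIV)"

definition nowhere_dense_in :: "'a topology \<Rightarrow> 'a set \<Rightarrow> bool" where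
  "nowhere_dense_in T X \<longleftrightarrow> X \<subseteq> topspace T \<and> T interior_of (T closure_of X) = {}"

definition meagre_in :: "'a topology \<Rightarrow> 'a set \<Rightarrow> bool" where
  "meagre_in T X \<longleftrightarrow> (\<exists>F. countable F \<and> (\<forall>N\<in>F. nowhere_dense_in T N) \<and> X = \<Union>F)"

definition meagre_ideal :: "(nat \<Rightarrow> bool) set set" where
  "meagre_ideal = {X. meagre_in (cantor_space UNIV) X}"

definition null_ideal :: "(nat \<Rightarrow> bool) set set" where
  "null_ideal = {X. \<exists>N\<in>null_sets cantor_measure. X \<subseteq> N}"

definition ideal_at :: "(nat \<Rightarrow> bool) set set \<Rightarrow> 'i set \<Rightarrow> ('i \<Rightarrow> bool) set set" where
  "ideal_at I A = {X. X \<subseteq> topspace (cantor_space A) \<and>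
     (\<exists>\<Delta> Y. inj \<Delta> \<and> range \<Delta> \<subseteq> A \<and> Y \<in> I \<and> (\<forall>f\<in>X. f \<circ> \<Delta> \<in> Y))}"

definition clopen_sigma :: "'i set \<Rightarrow> ('i \<Rightarrow> bool) set set" where
  "clopen_sigma A = sigma_sets (topspace (cantor_space A))
     {X. openin (cantor_space A) X \<and> closedin (cantor_space A) X}"

definition cohen_algebra :: "'i set \<Rightarrow> ('i \<Rightarrow> bool) set set gorder" where
  "cohen_algebra A = quotient_algebra (clopen_sigma A) (ideal_at meagre_ideal A)"

definition random_algebra :: "'i set \<Rightarrow> ('i \<Rightarrow> bool) set set gorder" where
  "random_algebra A = quotient_algebra (clopen_sigma A) (ideal_at null_ideal A)"


section \<open>Cardinal characteristics\<close>

abbreviation omega :: "nat set" where "omega \<equiv> UNIV"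

text \<open>\<^term>\<open>cardSuc natLeq\<close> is a well-order of type \<open>\<omega>\<^sub>1\<close>.\<close>

definition omega1 :: "nat set set" where "omega1 = Field (cardSuc natLeq)"

definition aleph1 :: "nat set rel" where "aleph1 = cardSuc natLeq"

definition continuum :: "(nat \<Rightarrow> bool) rel" where "continuum = ctwo ^c natLeq"

definition ultrafilter_number_omega :: "nat set set rel" where
  "ultrafilter_number_omega = ultrafilter_number (quotient_algebra UNIV {X :: nat set. finite X})"

definition dominating_number :: "(nat \<Rightarrow> nat) rel" where
  "dominating_number = cof UNIV (\<lambda>f g. \<forall>\<^sub>F n in sequentially. f n \<le> g n)"

definition non_null :: "(nat \<Rightarrow> bool) rel" where
  "non_null = min_card { |X| | X. X \<notin> null_ideal}"

definition cof_null :: "(nat \<Rightarrow> bool) set rel" where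
  "cof_null = cof null_ideal (\<subseteq>)"

end

theory Submission
  imports Defs
begin

text \<open>
  All comparisons of ultrafilter numbers use an ultrafilter on the algebra of Borel sets modulo a
  \<open>\<sigma>\<close>-ideal \<open>I\<close> and a base \<open>D\<close> of least size; category and measure are treated together through a few
  common properties of the ideal.

  \<^item> The ultrafilter determines a point \<open>z\<close>, coordinate by coordinate. The sets of points first
    differing from \<open>z\<close> at \<open>k\<close> (the shells) partition the space, and projecting the ultrafilter along
    this partition gives a nonprincipal ultrafilter on \<open>\<omega>\<close> with base the supports of the \<open>d \<in> D\<close>; this
    is (c).
  \<^item> A set outside \<open>I\<close> decides only finitely many coordinates. Letting \<open>b\<close> be the \<open>F k\<close>-th coordinate on
    the \<open>k\<close>-th shell, a base element deciding \<open>b\<close> bounds \<open>F\<close> on its infinite support; this is (d).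
  \<^item> For (e), fix for each \<open>n\<close> pairwise independent sets (the blocks) \<open>G n i\<close> of measure
    \<open>g n = 2 powr (- n * n)\<close>, and let \<open>B f\<close> be the set of points lying in an odd finite number of the
    \<open>G n (f n)\<close>. Once \<open>f\<close> is fixed below \<open>n\<close>, all but about \<open>1 / g n\<close> choices of \<open>f n\<close> make both \<open>d \<inter> B f\<close>
    and \<open>d - B f\<close> have measure of order \<open>g n\<close> after step \<open>n\<close>, which the later steps are too small to
    undo. So a base element deciding \<open>B f\<close> confines \<open>f\<close> to a slalom of width independent of \<open>f\<close> and \<open>d\<close>,
    and slaloms of fixed width give a cofinal family of null sets.
  \<^item> For (f), the algebra over \<open>\<omega>\<close> is a complete subalgebra of the one over \<open>\<omega>\<^sub>1\<close>, so the trace of an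
    ultrafilter is generated by the projections of its base; and the large algebra has at most
    continuum many elements.
  \<^item> To bound the dominating number by \<open>cof(N)\<close>: if the null set of points in infinitely many \<open>G n (f n)\<close> is covered by \<open>c\<close>, then
    some positive relatively clopen part of a closed set disjoint from \<open>c\<close> eventually avoids
    \<open>G n (f n)\<close>, and for each \<open>n\<close> it avoids only finitely many \<open>G n i\<close>.
\<close>

section \<open>Ultrafilters on quotients of set algebras\<close>

lemma cof_le:
  assumes "cofinal_in D R C"
  shows "cof D R \<le>o |C|"
  unfolding cof_def by (rule min_card(2)) (use assms in \<open>auto simp: card_of_Card_order\<close>)

lemma cof_attained:
  assumes "cofinal_in D R C0"
  obtains C where "cofinal_in D R C" "cof D R = |C|"
proof -
  have "cof D R \<in> { |C| | C. cofinal_in D R C}"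
    unfolding cof_def by (rule min_card(1)) (use assms in \<open>auto simp: card_of_Card_order\<close>)
  then show thesis using that by blast
qed

context set_algebra_ideal
begin

text \<open>Filters of the quotient are handled through representatives. Closure under
  \<open>X - Y \<in> I\<close> saturates the family, so that it is the full preimage in
  \<open>A\<close> of its set of classes and can be recovered from them.\<close>

definition set_filter :: "'a set set \<Rightarrow> bool" where
  "set_filter F \<longleftrightarrow> F \<subseteq> A \<and> S \<in> F \<and> F \<inter> I = {} \<and> (\<forall>X\<in>F. \<forall>Y\<in>F. X \<inter> Y \<in> F) \<and>
     (\<forall>X\<in>F. \<forall>Y\<in>A. X - Y \<in> I \<longrightarrow> Y \<in> F)"

definition set_ultrafilter :: "'a set set \<Rightarrow> bool" where
  "set_ultrafilter P \<longleftrightarrow> set_filter P \<and> (\<forall>X\<in>A. X \<in> P \<or> S - X \<in> P)"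

definition nonprincipal :: "'a set set \<Rightarrow> bool" where
  "nonprincipal P \<longleftrightarrow> (\<forall>X\<in>P. \<exists>Y\<in>P. X - Y \<notin> I)"

definition filter_base :: "'a set set \<Rightarrow> 'a set set \<Rightarrow> bool" where
  "filter_base P D \<longleftrightarrow> D \<subseteq> P \<and> (\<forall>X\<in>P. \<exists>d\<in>D. d - X \<in> I)"

lemma set_filterD:
  assumes "set_filter F"
  shows "X \<in> F \<Longrightarrow> X \<in> A" "S \<in> F" "X \<in> F \<Longrightarrow> X \<notin> I"
    "X \<in> F \<Longrightarrow> Y \<in> F \<Longrightarrow> X \<inter> Y \<in> F"
    "X \<in> F \<Longrightarrow> Y \<in> A \<Longrightarrow> X - Y \<in> I \<Longrightarrow> Y \<in> F"
  using assms unfolding set_filter_def by auto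

lemma set_ultrafilterD:
  assumes "set_ultrafilter P"
  shows "set_filter P" "X \<in> A \<Longrightarrow> X \<notin> P \<Longrightarrow> S - X \<in> P"
  using assms unfolding set_ultrafilter_def by auto

text \<open>The filter generated by \<open>F\<close> and \<open>X\<close> works: if it met the
  ideal, some \<open>Z \<in> F\<close> would lie in \<open>S - X\<close> up to the ideal, forcing
  \<open>S - X \<in> F\<close>.\<close>

lemma set_filter_extend:
  assumes F: "set_filter F" and X: "X \<in> A" "S - X \<notin> F"
  obtains G where "set_filter G" "F \<subseteq> G" "X \<in> G"
proof
  note FD = set_filterD[OF F]
  define G where "G = {Y \<in> A. \<exists>Z\<in>F. Z \<inter> X - Y \<in> I}"
  have "Y \<notin> I" if Y: "Y \<in> G" for Y
  proof
    assume "Y \<in> I"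
    obtain Z where Z: "Z \<in> F" "Z \<inter> X - Y \<in> I" using Y unfolding G_def by blast
    have "Z - (S - X) \<in> I"
      by (rule ideal_subset[OF ideal_Un[OF Z(2) \<open>Y \<in> I\<close>]])
         (use sets_into_space[OF FD(1)[OF Z(1)]] in auto)
    then show False using FD(5)[OF Z(1)] X by blast
  qed
  moreover have "Y \<inter> Y' \<in> G" if Y: "Y \<in> G" "Y' \<in> G" for Y Y'
  proof -
    obtain Z Z' where Z: "Z \<in> F" "Z \<inter> X - Y \<in> I" "Z' \<in> F" "Z' \<inter> X - Y' \<in> I"
      using Y unfolding G_def by blast
    have "(Z \<inter> Z') \<inter> X - (Y \<inter> Y') \<in> I"
      by (rule ideal_subset[OF ideal_Un[OF Z(2) Z(4)]]) auto
    then show ?thesis using Y FD(4)[OF Z(1,3)] unfolding G_def by blast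
  qed
  moreover have "Y' \<in> G" if "Y \<in> G" "Y' \<in> A" "Y - Y' \<in> I" for Y Y'
    using that diff_trans unfolding G_def by blast
  moreover have "Y \<in> G" if "Y \<in> F" for Y
    using that FD(1) ideal_subset[OF ideal_empty, of "Y \<inter> X - Y"] unfolding G_def by auto
  moreover have "X \<in> G"
    using X FD(2) ideal_subset[OF ideal_empty, of "S \<inter> X - X"] unfolding G_def by blast
  moreover have "G \<subseteq> A" unfolding G_def by auto
  ultimately show "set_filter G" "F \<subseteq> G" "X \<in> G"
    using FD(2) unfolding set_filter_def by blast+
qed

lemma maximal_set_filter:
  assumes "set_filter P" "\<And>F. set_filter F \<Longrightarrow> P \<subseteq> F \<Longrightarrow> F = P"
  shows "set_ultrafilter P"
  unfolding set_ultrafilter_def using assms set_filter_extend[OF assms(1)] by metis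

lemma set_ultrafilter_exists:
  assumes "S \<notin> I"
  obtains P where "set_ultrafilter P"
proof -
  \<comment> \<open>Zorn's lemma needs a nonempty family of filters; the sets with complement in the
    ideal provide its first member.\<close>
  have "set_filter {X \<in> A. S - X \<in> I}" unfolding set_filter_def
  proof (intro conjI ballI impI)
    show "{X \<in> A. S - X \<in> I} \<inter> I = {}"
      using assms ideal_Un ideal_subset[of "S - X \<union> X" S for X] by blast
    fix X Y assume X: "X \<in> {X \<in> A. S - X \<in> I}"
    { assume Y: "Y \<in> {X \<in> A. S - X \<in> I}"
      with X have "S - X \<union> (S - Y) \<in> I" by (simp add: ideal_Un)
      with X Y show "X \<inter> Y \<in> {X \<in> A. S - X \<in> I}" by (simp add: Diff_Int Int) }
    assume "Y \<in> A" "X - Y \<in> I"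
    with X show "Y \<in> {X \<in> A. S - X \<in> I}" using diff_trans by blast
  qed (use ideal_empty in auto)
  then have "\<exists>M\<in>{F. set_filter F}. \<forall>X\<in>{F. set_filter F}. M \<subseteq> X \<longrightarrow> X = M"
  proof (intro subset_Zorn_nonempty)
    fix C assume C: "C \<noteq> {}" "subset.chain {F. set_filter F} C"
    show "\<Union>C \<in> {F. set_filter F}" unfolding set_filter_def mem_Collect_eq
    proof (intro conjI ballI impI)
      have sf: "set_filter F" if "F \<in> C" for F
        using C that unfolding subset.chain_def by auto
      show "\<Union> C \<subseteq> A" "S \<in> \<Union> C" "\<Union> C \<inter> I = {}"
        using C(1) set_filterD(1-3)[OF sf] by blast+
      fix X Y assume X: "X \<in> \<Union>C"
      { assume Y: "Y \<in> \<Union>C"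
        then obtain F G where FG: "X \<in> F" "F \<in> C" "Y \<in> G" "G \<in> C" using X by blast
        have "F \<subseteq> G \<or> G \<subseteq> F" using FG C(2) unfolding subset.chain_def by blast
        then show "X \<inter> Y \<in> \<Union>C"
          using FG set_filterD(4)[OF sf, of F X Y] set_filterD(4)[OF sf, of G X Y] by blast }
      assume "Y \<in> A" "X - Y \<in> I"
      then show "Y \<in> \<Union> C" using X set_filterD(5)[OF sf] by blast
    qed
  qed auto
  then show thesis using that maximal_set_filter by blast
qed

lemma proper_filter_iff:
  "proper_filter Q U \<longleftrightarrow> (\<exists>F. set_filter F \<and> U = cls ` F)"
proof
  assume U: "proper_filter Q U"
  let ?F = "{X \<in> A. cls X \<in> U}"
  have "U = cls ` ?F"
  proof -
    have "u \<in> cls ` ?F" if "u \<in> U" for u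
    proof -
      have "u \<in> carrier Q" using U that unfolding proper_filter_def by auto
      then obtain X where "X \<in> A" "u = cls X" using carrier_Q by blast
      then show ?thesis using that by blast
    qed
    then show ?thesis by blast
  qed
  moreover have "set_filter ?F" unfolding set_filter_def
  proof (intro conjI ballI impI)
    show "S \<in> ?F" using U top unfolding proper_filter_def by (simp add: top_Q)
    have "cls {} \<notin> U" using U unfolding proper_filter_def by (simp add: bottom_Q)
    moreover have "cls X = cls {}" if "X \<in> A" "X \<in> I" for X
      using that cls_eq_iff[OF that(1) empty_sets] ideal_subset[OF that(2)] ideal_empty by auto
    ultimately show "?F \<inter> I = {}" by auto
    fix X Y assume X: "X \<in> ?F"
    { assume Y: "Y \<in> ?F"
      have "\<And>x y. x \<in> U \<Longrightarrow> y \<in> U \<Longrightarrow> x \<sqinter>\<^bsub>Q\<^esub> y \<in> U" using U unfolding proper_filter_def by blast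
      from this[of "cls X" "cls Y"] show "X \<inter> Y \<in> ?F" using X Y meet_Q[of X Y] Int by simp }
    assume Y: "Y \<in> A" "X - Y \<in> I"
    have "\<And>x y. x \<in> U \<Longrightarrow> y \<in> carrier Q \<Longrightarrow> x \<sqsubseteq>\<^bsub>Q\<^esub> y \<Longrightarrow> y \<in> U"
      using U unfolding proper_filter_def by blast
    from this[of "cls X" "cls Y"] show "Y \<in> ?F" using X Y le_Q[of X Y] cls_carrier[of Y] by simp
  qed auto
  ultimately show "\<exists>F. set_filter F \<and> U = cls ` F" by blast
next
  assume "\<exists>F. set_filter F \<and> U = cls ` F"
  then obtain F where F: "set_filter F" and U: "U = cls ` F" by blast
  note FD = set_filterD[OF F]
  show "proper_filter Q U" unfolding proper_filter_def
  proof (intro conjI ballI impI)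
    show "U \<subseteq> carrier Q" using FD(1) cls_carrier U by blast
    show "\<top>\<^bsub>Q\<^esub> \<in> U" using FD(2) U by (simp add: top_Q)
    show "\<bottom>\<^bsub>Q\<^esub> \<notin> U"
      using FD(1,3) U cls_eq_iff[OF empty_sets] by (auto simp: bottom_Q)
    fix x y assume x: "x \<in> U"
    { assume y: "y \<in> U"
      show "x \<sqinter>\<^bsub>Q\<^esub> y \<in> U" using x y U FD(1,4) by (force simp: meet_Q) }
    assume y: "y \<in> carrier Q" "x \<sqsubseteq>\<^bsub>Q\<^esub> y"
    then obtain Y where Y: "Y \<in> A" "y = cls Y" by (auto simp: carrier_Q)
    obtain X where X: "X \<in> F" "x = cls X" using x U by blast
    then have "X - Y \<in> I" using y(2) Y le_Q FD(1) by blast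
    then show "y \<in> U" using FD(5) X Y U by blast
  qed
qed

lemma cls_mem_iff: "set_filter F \<Longrightarrow> X \<in> A \<Longrightarrow> cls X \<in> cls ` F \<longleftrightarrow> X \<in> F"
  using set_filterD cls_eq_iff by blast

lemma cls_image_mono:
  assumes "set_filter F" "set_filter G"
  shows "cls ` F \<subseteq> cls ` G \<longleftrightarrow> F \<subseteq> G"
proof (intro iffI subsetI)
  fix X assume "cls ` F \<subseteq> cls ` G" "X \<in> F"
  then have "cls X \<in> cls ` G" by blast
  then show "X \<in> G" using cls_mem_iff[OF assms(2)] set_filterD(1)[OF assms(1) \<open>X \<in> F\<close>] by blast
qed (rule subsetD[OF image_mono])

text \<open>By \<open>cls_image_mono\<close> inclusion of filters is the same relation on both
  sides, so maximality transfers; a saturated family is maximal exactly when it decides every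
  set.\<close>

lemma ultrafilter_iff:
  "ultrafilter Q U \<longleftrightarrow> (\<exists>P. set_ultrafilter P \<and> U = cls ` P)"
proof
  assume U: "ultrafilter Q U"
  then obtain P where P: "set_filter P" "U = cls ` P"
    unfolding ultrafilter_def proper_filter_iff by blast
  have "F = P" if F: "set_filter F" "P \<subseteq> F" for F
  proof -
    have "proper_filter Q (cls ` F)" using F unfolding proper_filter_iff by blast
    then have "cls ` F = cls ` P"
      using U F P unfolding ultrafilter_def by (metis image_mono)
    then show ?thesis using cls_image_mono[OF F(1) P(1)] F(2) by blast
  qed
  then show "\<exists>P. set_ultrafilter P \<and> U = cls ` P" using P maximal_set_filter by blast
next
  assume "\<exists>P. set_ultrafilter P \<and> U = cls ` P"
  then obtain P where P: "set_ultrafilter P" and U: "U = cls ` P" by blast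
  note PD = set_ultrafilterD[OF P]
  show "ultrafilter Q U" unfolding ultrafilter_def
  proof (intro conjI allI impI)
    show "proper_filter Q U" using PD U unfolding proper_filter_iff by blast
    fix F' assume F': "proper_filter Q F' \<and> U \<subseteq> F'"
    then obtain F where F: "set_filter F" "F' = cls ` F" unfolding proper_filter_iff by blast
    then have "P \<subseteq> F" using F' U cls_image_mono[OF PD(1) F(1)] by blast
    have "X \<in> P" if "X \<in> F" for X
    proof (rule ccontr)
      assume "X \<notin> P"
      then have "S - X \<in> F" using PD(2) set_filterD(1)[OF F(1) that] \<open>P \<subseteq> F\<close> by blast
      then have "X \<inter> (S - X) \<in> F" using that set_filterD(4)[OF F(1)] by blast
      then show False using set_filterD(3)[OF F(1)] ideal_empty by auto
    qed
    then show "F' = U" using \<open>P \<subseteq> F\<close> F U by blast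
  qed
qed

lemma principal_iff:
  assumes P: "set_filter P"
  shows "principal Q (cls ` P) \<longleftrightarrow> \<not> nonprincipal P"
proof
  assume "principal Q (cls ` P)"
  then obtain X where X: "X \<in> A" "cls ` P = {x \<in> carrier Q. cls X \<sqsubseteq>\<^bsub>Q\<^esub> x}"
    unfolding principal_def by (auto simp: carrier_Q)
  have *: "X - Y \<in> I \<longleftrightarrow> Y \<in> P" if "Y \<in> A" for Y
    using that X le_Q[OF X(1) that] cls_mem_iff[OF P that] cls_carrier[OF that] by auto
  then have "X \<in> P" using X(1) ideal_empty *[of X] by simp
  then show "\<not> nonprincipal P"
    using * set_filterD(1)[OF P] unfolding nonprincipal_def by blast
next
  assume "\<not> nonprincipal P"
  then obtain X where X: "X \<in> P" "\<And>Y. Y \<in> P \<Longrightarrow> X - Y \<in> I" unfolding nonprincipal_def by blast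
  then have "X \<in> A" using set_filterD(1)[OF P] by blast
  have "cls ` P = {x \<in> carrier Q. cls X \<sqsubseteq>\<^bsub>Q\<^esub> x}"
  proof (intro equalityI subsetI)
    fix y assume "y \<in> cls ` P"
    then obtain Y where Y: "Y \<in> P" "y = cls Y" by blast
    then show "y \<in> {x \<in> carrier Q. cls X \<sqsubseteq>\<^bsub>Q\<^esub> x}"
      using X(2)[OF Y(1)] le_Q[OF \<open>X \<in> A\<close>] cls_carrier set_filterD(1)[OF P] by simp
  next
    fix y assume y: "y \<in> {x \<in> carrier Q. cls X \<sqsubseteq>\<^bsub>Q\<^esub> x}"
    then obtain Y where Y: "Y \<in> A" "y = cls Y" using carrier_Q by blast
    then have "X - Y \<in> I" using y le_Q[OF \<open>X \<in> A\<close> Y(1)] by simp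
    then show "y \<in> cls ` P" using set_filterD(5)[OF P X(1) Y(1)] Y(2) by blast
  qed
  then show "principal Q (cls ` P)"
    using cls_carrier[OF \<open>X \<in> A\<close>] unfolding principal_def by blast
qed

lemma cofinal_cls:
  assumes P: "set_filter P" and "D \<subseteq> P"
  shows "cofinal_in (cls ` P) (\<lambda>x y. y \<sqsubseteq>\<^bsub>Q\<^esub> x) (cls ` D) \<longleftrightarrow> filter_base P D"
  using assms le_Q set_filterD(1)[OF P] unfolding cofinal_in_def filter_base_def
  by (auto simp: subset_iff)

lemma ultrafilter_number_le:
  assumes P: "set_ultrafilter P" "nonprincipal P" and D: "filter_base P D"
  shows "ultrafilter_number Q \<le>o |D|"
proof -
  have P': "set_filter P" using P(1) by (rule set_ultrafilterD)
  \<comment> \<open>\<open>min_card\<close> is meaningful only for cardinal orders, so each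
    \<open>cof\<close> in the family has to be recognised as one. An ultrafilter is a base of
    itself, hence its \<open>cof\<close> is attained by a set.\<close>
  have "cofinal_in U R U" if "U = cls ` P" "R = (\<lambda>x y. y \<sqsubseteq>\<^bsub>Q\<^esub> x)" "set_filter P" for U R P
    unfolding that using cofinal_cls[OF that(3) order_refl] ideal_empty
    by (force simp: filter_base_def)
  then have "Card_order (cof U (\<lambda>x y. y \<sqsubseteq>\<^bsub>Q\<^esub> x))" if "ultrafilter Q U" for U
    using that cof_attained card_of_Card_order unfolding ultrafilter_iff
    by (metis set_ultrafilterD(1))
  moreover have "ultrafilter Q (cls ` P)" "\<not> principal Q (cls ` P)"
    using P principal_iff[OF P'] ultrafilter_iff by auto
  ultimately have "ultrafilter_number Q \<le>o cof (cls ` P) (\<lambda>x y. y \<sqsubseteq>\<^bsub>Q\<^esub> x)"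
    unfolding ultrafilter_number_def by (intro min_card(2)) auto
  also have "cof (cls ` P) (\<lambda>x y. y \<sqsubseteq>\<^bsub>Q\<^esub> x) \<le>o |cls ` D|"
    using D cofinal_cls[OF P', of D] by (auto simp: filter_base_def intro!: cof_le)
  also have "|cls ` D| \<le>o |D|" by (rule card_of_image)
  finally show ?thesis .
qed

lemma ultrafilter_number_attained:
  assumes "set_ultrafilter P0" "nonprincipal P0"
  obtains P D where "set_ultrafilter P" "nonprincipal P" "filter_base P D"
    "|D| \<le>o ultrafilter_number Q"
proof -
  let ?R = "\<lambda>x y. y \<sqsubseteq>\<^bsub>Q\<^esub> x"
  have refl: "cofinal_in (cls ` P) ?R (cls ` P)" if "set_filter P" for P
    using cofinal_cls[OF that order_refl] ideal_empty by (force simp: filter_base_def)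
  have co: "Card_order (cof U ?R)" if "ultrafilter Q U" for U
    using that cof_attained card_of_Card_order refl unfolding ultrafilter_iff
    by (metis set_ultrafilterD(1))
  have "ultrafilter Q (cls ` P0)" "\<not> principal Q (cls ` P0)"
    using assms principal_iff[OF set_ultrafilterD(1)] ultrafilter_iff by auto
  then have "ultrafilter_number Q \<in> {cof U ?R | U. ultrafilter Q U \<and> \<not> principal Q U}"
    unfolding ultrafilter_number_def using co by (intro min_card(1)) auto
  then obtain P where P: "set_ultrafilter P" "\<not> principal Q (cls ` P)"
      "ultrafilter_number Q = cof (cls ` P) ?R"
    unfolding ultrafilter_iff by blast
  then have P': "set_filter P" by (simp add: set_ultrafilterD)
  obtain C where C: "cofinal_in (cls ` P) ?R C" "cof (cls ` P) ?R = |C|"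
    using cof_attained[OF refl[OF P']] .
  then have "C \<subseteq> cls ` P" by (simp add: cofinal_in_def)
  \<comment> \<open>Choosing one representative per class keeps the base from growing.\<close>
  then obtain D where D: "D \<subseteq> P" "C = cls ` D" "inj_on cls D"
    by (auto elim: subset_image_inj[THEN iffD1, THEN exE])
  have "bij_betw cls D C" using D by (simp add: bij_betw_def)
  then have "|D| =o |C|" using card_of_ordIsoI by blast
  then have "|D| \<le>o ultrafilter_number Q" using P(3) C(2) ordIso_imp_ordLeq by simp
  then show thesis
    using that[OF P(1)] P(2) principal_iff[OF P'] C(1) D cofinal_cls[OF P' D(1)] by auto
qed

end

section \<open>The sigma-algebra of a Cantor space\<close>

lemma topspace_cantor_space: "topspace (cantor_space A) = PiE A (\<lambda>_. UNIV)"
  by (simp add: cantor_space_def)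

lemma topspace_cantor_space_UNIV [simp]: "topspace (cantor_space UNIV) = UNIV"
  by (simp add: topspace_cantor_space)

text \<open>A basic box restricts only finitely many coordinates, and since the factors are discrete
  it can be shrunk to the box that fixes those coordinates to the values of
  \<open>x\<close>.\<close>

lemma openin_cantor_space:
  "openin (cantor_space A) X \<longleftrightarrow> X \<subseteq> topspace (cantor_space A) \<and>
     (\<forall>x\<in>X. \<exists>F. finite F \<and> F \<subseteq> A \<and> {y \<in> topspace (cantor_space A). \<forall>i\<in>F. y i = x i} \<subseteq> X)"
proof (intro iffI conjI ballI)
  assume X: "openin (cantor_space A) X"
  show "X \<subseteq> topspace (cantor_space A)" using X by (rule openin_subset)
  fix x assume "x \<in> X"
  then obtain U where U: "finite {i \<in> A. U i \<noteq> UNIV}" "x \<in> Pi\<^sub>E A U" "Pi\<^sub>E A U \<subseteq> X"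
    using X by (auto simp: cantor_space_def openin_product_topology_alt)
  have "{y \<in> topspace (cantor_space A). \<forall>i\<in>{i \<in> A. U i \<noteq> UNIV}. y i = x i} \<subseteq> Pi\<^sub>E A U"
  proof
    fix y assume y: "y \<in> {y \<in> topspace (cantor_space A). \<forall>i\<in>{i \<in> A. U i \<noteq> UNIV}. y i = x i}"
    show "y \<in> Pi\<^sub>E A U"
    proof (rule PiE_I)
      show "y i \<in> U i" if "i \<in> A" for i
        using y that PiE_mem[OF U(2) that] by (cases "U i = UNIV") auto
      show "y i = undefined" if "i \<notin> A" for i
        using y that PiE_arb[of y A "\<lambda>_. UNIV" i] unfolding topspace_cantor_space by blast
    qed
  qed
  with U show "\<exists>F. finite F \<and> F \<subseteq> A \<and> {y \<in> topspace (cantor_space A). \<forall>i\<in>F. y i = x i} \<subseteq> X"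
    by (intro exI[of _ "{i \<in> A. U i \<noteq> UNIV}"]) auto
next
  assume X: "X \<subseteq> topspace (cantor_space A) \<and> (\<forall>x\<in>X. \<exists>F. finite F \<and> F \<subseteq> A \<and>
    {y \<in> topspace (cantor_space A). \<forall>i\<in>F. y i = x i} \<subseteq> X)"
  show "openin (cantor_space A) X"
    unfolding cantor_space_def openin_product_topology_alt
  proof
    fix x assume x: "x \<in> X"
    then obtain F where F: "finite F" "F \<subseteq> A"
      "{y \<in> topspace (cantor_space A). \<forall>i\<in>F. y i = x i} \<subseteq> X" using X by blast
    have "x \<in> extensional A" using x X by (auto simp: topspace_cantor_space PiE_iff)
    let ?U = "\<lambda>i. if i \<in> F then {x i} else UNIV"
    have "finite {i \<in> A. ?U i \<noteq> UNIV}" by (rule finite_subset[OF _ F(1)]) auto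
    moreover have "Pi\<^sub>E A ?U \<subseteq> X"
    proof
      fix y assume y: "y \<in> Pi\<^sub>E A ?U"
      have "y \<in> topspace (cantor_space A)"
        unfolding topspace_cantor_space using y by (auto simp: PiE_iff)
      moreover have "y i = x i" if "i \<in> F" for i
        using PiE_mem[OF y, of i] that F(2) by auto
      ultimately show "y \<in> X" using F(3) by blast
    qed
    moreover have "x \<in> Pi\<^sub>E A ?U" using \<open>x \<in> extensional A\<close> by (auto simp: PiE_iff)
    ultimately show "\<exists>U. finite {i \<in> A. U i \<noteq> topspace (discrete_topology UNIV)} \<and>
        (\<forall>i\<in>A. openin (discrete_topology UNIV) (U i)) \<and> x \<in> Pi\<^sub>E A U \<and> Pi\<^sub>E A U \<subseteq> X"
      by (intro exI[of _ ?U]) auto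
  qed
qed

lemma sigma_algebra_clopen_sigma: "sigma_algebra (topspace (cantor_space A)) (clopen_sigma A)"
  unfolding clopen_sigma_def
  by (rule sigma_algebra_sigma_sets) (use openin_subset in blast)

lemma clopen_sigma_basic: "openin (cantor_space A) X \<Longrightarrow> closedin (cantor_space A) X \<Longrightarrow> X \<in> clopen_sigma A"
  unfolding clopen_sigma_def by (rule sigma_sets.Basic) simp

lemma clopen_coordinate:
  assumes "i \<in> A"
  shows "openin (cantor_space A) {x \<in> topspace (cantor_space A). x i = e}"
    "closedin (cantor_space A) {x \<in> topspace (cantor_space A). x i = e}"
proof -
  show o: "openin (cantor_space A) {x \<in> topspace (cantor_space A). x i = e}" for e
    unfolding openin_cantor_space
    by (intro conjI ballI exI[of _ "{i}"]) (use assms in auto)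
  have "topspace (cantor_space A) - {x \<in> topspace (cantor_space A). x i = e} =
      {x \<in> topspace (cantor_space A). x i = (\<not> e)}" by auto
  then show "closedin (cantor_space A) {x \<in> topspace (cantor_space A). x i = e}"
    unfolding closedin_def using o[of "\<not> e"] by auto
qed

lemma coordinate_in_clopen_sigma:
  "i \<in> A \<Longrightarrow> {x \<in> topspace (cantor_space A). x i = e} \<in> clopen_sigma A"
  by (intro clopen_sigma_basic clopen_coordinate)

text \<open>By compactness a clopen set is a finite union of sets fixing finitely many coordinates.
  Inductions over the algebra may therefore start from the coordinate sets.\<close>

lemma clopen_sigma_coordinates:
  "clopen_sigma A \<subseteq> sigma_sets (topspace (cantor_space A))
     ((\<lambda>i. {x \<in> topspace (cantor_space A). x i}) ` A)"
    (is "_ \<subseteq> sigma_sets ?T ?G")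
  unfolding clopen_sigma_def
proof (rule sigma_sets_mono, rule subsetI)
  interpret sigma_algebra ?T "sigma_sets ?T ?G" by (rule sigma_algebra_sigma_sets) auto
  have co: "{x \<in> ?T. x i = e} \<in> sigma_sets ?T ?G" if "i \<in> A" for i e
  proof -
    have 1: "{x \<in> ?T. x i} \<in> sigma_sets ?T ?G" using that by blast
    then have "?T - {x \<in> ?T. x i} \<in> sigma_sets ?T ?G" by (rule compl_sets)
    moreover have "?T - {x \<in> ?T. x i} = {x \<in> ?T. \<not> x i}" by auto
    ultimately show ?thesis using 1 by (cases e) auto
  qed
  have ba: "{y \<in> ?T. \<forall>i\<in>F. y i = x i} \<in> sigma_sets ?T ?G" if "finite F" "F \<subseteq> A" for F x
    using that
  proof (induction F)
    case (insert j F)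
    then have "{y \<in> ?T. \<forall>i\<in>F. y i = x i} \<inter> {y \<in> ?T. y j = x j} \<in> sigma_sets ?T ?G"
      by (intro Int co) auto
    moreover have "{y \<in> ?T. \<forall>i\<in>insert j F. y i = x i} =
        {y \<in> ?T. \<forall>i\<in>F. y i = x i} \<inter> {y \<in> ?T. y j = x j}" by auto
    ultimately show ?case by simp
  qed (use top in simp)
  fix X assume "X \<in> {X. openin (cantor_space A) X \<and> closedin (cantor_space A) X}"
  then have X: "openin (cantor_space A) X" "closedin (cantor_space A) X" by auto
  have "compact_space (cantor_space A)"
    unfolding cantor_space_def by (simp add: compact_space_product_topology compact_space_discrete_topology)
  then have cp: "compactin (cantor_space A) X" using X(2) by (rule closedin_compact_space)
  have "\<forall>x\<in>X. \<exists>F. finite F \<and> F \<subseteq> A \<and> {y \<in> ?T. \<forall>i\<in>F. y i = x i} \<subseteq> X"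
    using X(1) unfolding openin_cantor_space by (rule conjunct2)
  then obtain F where F: "\<forall>x\<in>X. finite (F x) \<and> F x \<subseteq> A \<and> {y \<in> ?T. \<forall>i\<in>F x. y i = x i} \<subseteq> X"
    by (rule bchoice[THEN exE])
  let ?U = "\<lambda>x. {y \<in> ?T. \<forall>i\<in>F x. y i = x i}"
  have "openin (cantor_space A) (?U x)" if "x \<in> X" for x
    unfolding openin_cantor_space using F that
    by (intro conjI ballI exI[of _ "F x"]) auto
  moreover have "X \<subseteq> \<Union>(?U ` X)" using openin_subset[OF X(1)] by auto
  moreover have "\<And>\<U>. (\<forall>U\<in>\<U>. openin (cantor_space A) U) \<and> X \<subseteq> \<Union>\<U> \<Longrightarrow> \<exists>\<F>. finite \<F> \<and> \<F> \<subseteq> \<U> \<and> X \<subseteq> \<Union>\<F>"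
    using cp unfolding compactin_def by simp
  ultimately obtain \<F> where \<F>: "finite \<F>" "\<F> \<subseteq> ?U ` X" "X \<subseteq> \<Union>\<F>" by (metis (no_types, lifting) imageE)
  have "Y \<subseteq> X" if Y: "Y \<in> \<F>" for Y
  proof -
    obtain x where "x \<in> X" "Y = ?U x" using \<F>(2) Y by blast
    then show ?thesis using F by simp
  qed
  then have "X = \<Union>\<F>" using \<F>(3) by (intro equalityI Sup_least) auto
  moreover have "\<F> \<subseteq> sigma_sets ?T ?G"
  proof
    fix Y assume Y: "Y \<in> \<F>"
    obtain x where "x \<in> X" "Y = ?U x" using \<F>(2) Y by blast
    then show "Y \<in> sigma_sets ?T ?G" using F ba by simp
  qed
  ultimately show "X \<in> sigma_sets ?T ?G" using \<F>(1) by blast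
qed

section \<open>Borel codes and the size of the algebra\<close>

datatype 'i borel_code = CoordC 'i | ComplC "'i borel_code" | UnionC "nat \<Rightarrow> 'i borel_code"

primrec decode :: "'i set \<Rightarrow> 'i borel_code \<Rightarrow> ('i \<Rightarrow> bool) set" where
  "decode A (CoordC i) = {x \<in> topspace (cantor_space A). x i}"
| "decode A (ComplC t) = topspace (cantor_space A) - decode A t"
| "decode A (UnionC t) = (\<Union>n. decode A (t n))"

text \<open>A code is determined by the labels of its nodes, listed by path; the three constructors have
  distinguishable labels.\<close>

primrec labels :: "nat set borel_code \<Rightarrow> nat list \<Rightarrow> nat set" where
  "labels (CoordC a) = (\<lambda>p. insert 0 (Suc ` a))"
| "labels (ComplC t) = (\<lambda>p. case p of [] \<Rightarrow> {} | n # q \<Rightarrow> labels t q)"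
| "labels (UnionC t) = (\<lambda>p. case p of [] \<Rightarrow> {1} | n # q \<Rightarrow> labels (t n) q)"

text \<open>The root label reveals the constructor: it contains 0, is empty, or is
  \<open>{1}\<close>. The labels below the root are those of the subtrees, so induction
  applies.\<close>

lemma labels_inject: "labels s = labels t \<Longrightarrow> s = t"
proof (induction s arbitrary: t)
  case (CoordC a)
  then have "labels t [] = insert 0 (Suc ` a)" by (metis labels.simps(1))
  moreover have "(insert 0 (Suc ` a) = insert 0 (Suc ` b)) \<longleftrightarrow> a = b" for a b
  proof -
    have "insert 0 (Suc ` a) = insert 0 (Suc ` b) \<Longrightarrow> Suc ` a = Suc ` b" by auto
    then show ?thesis by (metis inj_Suc inj_image_eq_iff)
  qed
  ultimately show ?case by (cases t) auto
next
  case (ComplC s)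
  have 0: "labels t [] = {}" using ComplC.prems by (metis labels.simps(2) list.simps(4))
  then obtain t' where t: "t = ComplC t'" by (cases t) auto
  have "labels s q = labels t' q" for q
    using fun_cong[OF ComplC.prems, of "0 # q"] t by simp
  then show ?case using ComplC.IH t by blast
next
  case (UnionC s)
  have 0: "labels t [] = {1}" using UnionC.prems by (metis labels.simps(3) list.simps(4))
  then obtain t' where t: "t = UnionC t'" by (cases t) auto
  have "labels (s n) q = labels (t' n) q" for n q
    using fun_cong[OF UnionC.prems, of "n # q"] t by simp
  then have "s n = t' n" for n using UnionC.IH[of "s n" "t' n"] by blast
  then show ?case using t by blast
qed

lemma sigma_sets_decode:
  assumes "A \<noteq> {}" "X \<in> sigma_sets (topspace (cantor_space A)) ((\<lambda>i. {x \<in> topspace (cantor_space A). x i}) ` A)"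
  shows "X \<in> range (decode A)"
  using assms(2)
proof induction
  case (Basic a)
  then obtain i where "a = decode A (CoordC i)" by auto
  then show ?case by blast
next
  case Empty
  obtain i where "i \<in> A" using assms(1) by blast
  \<comment> \<open>No constructor codes the empty set, so it is written as the complement of a
    coordinate set united with its own complement.\<close>
  define t where "t = UnionC (\<lambda>n. if n = 0 then CoordC i else ComplC (CoordC i))"
  have "decode A (ComplC t) = {}"
  proof -
    have "x \<in> decode A t" if "x \<in> topspace (cantor_space A)" for x
    proof (cases "x i")
      case True
      then show ?thesis unfolding t_def using that by (auto intro!: exI[of _ 0])
    next
      case False
      then show ?thesis unfolding t_def using that by (auto intro!: exI[of _ 1])
    qed
    then show ?thesis by auto
  qed
  then show ?case by blast
next
  case (Compl a)
  then obtain t where "a = decode A t" by blast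
  then have "topspace (cantor_space A) - a = decode A (ComplC t)" by simp
  then show ?case by blast
next
  case (Union a)
  then have "\<forall>n. \<exists>t. a n = decode A t" by blast
  then obtain t where "\<And>n. a n = decode A (t n)" by metis
  then have "(\<Union>n. a n) = decode A (UnionC t)" by simp
  then show ?case by blast
qed

lemma continuum_eq: "continuum = |UNIV :: (nat \<Rightarrow> bool) set|"
  unfolding continuum_def cexp_def ctwo_def Func_def by (simp add: Field_natLeq Field_card_of)

lemma card_clopen_sigma_le_continuum:
  fixes A :: "nat set set"
  assumes "A \<noteq> {}"
  shows "|clopen_sigma A| \<le>o continuum"
proof -
  have "clopen_sigma A \<subseteq> range (decode A)"
    using clopen_sigma_coordinates sigma_sets_decode[OF assms] by blast
  then have 1: "|clopen_sigma A| \<le>o |UNIV :: nat set borel_code set|"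
    using card_of_ordLeq2 by (metis card_of_image card_of_mono1 ordLeq_transitive)
  \<comment> \<open>A labelling is a set of pairs of a path and a number; there are countably many
    pairs, so this is a point of \<open>nat \<Rightarrow> bool\<close>.\<close>
  define g :: "nat set borel_code \<Rightarrow> nat \<Rightarrow> bool"
    where "g t k = (case from_nat k of (p, n) \<Rightarrow> n \<in> labels t p)" for t k
  have "inj g"
  proof (rule injI, rule labels_inject, rule ext)
    fix s t p assume st: "g s = g t"
    have "n \<in> labels s p \<longleftrightarrow> n \<in> labels t p" for n
      using fun_cong[OF st, of "to_nat (p, n)"] by (simp add: g_def)
    then show "labels s p = labels t p" by blast
  qed
  then have "|UNIV :: nat set borel_code set| \<le>o |UNIV :: (nat \<Rightarrow> bool) set|"
    using card_of_ordLeq by blast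
  with 1 show ?thesis unfolding continuum_eq by (rule ordLeq_transitive)
qed

section \<open>Ideals on Cantor space and their lifts\<close>

text \<open>What category and measure share. \<open>pullback\<close> and \<open>pullback_rev\<close>
  allow renaming of coordinates along an injection; \<open>essential_union\<close> stands in for the
  countable chain condition and provides suprema in the quotient.\<close>

locale cantor_ideal =
  fixes I :: "(nat \<Rightarrow> bool) set set"
  assumes sub: "\<And>X Y. X \<in> I \<Longrightarrow> Y \<subseteq> X \<Longrightarrow> Y \<in> I"
    and countable_UN: "\<And>X. (\<And>n::nat. X n \<in> I) \<Longrightarrow> (\<Union>n. X n) \<in> I"
    and singleton: "\<And>z. {z} \<in> I"
    and UNIV_notin: "UNIV \<notin> I"
    and pullback: "\<And>e Y. inj e \<Longrightarrow> Y \<in> I \<Longrightarrow> {g. g \<circ> e \<in> Y} \<in> I"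
    and pullback_rev: "\<And>e X. inj e \<Longrightarrow> X \<in> clopen_sigma UNIV \<Longrightarrow> {g. g \<circ> e \<in> X} \<in> I \<Longrightarrow> X \<in> I"
    and essential_union: "\<And>B. B \<subseteq> clopen_sigma UNIV \<Longrightarrow> {} \<in> B \<Longrightarrow>
       (\<And>X. (\<And>n::nat. X n \<in> B) \<Longrightarrow> (\<Union>n. X n) \<in> B) \<Longrightarrow>
       (\<And>X Y. X \<in> clopen_sigma UNIV \<Longrightarrow> X - Y \<in> I \<Longrightarrow> Y \<in> B \<Longrightarrow> X \<in> B) \<Longrightarrow>
       \<exists>S\<in>B. \<forall>X\<in>B. X - S \<in> I"
begin

lemma empty_in: "{} \<in> I"
  using sub singleton by blast

lemma Un_in: "X \<in> I \<Longrightarrow> Y \<in> I \<Longrightarrow> X \<union> Y \<in> I"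
  using countable_UN[of "\<lambda>n. if n = 0 then X else Y"] by (rule sub) (auto split: if_splits)

end

locale cantor_ideal_at = cantor_ideal I for I +
  fixes A :: "'i set"
  assumes infinite_index: "infinite A"
begin

lemma ideal_at_subset: "X \<in> ideal_at I A \<Longrightarrow> Y \<subseteq> X \<Longrightarrow> Y \<in> ideal_at I A"
  unfolding ideal_at_def by blast

text \<open>An exceptional set for one injection is moved by \<open>pullback\<close> to any
  injection with larger range. Countably many witnesses can thus be traded for a single one.\<close>

lemma ideal_at_witness:
  assumes X: "X \<in> ideal_at I A"
  obtains \<Delta>1 :: "nat \<Rightarrow> 'i" where "inj \<Delta>1" "range \<Delta>1 \<subseteq> A"
    "\<And>\<Delta>. inj \<Delta> \<Longrightarrow> range \<Delta>1 \<subseteq> range \<Delta> \<Longrightarrow> \<exists>Y\<in>I. \<forall>f\<in>X. f \<circ> \<Delta> \<in> Y"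
proof -
  obtain \<Delta>1 Y where Y: "inj \<Delta>1" "range \<Delta>1 \<subseteq> A" "Y \<in> I" "\<forall>f\<in>X. f \<circ> \<Delta>1 \<in> Y"
    using X unfolding ideal_at_def by blast
  have "\<exists>Y\<in>I. \<forall>f\<in>X. f \<circ> \<Delta> \<in> Y" if \<Delta>: "inj \<Delta>" "range \<Delta>1 \<subseteq> range \<Delta>" for \<Delta> :: "nat \<Rightarrow> 'i"
  proof -
    define e where "e n = inv \<Delta> (\<Delta>1 n)" for n
    have e: "\<Delta> (e n) = \<Delta>1 n" for n
      unfolding e_def using \<Delta>(2) by (intro f_inv_into_f) auto
    have "inj e" using e Y(1) by (metis injD injI)
    then have "{g. g \<circ> e \<in> Y} \<in> I" using Y(3) by (rule pullback)
    moreover have "(f \<circ> \<Delta>) \<circ> e = f \<circ> \<Delta>1" for f :: "'i \<Rightarrow> bool" using e by (auto simp: fun_eq_iff)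
    ultimately show ?thesis using Y(4) by (intro bexI[of _ "{g. g \<circ> e \<in> Y}"]) auto
  qed
  then show thesis by (rule that[OF Y(1,2)])
qed

lemma injection_exists: obtains \<Delta> :: "nat \<Rightarrow> 'i" where "inj \<Delta>" "range \<Delta> \<subseteq> A"
  using infinite_countable_subset[OF infinite_index] by blast

lemma common_injection:
  assumes "\<And>n::nat. range (d n :: nat \<Rightarrow> 'i) \<subseteq> A"
  obtains \<Delta> :: "nat \<Rightarrow> 'i" where "inj \<Delta>" "range \<Delta> \<subseteq> A" "\<And>n. range (d n) \<subseteq> range \<Delta>"
proof -
  obtain \<Delta>0 :: "nat \<Rightarrow> 'i" where \<Delta>0: "inj \<Delta>0" "range \<Delta>0 \<subseteq> A" using injection_exists .
  define C where "C = range \<Delta>0 \<union> (\<Union>n. range (d n))"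
  have "infinite C" unfolding C_def using \<Delta>0(1) by (simp add: finite_image_iff)
  moreover have "countable C" unfolding C_def by auto
  ultimately have "bij_betw (from_nat_into C) UNIV C" by (intro bij_betw_from_nat_into)
  then have "inj (from_nat_into C)" "range (from_nat_into C) = C"
    by (auto simp: bij_betw_def)
  then show thesis using that[of "from_nat_into C"] assms \<Delta>0(2) unfolding C_def by auto
qed

lemma ideal_at_UN:
  assumes X: "\<And>n::nat. X n \<in> ideal_at I A"
  shows "(\<Union>n. X n) \<in> ideal_at I A"
proof -
  have "\<exists>d::nat \<Rightarrow> 'i. range d \<subseteq> A \<and> (\<forall>\<Delta>. inj \<Delta> \<longrightarrow> range d \<subseteq> range \<Delta> \<longrightarrow> (\<exists>Y\<in>I. \<forall>f\<in>X n. f \<circ> \<Delta> \<in> Y))"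
    for n by (rule ideal_at_witness[OF X[of n]]) blast
  then obtain d :: "nat \<Rightarrow> nat \<Rightarrow> 'i" where d: "\<And>n. range (d n) \<subseteq> A"
      "\<And>n \<Delta>. inj \<Delta> \<Longrightarrow> range (d n) \<subseteq> range \<Delta> \<Longrightarrow> \<exists>Y\<in>I. \<forall>f\<in>X n. f \<circ> \<Delta> \<in> Y"
    by metis
  obtain \<Delta> :: "nat \<Rightarrow> 'i" where \<Delta>: "inj \<Delta>" "range \<Delta> \<subseteq> A" "\<And>n. range (d n) \<subseteq> range \<Delta>"
    by (rule common_injection[of d, OF d(1)]) blast
  then obtain Y where Y: "\<And>n. Y n \<in> I" "\<And>n. \<forall>f\<in>X n. f \<circ> \<Delta> \<in> Y n" using d(2) by metis
  have "X n \<subseteq> topspace (cantor_space A)" for n using X[of n] unfolding ideal_at_def by blast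
  then have "(\<Union>n. X n) \<subseteq> topspace (cantor_space A)" by blast
  moreover have "\<forall>f\<in>(\<Union>n. X n). f \<circ> \<Delta> \<in> (\<Union>n. Y n)" using Y(2) by blast
  ultimately show ?thesis
    unfolding ideal_at_def using \<Delta>(1,2) countable_UN[of Y, OF Y(1)] by blast
qed

lemma ideal_at_empty: "{} \<in> ideal_at I A"
proof -
  obtain \<Delta> :: "nat \<Rightarrow> 'i" where "inj \<Delta>" "range \<Delta> \<subseteq> A" using injection_exists .
  then show ?thesis unfolding ideal_at_def using empty_in by blast
qed

lemma ideal_at_Un: "X \<in> ideal_at I A \<Longrightarrow> Y \<in> ideal_at I A \<Longrightarrow> X \<union> Y \<in> ideal_at I A"
  using ideal_at_UN[of "\<lambda>n. if n = 0 then X else Y"] by (rule ideal_at_subset) (auto split: if_splits)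

sublocale sa: sigma_algebra "topspace (cantor_space A)" "clopen_sigma A"
  by (rule sigma_algebra_clopen_sigma)

sublocale set_algebra_ideal "topspace (cantor_space A)" "clopen_sigma A" "ideal_at I A"
  by unfold_locales (fact ideal_at_empty ideal_at_Un ideal_at_subset)+

lemma extend_point:
  fixes \<Delta> :: "nat \<Rightarrow> 'i"
  assumes "inj \<Delta>" "range \<Delta> \<subseteq> A"
  obtains f where "f \<in> topspace (cantor_space A)" "f \<circ> \<Delta> = g"
proof
  let ?f = "\<lambda>i. if i \<in> A then g (inv \<Delta> i) else undefined"
  show "?f \<in> topspace (cantor_space A)"
    unfolding topspace_cantor_space PiE_def extensional_def by simp
  show "?f \<circ> \<Delta> = g" using assms by (auto simp: fun_eq_iff)
qed

definition lift :: "(nat \<Rightarrow> 'i) \<Rightarrow> (nat \<Rightarrow> bool) set \<Rightarrow> ('i \<Rightarrow> bool) set" where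
  "lift \<Delta> X = {f \<in> topspace (cantor_space A). f \<circ> \<Delta> \<in> X}"

lemma lift_in_clopen_sigma:
  assumes \<Delta>: "range \<Delta> \<subseteq> A" and "X \<in> clopen_sigma UNIV"
  shows "lift \<Delta> X \<in> clopen_sigma A"
proof -
  have "X \<in> sigma_sets UNIV ((\<lambda>i. {x. x i}) ` UNIV)"
    using assms(2) clopen_sigma_coordinates[of UNIV] by auto
  then show ?thesis
  proof induction
    case (Basic a)
    then obtain i where "a = {x. x i}" by blast
    then have "lift \<Delta> a = {f \<in> topspace (cantor_space A). f (\<Delta> i) = True}" by (simp add: lift_def)
    then show ?case using coordinate_in_clopen_sigma[of "\<Delta> i" A True] \<Delta> by auto
  next
    case Empty
    then show ?case by (simp add: lift_def)
  next
    case (Compl a)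
    have "lift \<Delta> (UNIV - a) = topspace (cantor_space A) - lift \<Delta> a" by (auto simp: lift_def)
    then show ?case using Compl by (simp add: sa.compl_sets)
  next
    case (Union a)
    have "lift \<Delta> (\<Union>n. a n) = (\<Union>n. lift \<Delta> (a n))" by (auto simp: lift_def)
    moreover have "(\<Union>n. lift \<Delta> (a n)) \<in> clopen_sigma A"
      by (rule sa.countable_nat_UN) (use Union.IH in auto)
    ultimately show ?case by simp
  qed
qed

text \<open>For the hard direction, enlarge \<open>\<Delta>\<close> and the witnessing injection to
  a common \<open>\<Delta>'\<close>. Every point over \<open>\<omega>\<close> extends to a full
  point, so the exceptional set contains the pullback of \<open>X\<close>, and
  \<open>pullback_rev\<close> applies.\<close>

lemma lift_ideal_iff:
  assumes \<Delta>: "inj \<Delta>" "range \<Delta> \<subseteq> A" and X: "X \<in> clopen_sigma UNIV"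
  shows "lift \<Delta> X \<in> ideal_at I A \<longleftrightarrow> X \<in> I"
proof
  assume "X \<in> I"
  then show "lift \<Delta> X \<in> ideal_at I A"
    using \<Delta> unfolding ideal_at_def lift_def by blast
next
  assume "lift \<Delta> X \<in> ideal_at I A"
  then obtain \<Delta>1 :: "nat \<Rightarrow> 'i" where \<Delta>1: "range \<Delta>1 \<subseteq> A"
    "\<And>\<Delta>'. inj \<Delta>' \<Longrightarrow> range \<Delta>1 \<subseteq> range \<Delta>' \<Longrightarrow> \<exists>Y\<in>I. \<forall>f\<in>lift \<Delta> X. f \<circ> \<Delta>' \<in> Y"
    by (rule ideal_at_witness) blast
  obtain \<Delta>' :: "nat \<Rightarrow> 'i" where \<Delta>': "inj \<Delta>'" "range \<Delta>' \<subseteq> A" "range \<Delta> \<subseteq> range \<Delta>'" "range \<Delta>1 \<subseteq> range \<Delta>'"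
  proof -
    have "range (if n = 0 then \<Delta> else \<Delta>1) \<subseteq> A" for n :: nat using \<Delta>(2) \<Delta>1(1) by auto
    then obtain \<Delta>' :: "nat \<Rightarrow> 'i" where d: "inj \<Delta>'" "range \<Delta>' \<subseteq> A" "\<And>n::nat. range (if n = 0 then \<Delta> else \<Delta>1) \<subseteq> range \<Delta>'"
      using common_injection[of "\<lambda>n. if n = 0 then \<Delta> else \<Delta>1"] by blast
    show thesis using that[OF d(1,2)] d(3)[of 0] d(3)[of 1] by simp
  qed
  obtain Y where Y: "Y \<in> I" "\<forall>f\<in>lift \<Delta> X. f \<circ> \<Delta>' \<in> Y" using \<Delta>1(2)[OF \<Delta>'(1,4)] by blast
  define e where "e n = inv \<Delta>' (\<Delta> n)" for n
  have e: "\<Delta>' (e n) = \<Delta> n" for n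
    unfolding e_def using \<Delta>'(3) by (intro f_inv_into_f) auto
  have "inj e" using e \<Delta>(1) by (metis injD injI)
  moreover have "g \<in> Y" if g: "g \<circ> e \<in> X" for g
  proof -
    obtain f where f: "f \<in> topspace (cantor_space A)" "f \<circ> \<Delta>' = g"
      using extend_point[OF \<Delta>'(1,2)] .
    then have "f (\<Delta> n) = g (e n)" for n using e[of n] by (metis comp_apply)
    then have "f \<circ> \<Delta> = g \<circ> e" by (simp add: fun_eq_iff)
    then show ?thesis using Y(2) f g by (auto simp: lift_def)
  qed
  ultimately show "X \<in> I" using pullback_rev X sub[OF Y(1), of "{g. g \<circ> e \<in> X}"] by blast
qed

lemma space_notin: "topspace (cantor_space A) \<notin> ideal_at I A"
proof
  assume "topspace (cantor_space A) \<in> ideal_at I A"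
  obtain \<Delta> :: "nat \<Rightarrow> 'i" where \<Delta>: "inj \<Delta>" "range \<Delta> \<subseteq> A" using injection_exists .
  have "UNIV \<in> clopen_sigma (UNIV :: nat set)"
    by (rule clopen_sigma_basic) (use openin_topspace[of "cantor_space UNIV"] closedin_topspace[of "cantor_space UNIV"] in simp_all)
  then have "UNIV \<in> I" using lift_ideal_iff[OF \<Delta>, of UNIV] \<open>topspace (cantor_space A) \<in> _\<close>
    by (simp add: lift_def)
  then show False using UNIV_notin by simp
qed

text \<open>A least member modulo the ideal would decide all coordinates along an injection
  \<open>\<Delta>\<close>. It would then lie, up to the ideal, in the lift of a single point, which
  is itself in the ideal.\<close>

lemma nonprincipal:
  assumes P: "set_ultrafilter P"
  shows "nonprincipal P"
  unfolding nonprincipal_def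
proof (intro ballI, rule ccontr)
  note PD = set_filterD[OF set_ultrafilterD(1)[OF P]]
  fix X assume X: "X \<in> P" and "\<not> (\<exists>Y\<in>P. X - Y \<notin> ideal_at I A)"
  then have XI: "X - Y \<in> ideal_at I A" if "Y \<in> P" for Y using that by blast
  let ?T = "topspace (cantor_space A)"
  obtain \<Delta> :: "nat \<Rightarrow> 'i" where \<Delta>: "inj \<Delta>" "range \<Delta> \<subseteq> A" using injection_exists .
  define z where "z m \<longleftrightarrow> {f \<in> ?T. f (\<Delta> m)} \<in> P" for m
  have zP: "{f \<in> ?T. f (\<Delta> m) = z m} \<in> P" for m
  proof (cases "z m")
    case False
    have "{f \<in> ?T. f (\<Delta> m) = True} \<in> clopen_sigma A"
      using \<Delta>(2) by (intro coordinate_in_clopen_sigma) auto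
    then have "?T - {f \<in> ?T. f (\<Delta> m)} \<in> P"
      using set_ultrafilterD(2)[OF P, of "{f \<in> ?T. f (\<Delta> m)}"] False unfolding z_def by simp
    moreover have "?T - {f \<in> ?T. f (\<Delta> m)} = {f \<in> ?T. f (\<Delta> m) = z m}" using False by auto
    ultimately show ?thesis by simp
  qed (simp add: z_def)
  have "(\<Union>m. X - {f \<in> ?T. f (\<Delta> m) = z m}) \<in> ideal_at I A"
    by (intro ideal_at_UN XI zP)
  moreover have "lift \<Delta> {z} \<in> ideal_at I A"
    using singleton \<Delta> unfolding ideal_at_def lift_def by blast
  moreover have "X \<subseteq> (\<Union>m. X - {f \<in> ?T. f (\<Delta> m) = z m}) \<union> lift \<Delta> {z}"
    using sa.sets_into_space[OF PD(1)[OF X]] by (auto simp: lift_def fun_eq_iff)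
  ultimately have "X \<in> ideal_at I A" using ideal_at_Un ideal_at_subset by blast
  then show False using PD(3)[OF X] by blast
qed

lemma base_exists:
  obtains P D where "set_ultrafilter P" "filter_base P D" "|D| \<le>o ultrafilter_number Q"
proof -
  obtain P0 where P0: "set_ultrafilter P0" using set_ultrafilter_exists[OF space_notin] .
  show thesis by (rule ultrafilter_number_attained[OF P0 nonprincipal[OF P0]]) (rule that)
qed

lemma ultrafilter_number_le_base:
  assumes "set_ultrafilter P" "filter_base P D"
  shows "ultrafilter_number Q \<le>o |D|"
  using ultrafilter_number_le[OF assms(1) nonprincipal[OF assms(1)] assms(2)] .

lemma ultrafilter_number_le_algebra: "ultrafilter_number Q \<le>o |clopen_sigma A|"
proof -
  obtain P where P: "set_ultrafilter P" using set_ultrafilter_exists[OF space_notin] .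
  have "filter_base P P" unfolding filter_base_def using ideal_at_empty by (force simp: Diff_cancel)
  then have "ultrafilter_number Q \<le>o |P|" by (rule ultrafilter_number_le_base[OF P])
  moreover have "|P| \<le>o |clopen_sigma A|"
    by (rule card_of_mono1) (use set_filterD(1)[OF set_ultrafilterD(1)[OF P]] in blast)
  ultimately show ?thesis by (rule ordLeq_transitive)
qed

end

text \<open>The injection in \<open>ideal_at\<close> may miss coordinates; \<open>pullback\<close>
  restores them.\<close>

lemma (in cantor_ideal) ideal_at_UNIV: "ideal_at I (UNIV :: nat set) = I"
proof (intro equalityI subsetI)
  fix X assume "X \<in> ideal_at I (UNIV :: nat set)"
  then obtain \<Delta> :: "nat \<Rightarrow> nat" and Y where \<Delta>: "inj \<Delta>" "Y \<in> I" "\<forall>f\<in>X. f \<circ> \<Delta> \<in> Y"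
    unfolding ideal_at_def by blast
  show "X \<in> I" by (rule sub[OF pullback[OF \<Delta>(1,2)]]) (use \<Delta>(3) in blast)
next
  fix X assume "X \<in> I"
  then show "X \<in> ideal_at I UNIV"
    unfolding ideal_at_def by (intro CollectI conjI exI[of _ id] exI[of _ X]) auto
qed

locale cantor_ideal_omega = cantor_ideal
begin

sublocale at: cantor_ideal_at I "UNIV :: nat set"
  by unfold_locales simp

sublocale set_algebra_ideal UNIV "clopen_sigma (UNIV :: nat set)" I
  using at.set_algebra_ideal_axioms by (simp add: ideal_at_UNIV)

lemma nonprincipal_omega: "set_ultrafilter P \<Longrightarrow> nonprincipal P"
  using at.nonprincipal by (simp add: ideal_at_UNIV)

lemma base_exists_omega:
  obtains P D where "set_ultrafilter P" "filter_base P D" "|D| \<le>o ultrafilter_number Q"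
proof -
  obtain P D where "at.set_ultrafilter P" "at.filter_base P D" "|D| \<le>o ultrafilter_number at.Q"
    using at.base_exists .
  then show thesis using that by (simp add: ideal_at_UNIV)
qed

end

text \<open>An ultrafilter on the larger algebra traces to one on the subalgebra of sets depending only
  on the coordinates in the range of an injection; each base element \<open>d\<close> is replaced by the
  complement of the essential union of the sets in the subalgebra that are almost disjoint from \<open>d\<close>.\<close>

lemma (in cantor_ideal_at) ultrafilter_number_omega_le:
  "ultrafilter_number (quotient_algebra (clopen_sigma (UNIV :: nat set)) I) \<le>o ultrafilter_number Q"
proof -
  interpret om: cantor_ideal_omega I by unfold_locales
  obtain P D where P: "set_ultrafilter P" and D: "filter_base P D" and card: "|D| \<le>o ultrafilter_number Q"
    using base_exists .
  note PF = set_ultrafilterD(1)[OF P]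
  note PD = set_filterD[OF PF]
  obtain \<Delta> :: "nat \<Rightarrow> 'i" where \<Delta>: "inj \<Delta>" "range \<Delta> \<subseteq> A" using injection_exists .
  let ?B = "clopen_sigma (UNIV :: nat set)"
  note lA = lift_in_clopen_sigma[OF \<Delta>(2)]
  note lI = lift_ideal_iff[OF \<Delta>]
  have l_diff: "lift \<Delta> X - lift \<Delta> Y = lift \<Delta> (X - Y)" for X Y by (auto simp: lift_def)
  have l_compl: "topspace (cantor_space A) - lift \<Delta> X = lift \<Delta> (UNIV - X)" for X
    by (auto simp: lift_def)
  define P' where "P' = {X \<in> ?B. lift \<Delta> X \<in> P}"
  have P': "om.set_ultrafilter P'"
    unfolding om.set_ultrafilter_def om.set_filter_def
  proof (intro conjI ballI impI)
    show "P' \<subseteq> ?B" by (auto simp: P'_def)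
    have "lift \<Delta> UNIV = topspace (cantor_space A)" by (auto simp: lift_def)
    then show "UNIV \<in> P'" using PD(2) om.top by (simp add: P'_def)
    show "P' \<inter> I = {}" using PD(3) lI by (auto simp: P'_def)
    fix X assume X: "X \<in> P'"
    { fix Y assume Y: "Y \<in> P'"
      have "lift \<Delta> X \<inter> lift \<Delta> Y = lift \<Delta> (X \<inter> Y)" by (auto simp: lift_def)
      then show "X \<inter> Y \<in> P'" using X Y PD(4)[of "lift \<Delta> X" "lift \<Delta> Y"] om.Int by (simp add: P'_def) }
    fix Y assume Y: "Y \<in> ?B" "X - Y \<in> I"
    then have "lift \<Delta> (X - Y) \<in> ideal_at I A" using lI[of "X - Y"] X om.Diff by (auto simp: P'_def)
    then show "Y \<in> P'" using PD(5)[of "lift \<Delta> X" "lift \<Delta> Y"] X Y lA by (auto simp: P'_def l_diff)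
  next
    fix X assume X: "X \<in> ?B"
    then have "UNIV - X \<in> ?B" using om.compl_sets by simp
    then show "X \<in> P' \<or> UNIV - X \<in> P'"
      using set_ultrafilterD(2)[OF P lA[OF X]] X unfolding l_compl P'_def by blast
  qed
  define B where "B d = {X \<in> ?B. lift \<Delta> X \<inter> d \<in> ideal_at I A}" for d
  have "\<exists>S\<in>B d. \<forall>X\<in>B d. X - S \<in> I" for d
  proof (rule essential_union)
    show "B d \<subseteq> ?B" "{} \<in> B d" by (auto simp: B_def lift_def ideal_at_empty)
    show "(\<Union>n. X n) \<in> B d" if "\<And>n::nat. X n \<in> B d" for X
    proof -
      have "(\<Union>n. lift \<Delta> (X n) \<inter> d) \<in> ideal_at I A" using that by (intro ideal_at_UN) (auto simp: B_def)
      moreover have "lift \<Delta> (\<Union>n. X n) \<inter> d = (\<Union>n. lift \<Delta> (X n) \<inter> d)" by (auto simp: lift_def)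
      moreover have "(\<Union>n. X n) \<in> ?B" using that by (intro om.at.sa.countable_UN) (auto simp: B_def)
      ultimately show ?thesis by (simp add: B_def)
    qed
    fix X Y assume XY: "X \<in> ?B" "X - Y \<in> I" "Y \<in> B d"
    then have "lift \<Delta> (X - Y) \<in> ideal_at I A" using lI om.Diff by (auto simp: B_def)
    then have "(lift \<Delta> X - lift \<Delta> Y) \<union> (lift \<Delta> Y \<inter> d) \<in> ideal_at I A"
      using XY(3) by (intro ideal_at_Un) (auto simp: B_def l_diff)
    then have "lift \<Delta> X \<inter> d \<in> ideal_at I A" by (rule ideal_at_subset) auto
    then show "X \<in> B d" using XY(1) by (simp add: B_def)
  qed
  then obtain S where S: "\<And>d. S d \<in> B d" "\<And>d X. X \<in> B d \<Longrightarrow> X - S d \<in> I" by metis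
  have "om.filter_base P' ((\<lambda>d. UNIV - S d) ` D)"
    unfolding om.filter_base_def
  proof (intro conjI ballI)
    have "UNIV - S d \<in> P'" if "d \<in> D" for d
    proof -
      have dP: "d \<in> P" using that D by (auto simp: filter_base_def)
      have Sd: "S d \<in> ?B" "lift \<Delta> (S d) \<inter> d \<in> ideal_at I A" using S(1)[of d] by (auto simp: B_def)
      then have "lift \<Delta> (S d) \<notin> P" using PD(3,4) dP by blast
      then show ?thesis using om.set_ultrafilterD(2)[OF P' Sd(1)] by (auto simp: P'_def)
    qed
    then show "(\<lambda>d. UNIV - S d) ` D \<subseteq> P'" by blast
    fix X assume X: "X \<in> P'"
    then obtain d where d: "d \<in> D" "d - lift \<Delta> X \<in> ideal_at I A"
      using D by (auto simp: P'_def filter_base_def)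
    \<comment> \<open>Almost inclusion of \<open>d\<close> in the lift of \<open>X\<close> puts
      \<open>UNIV - X\<close> into \<open>B d\<close>, hence almost below \<open>S d\<close>;
      complementing gives the base property.\<close>
    have "lift \<Delta> (UNIV - X) \<inter> d \<in> ideal_at I A"
      by (rule ideal_at_subset[OF d(2)]) (auto simp: lift_def)
    then have "UNIV - X \<in> B d" using X om.compl_sets by (auto simp: B_def P'_def)
    then have "UNIV - X - S d \<in> I" by (rule S(2))
    moreover have "UNIV - X - S d = UNIV - S d - X" by auto
    ultimately show "\<exists>d\<in>(\<lambda>d. UNIV - S d) ` D. d - X \<in> I" using d(1) by auto
  qed
  then have "ultrafilter_number om.Q \<le>o |(\<lambda>d. UNIV - S d) ` D|"
    by (rule om.ultrafilter_number_le[OF P' om.nonprincipal_omega[OF P']])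
  then show ?thesis using card_of_image card ordLeq_transitive by metis
qed

section \<open>Projection to ultrafilters on the natural numbers\<close>

definition cyl :: "(nat \<Rightarrow> bool) \<Rightarrow> nat \<Rightarrow> (nat \<Rightarrow> bool) set" where
  "cyl x N = {y. \<forall>i<N. y i = x i}"

definition shell :: "(nat \<Rightarrow> bool) \<Rightarrow> nat \<Rightarrow> (nat \<Rightarrow> bool) set" where
  "shell x k = cyl x k - cyl x (Suc k)"

lemma cyl_self: "x \<in> cyl x N" by (simp add: cyl_def)

lemma cyl_antimono: "N \<le> M \<Longrightarrow> cyl x M \<subseteq> cyl x N" by (auto simp: cyl_def)

lemma cyl_Suc: "cyl x (Suc k) = cyl x k \<inter> {y. y k = x k}"
  by (auto simp: cyl_def less_Suc_eq)

lemma shell_disjoint: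
  assumes "j \<noteq> k" shows "shell x j \<inter> shell x k = {}"
proof -
  have "shell x j \<inter> shell x k = {}" if "j < k" for j k
    using cyl_antimono[of "Suc j" k x] that by (auto simp: shell_def)
  then show ?thesis using assms by (metis inf_commute linorder_neqE_nat)
qed

lemma shell_unique: "y \<in> shell x j \<Longrightarrow> y \<in> shell x k \<Longrightarrow> j = k"
  using shell_disjoint by blast

text \<open>A point other than \<open>x\<close> lies in the shell indexed by the first coordinate at
  which it differs from \<open>x\<close>.\<close>

lemma cyl_shells: "cyl x k \<subseteq> {x} \<union> (\<Union>j\<in>{k..}. shell x j)"
proof
  fix y assume y: "y \<in> cyl x k"
  show "y \<in> {x} \<union> (\<Union>j\<in>{k..}. shell x j)"
  proof (cases "y = x")
    case False
    define j where "j = (LEAST i. y i \<noteq> x i)"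
    have "\<exists>i. y i \<noteq> x i" using False by auto
    then have j: "y j \<noteq> x j" "\<forall>i<j. y i = x i"
      unfolding j_def using LeastI_ex[of "\<lambda>i. y i \<noteq> x i"] not_less_Least by auto
    have "j \<ge> k"
    proof (rule ccontr)
      assume "\<not> j \<ge> k"
      then have "y j = x j" using y by (simp add: cyl_def)
      then show False using j(1) by blast
    qed
    moreover have "y \<in> shell x j" using j by (auto simp: shell_def cyl_def)
    ultimately show ?thesis by auto
  qed simp
qed

lemma coordinate_in_borel: "{x. x i = e} \<in> clopen_sigma (UNIV :: nat set)"
  using coordinate_in_clopen_sigma[of i UNIV e] by simp

section \<open>The algebra of subsets of \<omega> modulo finite sets\<close>

lemma finite_ideal: "set_algebra_ideal UNIV UNIV {X :: nat set. finite X}"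
  by (intro set_algebra_ideal.intro set_algebra_ideal_axioms.intro algebra_Pow[of UNIV, simplified Pow_UNIV])
     (auto intro: finite_subset)

interpretation fin: set_algebra_ideal UNIV UNIV "{X :: nat set. finite X}"
  by (rule finite_ideal)

lemma infinite_split:
  assumes "infinite (N :: nat set)"
  obtains M where "infinite (N \<inter> M)" "infinite (N - M)"
proof
  let ?e = "enumerate N"
  have inj: "inj ?e" and r: "range ?e = N"
    using strict_mono_imp_inj_on[OF strict_mono_enumerate[OF assms]] range_enumerate[OF assms] by auto
  let ?M = "?e ` {n. even n}"
  have inf: "infinite {n::nat. even n}" "infinite {n::nat. odd n}"
    using infinite_nat_iff_unbounded_le by (auto, metis even_Suc le_SucI nat_le_linear, metis even_Suc le_SucI nat_le_linear)
  have "N \<inter> ?M = ?e ` {n. even n}" using r by auto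
  then show "infinite (N \<inter> ?M)" using inf(1) inj by (metis finite_imageD inj_on_subset subset_UNIV)
  have "?e ` (UNIV - {n. even n}) = range ?e - ?M" by (rule image_set_diff[OF inj])
  moreover have "UNIV - {n::nat. even n} = {n. odd n}" by auto
  ultimately have "N - ?M = ?e ` {n. odd n}" using r by simp
  then show "infinite (N - ?M)" using inf(2) inj by (metis finite_imageD inj_on_subset subset_UNIV)
qed

text \<open>An infinite member splits into two infinite pieces, and the ultrafilter contains a set
  omitting one of them.\<close>

lemma fin_nonprincipal:
  assumes "fin.set_ultrafilter V"
  shows "fin.nonprincipal V"
  unfolding fin.nonprincipal_def
proof
  fix N assume "N \<in> V"
  then have "infinite N" using fin.set_filterD(3)[OF fin.set_ultrafilterD(1)[OF assms]] by auto
  then obtain M where M: "infinite (N \<inter> M)" "infinite (N - M)" by (rule infinite_split)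
  have "N - (UNIV - M) = N \<inter> M" by auto
  with M show "\<exists>Y\<in>V. N - Y \<notin> {X. finite X}"
    using fin.set_ultrafilterD(2)[OF assms, of M] by (cases "M \<in> V") force+
qed

lemma aleph1_le_iff: "aleph1 \<le>o |C| \<longleftrightarrow> uncountable C"
proof -
  have "aleph1 \<le>o |C| \<longleftrightarrow> natLeq <o |C|"
    unfolding aleph1_def by (rule cardSuc_ordLess_ordLeq[symmetric, OF natLeq_Card_order card_of_Card_order])
  also have "\<dots> \<longleftrightarrow> \<not> |C| \<le>o natLeq"
    using not_ordLeq_iff_ordLess[OF natLeq_Well_order card_of_Well_order] by blast
  also have "\<dots> \<longleftrightarrow> uncountable C"
  proof -
    have "|C| \<le>o natLeq \<longleftrightarrow> |C| \<le>o |UNIV :: nat set|"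
      using card_of_nat ordIso_symmetric ordLeq_ordIso_trans by blast
    also have "\<dots> \<longleftrightarrow> countable C"
      unfolding card_of_ordLeq[symmetric] countable_def by simp
    finally show ?thesis by simp
  qed
  finally show ?thesis .
qed

text \<open>Diagonalise against a countable base: pick an increasing sequence whose
  \<open>n\<close>-th point lies in the first \<open>n + 1\<close> members. Its even-indexed points
  split every member into two infinite parts, so no member decides this set.\<close>

lemma fin_base_uncountable:
  assumes V: "fin.set_ultrafilter V" and D: "fin.filter_base V D"
  shows "uncountable D"
proof
  assume "countable D"
  note VD = fin.set_filterD[OF fin.set_ultrafilterD(1)[OF V]]
  have DV: "D \<subseteq> V" using D by (simp add: fin.filter_base_def)
  have "D \<noteq> {}" using D VD(2) unfolding fin.filter_base_def by blast
  define W where "W = from_nat_into D"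
  have W: "range W = D" unfolding W_def using \<open>D \<noteq> {}\<close> \<open>countable D\<close> by simp
  have inf: "infinite (\<Inter>i\<le>n. W i)" for n
  proof -
    have "(\<Inter>i\<le>n. W i) \<in> V"
    proof (induction n)
      case 0
      then show ?case using W DV by auto
    next
      case (Suc n)
      have "W (Suc n) \<in> V" using W DV by auto
      then show ?case using Suc VD(4) by (simp add: atMost_Suc)
    qed
    then show ?thesis using VD(3) by auto
  qed
  have "\<exists>x. x \<in> (\<Inter>i\<le>n. W i) \<and> m < x" for n m
    using inf[of n] infinite_nat_iff_unbounded by blast
  then obtain h where h: "\<And>n m. h n m \<in> (\<Inter>i\<le>n. W i)" "\<And>n m. m < h n m" by metis
  define x where "x = rec_nat (h 0 0) (\<lambda>n r. h (Suc n) r)"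
  have x0: "x 0 = h 0 0" and xS: "x (Suc n) = h (Suc n) (x n)" for n by (simp_all add: x_def)
  have mono: "strict_mono x" unfolding strict_mono_Suc_iff using h(2) xS by simp
  have xW: "x n \<in> (\<Inter>i\<le>n. W i)" for n using h(1) x0 xS by (cases n) auto
  define X where "X = x ` {n. even n}"
  have odd_notin: "x n \<notin> X" if "odd n" for n
    using that strict_mono_eq[OF mono] by (auto simp: X_def)
  have bad: "infinite (W i \<inter> X)" "infinite (W i - X)" for i
  proof -
    have *: "infinite (x ` {n. e n \<and> i \<le> n})" if "\<And>m. \<exists>n>m. e n" for e
    proof -
      have "infinite {n. e n \<and> i \<le> n}"
        unfolding infinite_nat_iff_unbounded using that by (metis (no_types, lifting) le_max_iff_disj less_or_eq_imp_le max.strict_boundedE mem_Collect_eq max_less_iff_conj)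
      then show ?thesis using strict_mono_imp_inj_on[OF mono] by (metis finite_imageD inj_on_subset subset_UNIV)
    qed
    have "\<exists>n>m. even n" for m :: nat by (rule exI[of _ "2 * Suc m"]) auto
    then have 1: "infinite (x ` {n. even n \<and> i \<le> n})" by (rule *)
    have "\<exists>n>m. odd n" for m :: nat by (rule exI[of _ "Suc (2 * Suc m)"]) auto
    then have 2: "infinite (x ` {n. odd n \<and> i \<le> n})" by (rule *)
    show "infinite (W i \<inter> X)"
      by (rule infinite_super[OF _ 1]) (use xW in \<open>auto simp: X_def\<close>)
    show "infinite (W i - X)"
      by (rule infinite_super[OF _ 2]) (use xW odd_notin in auto)
  qed
  have "\<exists>i. finite (W i - Y)" if "Y \<in> V" for Y
    using D that W unfolding fin.filter_base_def by fastforce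
  moreover have "X \<in> V \<or> UNIV - X \<in> V" using fin.set_ultrafilterD(2)[OF V, of X] by blast
  moreover have "W i - (UNIV - X) = W i \<inter> X" for i by auto
  ultimately show False using bad by metis
qed

section \<open>Shells and the projected ultrafilter\<close>

context cantor_ideal_omega
begin

text \<open>If the value \<open>e\<close> were almost excluded at infinitely many coordinates,
  \<open>X\<close> would almost be contained in the set of points equal to \<open>\<not> e\<close>
  at all of them. That set is the pullback of a singleton.\<close>

lemma finite_decided:
  assumes "X \<notin> I"
  shows "finite {m. X \<inter> {x. x m = e} \<in> I}"
proof (rule ccontr)
  assume inf: "infinite {m. X \<inter> {x. x m = e} \<in> I}"
  define r where "r = enumerate {m. X \<inter> {x. x m = e} \<in> I}"
  have r: "X \<inter> {x. x (r n) = e} \<in> I" for n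
    unfolding r_def using enumerate_in_set[OF inf, of n] by simp
  have "inj r" unfolding r_def by (rule strict_mono_imp_inj_on[OF strict_mono_enumerate[OF inf]])
  then have "{g. g \<circ> r \<in> {\<lambda>_. \<not> e}} \<in> I" by (rule pullback[OF _ singleton])
  moreover have "(\<Union>n. X \<inter> {x. x (r n) = e}) \<in> I" using r by (rule countable_UN)
  moreover have "X \<subseteq> {g. g \<circ> r \<in> {\<lambda>_. \<not> e}} \<union> (\<Union>n. X \<inter> {x. x (r n) = e})"
    by (auto simp: fun_eq_iff)
  ultimately show False using Un_in sub assms by blast
qed

lemma cyl_in_borel: "cyl z k \<in> clopen_sigma UNIV"
proof (induction k)
  case 0
  then show ?case using top by (simp add: cyl_def)
next
  case (Suc k)
  then show ?case unfolding cyl_Suc using coordinate_in_borel by (rule Int)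
qed

lemma shell_in_borel: "shell z k \<in> clopen_sigma UNIV"
  unfolding shell_def using cyl_in_borel by (intro Diff)

lemma UN_in_borel:
  assumes "\<And>n::nat. X n \<in> clopen_sigma (UNIV :: nat set)"
  shows "(\<Union>n\<in>N. X n) \<in> clopen_sigma UNIV"
proof -
  have "sigma_algebra UNIV (clopen_sigma (UNIV :: nat set))"
    using sigma_algebra_clopen_sigma[of UNIV] by simp
  then show ?thesis using assms by (intro sigma_algebra.countable_UN'[of UNIV]) auto
qed

lemma ultrafilter_point:
  assumes P: "set_ultrafilter P"
  obtains z where "\<And>k. cyl z k \<in> P"
proof
  note PD = set_filterD[OF set_ultrafilterD(1)[OF P]]
  define z where "z m \<longleftrightarrow> {x. x m} \<in> P" for m
  have z: "{x. x m = z m} \<in> P" for m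
  proof (cases "z m")
    case False
    have "UNIV - {x. x m} \<in> P"
      using set_ultrafilterD(2)[OF P, of "{x. x m = True}"] coordinate_in_borel[of m True] False
      unfolding z_def by simp
    moreover have "UNIV - {x. x m} = {x. x m = z m}" using False by auto
    ultimately show ?thesis by simp
  qed (simp add: z_def)
  show "cyl z k \<in> P" for k
  proof (induction k)
    case 0
    then show ?case using PD(2) by (simp add: cyl_def)
  next
    case (Suc k)
    then show ?case unfolding cyl_Suc using z by (rule PD(4))
  qed
qed

text \<open>The shells around the point determined by an ultrafilter form a countable partition of which
  the ultrafilter contains no member; this projects it to a nonprincipal ultrafilter on \<open>\<omega>\<close>.\<close>

definition support :: "(nat \<Rightarrow> bool) \<Rightarrow> (nat \<Rightarrow> bool) set \<Rightarrow> nat set" where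
  "support z d = {k. d \<inter> shell z k \<notin> I}"

text \<open>With a finite support, a small cylinder around \<open>z\<close> would meet
  \<open>d\<close> only in \<open>z\<close> and in countably many pieces from the ideal, although
  both sets belong to \<open>P\<close>.\<close>

lemma infinite_support:
  assumes P: "set_ultrafilter P" and z: "\<And>k. cyl z k \<in> P" and d: "d \<in> P"
  shows "infinite (support z d)"
proof
  assume "finite (support z d)"
  then obtain k where k: "\<forall>j\<in>support z d. j < k" using finite_nat_set_iff_bounded by blast
  have "d \<inter> cyl z k \<notin> I"
    using set_filterD(3,4)[OF set_ultrafilterD(1)[OF P]] d z by blast
  moreover have "d \<inter> cyl z k \<subseteq> {z} \<union> (\<Union>j. if k \<le> j then d \<inter> shell z j else {})"
    using cyl_shells[of z k] by auto
  moreover have "(\<Union>j. if k \<le> j then d \<inter> shell z j else {}) \<in> I"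
    using k by (intro countable_UN) (auto simp: empty_in support_def)
  ultimately show False using Un_in[OF singleton] sub by blast
qed

text \<open>By \<open>infinite_support\<close> all members of \<open>V\<close> are infinite, which
  makes \<open>V\<close> closed under finite changes. Up to the ideal, \<open>d\<close> lies in the
  union of the shells over \<open>N\<close> exactly when \<open>support z d \<subseteq> N\<close>;
  so the supports form a base.\<close>

lemma fin_ultrafilter_projection:
  assumes P: "set_ultrafilter P" and D: "filter_base P D" and z: "\<And>k. cyl z k \<in> P"
  defines "V \<equiv> {N. (\<Union>k\<in>N. shell z k) \<in> P}"
  shows "fin.set_ultrafilter V" "fin.filter_base V (support z ` D)"
proof -
  note PF = set_ultrafilterD(1)[OF P]
  note PD = set_filterD[OF PF]
  let ?s = "\<lambda>N. \<Union>k\<in>N. shell z k"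
  have s_in: "?s N \<in> clopen_sigma UNIV" for N by (rule UN_in_borel[OF shell_in_borel])
  have s_Int: "?s N \<inter> ?s M = ?s (N \<inter> M)" for N M
  proof (intro equalityI subsetI)
    fix y assume "y \<in> ?s N \<inter> ?s M"
    then obtain j k where "j \<in> N" "k \<in> M" "y \<in> shell z j" "y \<in> shell z k" by blast
    then show "y \<in> ?s (N \<inter> M)" using shell_unique[of y z j k] by blast
  qed blast
  have sup: "N \<in> V \<Longrightarrow> infinite N" for N
  proof -
    assume "N \<in> V"
    then have "infinite (support z (?s N))" by (intro infinite_support[OF P z]) (simp add: V_def)
    moreover have "support z (?s N) \<subseteq> N"
    proof
      fix k assume "k \<in> support z (?s N)"
      then have "?s N \<inter> shell z k \<noteq> {}" using empty_in by (auto simp: support_def)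
      then obtain j y where "j \<in> N" "y \<in> shell z j" "y \<in> shell z k" by blast
      then show "k \<in> N" using shell_unique[of y z j k] by blast
    qed
    ultimately show "infinite N" using infinite_super by blast
  qed
  have dich: "N \<in> V \<or> UNIV - N \<in> V" for N
  proof (cases "?s N \<in> P")
    case False
    then have "UNIV - ?s N \<in> P" using set_ultrafilterD(2)[OF P s_in] by blast
    moreover have "UNIV - ?s N - ?s (UNIV - N) \<subseteq> {z}"
      using cyl_shells[of z 0] by (auto simp: cyl_def)
    ultimately show ?thesis using PD(5) s_in sub[OF singleton] unfolding V_def by blast
  qed (simp add: V_def)
  have V_Int: "N \<inter> M \<in> V" if "N \<in> V" "M \<in> V" for N M
    using PD(4)[of "?s N" "?s M"] that s_Int[of N M] unfolding V_def by simp
  have V_mono: "M \<in> V" if "N \<in> V" "finite (N - M)" for N M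
  proof (rule ccontr)
    assume "M \<notin> V"
    then have "N \<inter> (UNIV - M) \<in> V" using V_Int[OF that(1)] dich[of M] by blast
    then have "infinite (N \<inter> (UNIV - M))" by (rule sup)
    moreover have "N \<inter> (UNIV - M) = N - M" by auto
    ultimately show False using that(2) by simp
  qed
  have "UNIV \<in> V" using dich[of UNIV] sup[of "{}"] by auto
  then show "fin.set_ultrafilter V"
    unfolding fin.set_ultrafilter_def fin.set_filter_def
    using sup V_Int V_mono dich by blast
  show "fin.filter_base V (support z ` D)"
    unfolding fin.filter_base_def
  proof (intro conjI ballI subsetI)
    fix N assume "N \<in> support z ` D"
    then obtain d where d: "d \<in> D" "N = support z d" by blast
    then have dP: "d \<in> P" using D by (auto simp: filter_base_def)
    have "d - ?s N \<subseteq> {z} \<union> (\<Union>j. if j \<in> N then {} else d \<inter> shell z j)"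
      using cyl_shells[of z 0] by (auto simp: cyl_def)
    moreover have "(\<Union>j. if j \<in> N then {} else d \<inter> shell z j) \<in> I"
      using d(2) by (intro countable_UN) (auto simp: empty_in support_def)
    ultimately have "d - ?s N \<in> I" using Un_in[OF singleton] sub by blast
    then show "N \<in> V" using PD(5)[OF dP s_in] by (simp add: V_def)
  next
    fix N assume "N \<in> V"
    then obtain d where d: "d \<in> D" "d - ?s N \<in> I" using D unfolding filter_base_def V_def by blast
    have "support z d \<subseteq> N"
    proof
      fix k assume k: "k \<in> support z d"
      show "k \<in> N"
      proof (rule ccontr)
        assume "k \<notin> N"
        then have "d \<inter> shell z k \<subseteq> d - ?s N" using shell_unique[of _ z k] by blast
        then show False using k sub[OF d(2)] by (simp add: support_def)
      qed
    qed
    then have "support z d - N = {}" by auto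
    then have "support z d - N \<in> {X. finite X}" by (metis finite.emptyI mem_Collect_eq)
    then show "\<exists>d\<in>support z ` D. d - N \<in> {X. finite X}" using d(1) by blast
  qed
qed

lemma ultrafilter_number_omega_le_quotient: "ultrafilter_number_omega \<le>o ultrafilter_number Q"
proof -
  obtain P D where P: "set_ultrafilter P" and D: "filter_base P D" and c: "|D| \<le>o ultrafilter_number Q"
    using base_exists_omega .
  obtain z where z: "\<And>k. cyl z k \<in> P" using ultrafilter_point[OF P] by blast
  note V = fin_ultrafilter_projection[OF P D z]
  have "ultrafilter_number_omega \<le>o |support z ` D|"
    unfolding ultrafilter_number_omega_def
    by (rule fin.ultrafilter_number_le[OF V(1) fin_nonprincipal[OF V(1)] V(2)])
  then show ?thesis using card_of_image c ordLeq_transitive by metis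
qed

lemma aleph1_le_ultrafilter_number_omega: "aleph1 \<le>o ultrafilter_number_omega"
proof -
  \<comment> \<open>Projecting an ultrafilter of the algebra yields a nonprincipal ultrafilter on
    \<omega>, so the minimum ranges over a nonempty family.\<close>
  obtain P D where P: "set_ultrafilter P" and D: "filter_base P D" using base_exists_omega .
  obtain z where z: "\<And>k. cyl z k \<in> P" using ultrafilter_point[OF P] by blast
  note V = fin_ultrafilter_projection(1)[OF P D z]
  obtain V' E where E: "fin.set_ultrafilter V'" "fin.filter_base V' E"
      "|E| \<le>o ultrafilter_number fin.Q"
    by (rule fin.ultrafilter_number_attained[OF V fin_nonprincipal[OF V]])
  have "aleph1 \<le>o |E|" using fin_base_uncountable[OF E(1,2)] aleph1_le_iff by blast
  then show ?thesis using E(3) unfolding ultrafilter_number_omega_def by (rule ordLeq_transitive)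
qed

text \<open>The test set \<open>b\<close> compares \<open>d\<close> on the \<open>k\<close>-th shell with the coordinate \<open>F k\<close>. Whichever way
  \<open>d\<close> decides \<open>b\<close>, it decides the coordinate \<open>F k\<close> on each shell in its support, and a positive set
  decides only finitely many coordinates.\<close>

lemma dominating_number_le_ultrafilter_number: "dominating_number \<le>o ultrafilter_number Q"
proof -
  obtain P D where P: "set_ultrafilter P" and D: "filter_base P D" and c: "|D| \<le>o ultrafilter_number Q"
    using base_exists_omega .
  obtain z where z: "\<And>k. cyl z k \<in> P" using ultrafilter_point[OF P] by blast
  define M where "M d k = {m. d \<inter> shell z k \<inter> {x. x m = True} \<in> I} \<union> {m. d \<inter> shell z k \<inter> {x. x m = False} \<in> I}" for d k
  \<comment> \<open>Off the support every coordinate belongs to \<open>M d k\<close>; on it the set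
    is finite. The bound is therefore read at the next support point.\<close>
  define nxt where "nxt d k = (LEAST j. j \<in> support z d \<and> k \<le> j)" for d k
  define g where "g d k = Max (M d (nxt d k))" for d k
  have "cofinal_in UNIV (\<lambda>f g. \<forall>\<^sub>F n in sequentially. f n \<le> g n) (g ` D)"
    unfolding cofinal_in_def
  proof (intro conjI ballI)
    fix f :: "nat \<Rightarrow> nat"
    \<comment> \<open>Partial sums give a monotone function above \<open>f\<close>, so a bound for
      \<open>F\<close> at a later support point also bounds \<open>f k\<close>.\<close>
    define F where "F k = (\<Sum>j\<le>k. f j)" for k
    have F: "f j \<le> F k" if "j \<le> k" for j k
      unfolding F_def using that by (intro member_le_sum) auto
    define b where "b = (\<Union>k. shell z k \<inter> {x. x (F k) = True})"
    have b: "b \<in> clopen_sigma UNIV"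
      unfolding b_def by (intro UN_in_borel Int shell_in_borel coordinate_in_borel)
    have bs: "shell z k \<inter> {x. x (F k) = False} = shell z k - b" "shell z k \<inter> {x. x (F k) = True} = shell z k \<inter> b" for k
      using shell_unique[of _ z k] unfolding b_def by auto
    have "\<exists>d\<in>D. d - b \<in> I \<or> d \<inter> b \<in> I"
    proof (cases "b \<in> P")
      case True
      then show ?thesis using D unfolding filter_base_def by blast
    next
      case False
      then have "UNIV - b \<in> P" by (rule set_ultrafilterD(2)[OF P b])
      then obtain d where "d \<in> D" "d - (UNIV - b) \<in> I" using D unfolding filter_base_def by blast
      moreover have "d - (UNIV - b) = d \<inter> b" by auto
      ultimately show ?thesis by auto
    qed
    then obtain d where d: "d \<in> D" "d - b \<in> I \<or> d \<inter> b \<in> I" by blast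
    have FM: "F k \<in> M d k" for k
    proof -
      have "d \<inter> shell z k \<inter> {x. x (F k) = True} \<subseteq> d \<inter> b" using bs(2)[of k] by blast
      moreover have "d \<inter> shell z k \<inter> {x. x (F k) = False} \<subseteq> d - b" using bs(1)[of k] by blast
      ultimately have "d \<inter> shell z k \<inter> {x. x (F k) = True} \<in> I \<or> d \<inter> shell z k \<inter> {x. x (F k) = False} \<in> I"
        using d(2) sub[of "d \<inter> b"] sub[of "d - b"] by metis
      then show ?thesis unfolding M_def by blast
    qed
    have "f k \<le> g d k" for k
    proof -
      have "infinite (support z d)"
        by (rule infinite_support[OF P z]) (use d(1) D in \<open>auto simp: filter_base_def\<close>)
      then have "\<exists>j. j \<in> support z d \<and> k \<le> j" using infinite_nat_iff_unbounded_le by blast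
      then have n: "nxt d k \<in> support z d" "k \<le> nxt d k"
        unfolding nxt_def by (metis (mono_tags, lifting) LeastI_ex)+
      have "finite (M d (nxt d k))"
        unfolding M_def using n(1) by (intro finite_UnI finite_decided) (simp_all add: support_def)
      then have "F (nxt d k) \<le> g d k" unfolding g_def using FM by (rule Max_ge)
      then show ?thesis using F[OF n(2)] by (rule order_trans[rotated])
    qed
    then show "\<exists>c\<in>g ` D. \<forall>\<^sub>F n in sequentially. f n \<le> c n" using d(1) by (intro bexI[of _ "g d"]) auto
  qed simp
  then have "dominating_number \<le>o |g ` D|" unfolding dominating_number_def by (rule cof_le)
  then show ?thesis using card_of_image c ordLeq_transitive by metis
qed

end

section \<open>The meagre ideal\<close>

lemma openin_cantor_space_cyl: "openin (cantor_space UNIV) X \<longleftrightarrow> (\<forall>x\<in>X. \<exists>N. cyl x N \<subseteq> X)"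
proof -
  have 1: "\<exists>N. cyl x N \<subseteq> X" if F: "finite F" "{y. \<forall>i\<in>F. y i = x i} \<subseteq> X" for F x
  proof -
    obtain N where "\<forall>i\<in>F. i < N" using F(1) finite_nat_set_iff_bounded by blast
    then have "cyl x N \<subseteq> {y. \<forall>i\<in>F. y i = x i}" by (auto simp: cyl_def)
    from this F(2) have "cyl x N \<subseteq> X" by (rule subset_trans)
    then show ?thesis ..
  qed
  have 2: "\<exists>F. finite F \<and> {y. \<forall>i\<in>F. y i = x i} \<subseteq> X" if "cyl x N \<subseteq> X" for x N
    using that by (intro exI[of _ "{..<N}"]) (auto simp: cyl_def)
  have "openin (cantor_space UNIV) X \<longleftrightarrow> (\<forall>x\<in>X. \<exists>F. finite F \<and> {y. \<forall>i\<in>F. y i = x i} \<subseteq> X)"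
    unfolding openin_cantor_space by simp
  also have "\<dots> \<longleftrightarrow> (\<forall>x\<in>X. \<exists>N. cyl x N \<subseteq> X)" 
  proof (intro ball_cong refl iffI)
    fix x assume "\<exists>F. finite F \<and> {y. \<forall>i\<in>F. y i = x i} \<subseteq> X"
    then show "\<exists>N. cyl x N \<subseteq> X" by (elim exE conjE) (rule 1)
  next
    fix x assume "\<exists>N. cyl x N \<subseteq> X"
    then show "\<exists>F. finite F \<and> {y. \<forall>i\<in>F. y i = x i} \<subseteq> X" by (elim exE) (rule 2)
  qed
  finally show ?thesis .
qed

lemma cyl_eq: "y \<in> cyl x N \<Longrightarrow> cyl y N = cyl x N"
  by (auto simp: cyl_def)

lemma cyl_subset: "y \<in> cyl x N \<Longrightarrow> N \<le> M \<Longrightarrow> cyl y M \<subseteq> cyl x N"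
  using cyl_eq cyl_antimono by blast

lemma openin_cyl: "openin (cantor_space UNIV) (cyl x N)"
  unfolding openin_cantor_space_cyl using cyl_eq by blast

lemma nowhere_dense_iff:
  "nowhere_dense_in (cantor_space UNIV) X \<longleftrightarrow> (\<forall>x N. \<exists>y\<in>cyl x N. \<exists>M\<ge>N. cyl y M \<inter> X = {})"
    (is "_ \<longleftrightarrow> ?R")
proof -
  let ?C = "cantor_space UNIV closure_of X"
  have cl: "y \<notin> ?C \<longleftrightarrow> (\<exists>M. cyl y M \<inter> X = {})" for y
  proof
    assume "y \<notin> ?C"
    then obtain T where T: "y \<in> T" "openin (cantor_space UNIV) T" "T \<inter> X = {}"
      by (auto simp: in_closure_of)
    then obtain M where "cyl y M \<subseteq> T" unfolding openin_cantor_space_cyl by blast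
    then show "\<exists>M. cyl y M \<inter> X = {}" using T(3) by blast
  next
    assume "\<exists>M. cyl y M \<inter> X = {}"
    then obtain M where "cyl y M \<inter> X = {}" ..
    then show "y \<notin> ?C" unfolding in_closure_of using openin_cyl[of y M] cyl_self[of y M] by blast
  qed
  have "nowhere_dense_in (cantor_space UNIV) X \<longleftrightarrow> (\<forall>x N. \<exists>y\<in>cyl x N. y \<notin> ?C)"
  proof -
    have "nowhere_dense_in (cantor_space UNIV) X \<longleftrightarrow>
        (\<forall>(T :: (nat \<Rightarrow> bool) set) x. openin (cantor_space UNIV) T \<and> x \<in> T \<longrightarrow> \<not> T \<subseteq> ?C)"
      unfolding nowhere_dense_in_def interior_of_def by auto
    also have "\<dots> \<longleftrightarrow> (\<forall>x N. \<not> cyl x N \<subseteq> ?C)"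
    proof (intro iffI allI impI)
      fix x N assume "\<forall>(T :: (nat \<Rightarrow> bool) set) x. openin (cantor_space UNIV) T \<and> x \<in> T \<longrightarrow> \<not> T \<subseteq> ?C"
      then show "\<not> cyl x N \<subseteq> ?C" using openin_cyl[of x N] cyl_self[of x N] by blast
    next
      fix T :: "(nat \<Rightarrow> bool) set" and x assume a: "\<forall>x N. \<not> cyl x N \<subseteq> ?C" "openin (cantor_space UNIV) T \<and> x \<in> T"
      then obtain N where "cyl x N \<subseteq> T" unfolding openin_cantor_space_cyl by blast
      then show "\<not> T \<subseteq> ?C" using a(1) by blast
    qed
    also have "\<dots> \<longleftrightarrow> (\<forall>x N. \<exists>y\<in>cyl x N. y \<notin> ?C)" by blast
    finally show ?thesis .
  qed
  also have "\<dots> \<longleftrightarrow> ?R"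
  proof -
    have "(\<exists>M. cyl y M \<inter> X = {}) \<longleftrightarrow> (\<exists>M\<ge>N. cyl y M \<inter> X = {})" for y N
    proof
      assume "\<exists>M. cyl y M \<inter> X = {}"
      then obtain M where "cyl y M \<inter> X = {}" ..
      moreover have "cyl y (max M N) \<subseteq> cyl y M" by (rule cyl_antimono) simp
      ultimately show "\<exists>M\<ge>N. cyl y M \<inter> X = {}" by (intro exI[of _ "max M N"]) auto
    qed auto
    then show ?thesis unfolding cl by simp
  qed
  finally show ?thesis .
qed

abbreviation nowhere_dense :: "(nat \<Rightarrow> bool) set \<Rightarrow> bool" where
  "nowhere_dense \<equiv> nowhere_dense_in (cantor_space UNIV)"

lemma nowhere_dense_subset: "nowhere_dense X \<Longrightarrow> Y \<subseteq> X \<Longrightarrow> nowhere_dense Y"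
  unfolding nowhere_dense_iff
proof (intro allI)
  fix x N assume X: "\<forall>x N. \<exists>y\<in>cyl x N. \<exists>M\<ge>N. cyl y M \<inter> X = {}" and "Y \<subseteq> X"
  from X obtain y M where "y \<in> cyl x N" "N \<le> M" "cyl y M \<inter> X = {}" by blast
  with \<open>Y \<subseteq> X\<close> show "\<exists>y\<in>cyl x N. \<exists>M\<ge>N. cyl y M \<inter> Y = {}" by blast
qed

lemma nowhere_dense_empty: "nowhere_dense {}"
  unfolding nowhere_dense_iff using cyl_self by auto

lemma meagre_ideal_iff:
  "X \<in> meagre_ideal \<longleftrightarrow> (\<exists>F :: nat \<Rightarrow> _. (\<forall>n. nowhere_dense (F n)) \<and> X \<subseteq> (\<Union>n. F n))"
proof
  assume "X \<in> meagre_ideal"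
  then obtain \<F> where F: "countable \<F>" "\<forall>N\<in>\<F>. nowhere_dense N" "X = \<Union>\<F>"
    unfolding meagre_ideal_def meagre_in_def by blast
  have "\<forall>N\<in>insert {} \<F>. nowhere_dense N" using F(2) nowhere_dense_empty by blast
  moreover have r: "range (from_nat_into (insert {} \<F>)) = insert {} \<F>" using F(1) by simp
  ultimately have "\<forall>n. nowhere_dense (from_nat_into (insert {} \<F>) n)" by (metis rangeI)
  moreover have "X \<subseteq> \<Union>(range (from_nat_into (insert {} \<F>)))" unfolding r F(3) by auto
  ultimately show "\<exists>F :: nat \<Rightarrow> _. (\<forall>n. nowhere_dense (F n)) \<and> X \<subseteq> (\<Union>n. F n)"
    by (intro exI[of _ "from_nat_into (insert {} \<F>)"] conjI)
next
  assume "\<exists>F :: nat \<Rightarrow> _. (\<forall>n. nowhere_dense (F n)) \<and> X \<subseteq> (\<Union>n. F n)"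
  then obtain F :: "nat \<Rightarrow> _" where F: "\<forall>n. nowhere_dense (F n)" "X \<subseteq> (\<Union>n. F n)" by blast
  have "countable (range (\<lambda>n. F n \<inter> X))" by simp
  moreover have "\<forall>N\<in>range (\<lambda>n. F n \<inter> X). nowhere_dense N"
  proof
    fix N assume "N \<in> range (\<lambda>n. F n \<inter> X)"
    then obtain n where "N = F n \<inter> X" by blast
    then show "nowhere_dense N" using F(1) nowhere_dense_subset[of "F n" N] by simp
  qed
  moreover have "X = \<Union>(range (\<lambda>n. F n \<inter> X))" using F(2) by auto
  ultimately show "X \<in> meagre_ideal" unfolding meagre_ideal_def meagre_in_def by blast
qed

lemma nowhere_dense_meagre: "nowhere_dense X \<Longrightarrow> X \<in> meagre_ideal"
  unfolding meagre_ideal_iff by (intro exI[of _ "\<lambda>_. X"]) auto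

lemma meagre_subset: "X \<in> meagre_ideal \<Longrightarrow> Y \<subseteq> X \<Longrightarrow> Y \<in> meagre_ideal"
  unfolding meagre_ideal_iff by blast

lemma meagre_UN:
  assumes "\<And>n::nat. X n \<in> meagre_ideal"
  shows "(\<Union>n. X n) \<in> meagre_ideal"
proof -
  have "\<exists>F :: nat \<Rightarrow> _. (\<forall>k. nowhere_dense (F k)) \<and> X n \<subseteq> (\<Union>k. F k)" for n
    using assms[of n] unfolding meagre_ideal_iff .
  then obtain F where F: "\<And>n k::nat. nowhere_dense (F n k)" "\<And>n. X n \<subseteq> (\<Union>k. F n k)" by metis
  let ?G = "\<lambda>m. case prod_decode m of (n, k) \<Rightarrow> F n k"
  have "nowhere_dense (?G m)" for m using F(1) by (simp split: prod.split)
  moreover have "F n k \<subseteq> (\<Union>m. ?G m)" for n k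
    by (rule subset_trans[OF _ UN_upper[of "prod_encode (n, k)"]]) auto
  then have "(\<Union>n. X n) \<subseteq> (\<Union>m. ?G m)"
    by (intro UN_least subset_trans[OF F(2)]) simp
  ultimately show ?thesis unfolding meagre_ideal_iff by (intro exI[of _ ?G] conjI allI)
qed

lemma meagre_Un: "X \<in> meagre_ideal \<Longrightarrow> Y \<in> meagre_ideal \<Longrightarrow> X \<union> Y \<in> meagre_ideal"
  using meagre_UN[of "\<lambda>n. if n = 0 then X else Y"] by (rule meagre_subset) (auto split: if_splits)

lemma nowhere_dense_singleton: "nowhere_dense {z}"
  unfolding nowhere_dense_iff
proof (intro allI)
  fix x N
  have "x(N := \<not> z N) \<in> cyl x N" by (simp add: cyl_def)
  moreover have "cyl (x(N := \<not> z N)) (Suc N) \<inter> {z} = {}" by (auto simp: cyl_def)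
  ultimately show "\<exists>y\<in>cyl x N. \<exists>M\<ge>N. cyl y M \<inter> {z} = {}" by (metis le_Suc_eq order_refl)
qed

text \<open>Completeness of the Cantor space, in the form needed for Baire's theorem and for the
  fusion argument on blocks.\<close>

lemma nested_cyls:
  assumes y: "\<And>n. y (Suc n) \<in> cyl (y n) (m n)" and m: "\<And>n. m n < m (Suc n)"
  obtains w where "\<And>n. w \<in> cyl (y n) (m n)"
proof
  have mono: "strict_mono m" unfolding strict_mono_Suc_iff using m by simp
  have nest: "y (n + k) \<in> cyl (y n) (m n)" for n k
  proof (induction k)
    case (Suc k)
    have "y (Suc (n + k)) \<in> cyl (y (n + k)) (m (n + k))" by (rule y)
    moreover have "cyl (y (n + k)) (m (n + k)) \<subseteq> cyl (y n) (m n)"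
      using Suc mono by (intro cyl_subset) (auto simp: strict_mono_less_eq)
    ultimately show ?case by auto
  qed (simp add: cyl_self)
  have agree: "y k i = y n i" if "i < m n" "n \<le> k" for k n i
    using nest[of n "k - n"] that by (simp add: cyl_def)
  \<comment> \<open>The level at stage \<open>Suc i\<close> exceeds \<open>i\<close>, so coordinate
    \<open>i\<close> no longer changes from there on.\<close>
  let ?w = "\<lambda>i. y (Suc i) i"
  have "?w i = y n i" if "i < m n" for n i
  proof (cases "n \<le> Suc i")
    case True
    then show ?thesis using agree that by blast
  next
    case False
    have "i < m (Suc i)" using strict_mono_imp_increasing[OF mono, of "Suc i"] by simp
    then show ?thesis using agree[of i "Suc i" n] False by simp
  qed
  then show "?w \<in> cyl (y n) (m n)" for n by (simp add: cyl_def)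
qed

text \<open>The Baire category theorem: shrink the cylinder step by step, avoiding the
  \<open>n\<close>-th nowhere dense set at step \<open>n\<close>, and take a point of all the
  cylinders.\<close>

lemma cyl_not_meagre: "cyl x N \<notin> meagre_ideal"
proof
  assume "cyl x N \<in> meagre_ideal"
  then obtain F :: "nat \<Rightarrow> _" where F: "\<And>n. nowhere_dense (F n)" "cyl x N \<subseteq> (\<Union>n. F n)"
    unfolding meagre_ideal_iff by blast
  define R where "R n q p \<longleftrightarrow> fst p \<in> cyl (fst q) (snd q) \<and> snd q < snd p \<and> cyl (fst p) (snd p) \<inter> F n = {}" for n q p
  have R: "\<exists>p. R n q p" for n q
  proof -
    obtain y M where "y \<in> cyl (fst q) (snd q)" "snd q \<le> M" "cyl y M \<inter> F n = {}"
      using F(1)[of n] unfolding nowhere_dense_iff by blast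
    moreover have "cyl y (Suc M) \<subseteq> cyl y M" by (rule cyl_antimono) simp
    ultimately show ?thesis unfolding R_def by (intro exI[of _ "(y, Suc M)"]) auto
  qed
  define s where "s = rec_nat (x, N) (\<lambda>n q. SOME p. R n q p)"
  define y where "y n = fst (s n)" for n
  define m where "m n = snd (s n)" for n
  have 0: "y 0 = x" "m 0 = N" by (simp_all add: y_def m_def s_def)
  have "R n (s n) (s (Suc n))" for n using someI_ex[OF R] by (simp add: s_def)
  then have S: "y (Suc n) \<in> cyl (y n) (m n)" "m n < m (Suc n)" "cyl (y (Suc n)) (m (Suc n)) \<inter> F n = {}" for n
    by (simp_all add: y_def m_def R_def)
  obtain w where w: "\<And>n. w \<in> cyl (y n) (m n)" using nested_cyls[of y m, OF S(1,2)] by blast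
  have "w \<notin> F n" for n using w[of "Suc n"] S(3)[of n] by auto
  moreover have "w \<in> cyl x N" using w[of 0] 0 by simp
  ultimately show False using F(2) by blast
qed

text \<open>Fixing the coordinates below \<open>N\<close> restricts \<open>g \<circ> e\<close> only
  below some \<open>N0\<close>. A refinement avoiding \<open>X\<close> can be found there and copied
  onto the range of \<open>e\<close>.\<close>

lemma nowhere_dense_pullback:
  assumes e: "inj e" and X: "nowhere_dense X"
  shows "nowhere_dense {g. g \<circ> e \<in> X}"
  unfolding nowhere_dense_iff
proof (intro allI)
  fix x :: "nat \<Rightarrow> bool" and N
  have "finite (e -` {..<N})" by (rule finite_vimageI[OF _ e]) simp
  then obtain N0 where N0: "\<forall>j\<in>e -` {..<N}. j < N0" using finite_nat_set_iff_bounded by blast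
  obtain y M where y: "y \<in> cyl (x \<circ> e) N0" "N0 \<le> M" "cyl y M \<inter> X = {}"
    using X unfolding nowhere_dense_iff by blast
  define x' where "x' i = (if i \<in> range e then y (inv e i) else x i)" for i
  \<comment> \<open>The sum is a crude bound lying above every \<open>e j\<close> with
    \<open>j < M\<close>.\<close>
  define N' where "N' = N + (\<Sum>j<M. Suc (e j))"
  have "x' i = x i" if "i < N" for i
  proof (cases "i \<in> range e")
    case True
    then obtain j where j: "i = e j" by blast
    then have "j < N0" using N0 that by auto
    then show ?thesis using y(1) e j by (simp add: x'_def cyl_def)
  qed (simp add: x'_def)
  then have "x' \<in> cyl x N" by (simp add: cyl_def)
  moreover have "g \<circ> e \<in> cyl y M" if g: "g \<in> cyl x' N'" for g
  proof -
    have "g (e j) = y j" if "j < M" for j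
    proof -
      have "Suc (e j) \<le> (\<Sum>j<M. Suc (e j))" using that by (intro member_le_sum) auto
      then have "e j < N'" by (simp add: N'_def)
      then show ?thesis using g e by (simp add: cyl_def x'_def)
    qed
    then show ?thesis by (simp add: cyl_def)
  qed
  then have "cyl x' N' \<inter> {g. g \<circ> e \<in> X} = {}" using y(3) by auto
  moreover have "N \<le> N'" by (simp add: N'_def)
  ultimately show "\<exists>y\<in>cyl x N. \<exists>M\<ge>N. cyl y M \<inter> {g. g \<circ> e \<in> X} = {}" by blast
qed

lemma meagre_pullback:
  assumes "inj e" "Y \<in> meagre_ideal"
  shows "{g. g \<circ> e \<in> Y} \<in> meagre_ideal"
proof -
  obtain F :: "nat \<Rightarrow> _" where F: "\<And>n. nowhere_dense (F n)" "Y \<subseteq> (\<Union>n. F n)"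
    using assms(2) unfolding meagre_ideal_iff by blast
  have "{g. g \<circ> e \<in> Y} \<subseteq> (\<Union>n. {g. g \<circ> e \<in> F n})" using F(2) by auto
  then show ?thesis unfolding meagre_ideal_iff
    using nowhere_dense_pullback[OF assms(1) F(1)] by (intro exI[of _ "\<lambda>n. {g. g \<circ> e \<in> F n}"]) auto
qed

text \<open>Open sets modulo meagre sets are closed under complements: replace the complement of
  \<open>G\<close> by its interior \<open>H\<close>, which loses only the nowhere dense boundary of
  \<open>G\<close>.\<close>

lemma baire_property:
  assumes "X \<in> clopen_sigma (UNIV :: nat set)"
  shows "\<exists>G. openin (cantor_space UNIV) G \<and> X - G \<in> meagre_ideal \<and> G - X \<in> meagre_ideal"
  using assms unfolding clopen_sigma_def
proof induction
  case (Basic a)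
  then show ?case using nowhere_dense_meagre[OF nowhere_dense_empty] by (intro exI[of _ a]) auto
next
  case Empty
  then show ?case using nowhere_dense_meagre[OF nowhere_dense_empty] by (intro exI[of _ "{}"]) auto
next
  case (Compl a)
  then obtain G where G: "openin (cantor_space UNIV) G" "a - G \<in> meagre_ideal" "G - a \<in> meagre_ideal"
    by blast
  define H where "H = {x. \<exists>N. cyl x N \<inter> G = {}}"
  have cH: "cyl x N \<subseteq> H" if "cyl x N \<inter> G = {}" for x N
    using that cyl_eq[of _ x N] unfolding H_def by blast
  have "openin (cantor_space UNIV) H"
    unfolding openin_cantor_space_cyl
  proof
    fix x assume "x \<in> H"
    then obtain N where "cyl x N \<inter> G = {}" unfolding H_def by blast
    then show "\<exists>N. cyl x N \<subseteq> H" using cH by blast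
  qed
  moreover have "nowhere_dense (UNIV - G - H)"
    unfolding nowhere_dense_iff
  proof (intro allI)
    fix x N
    show "\<exists>y\<in>cyl x N. \<exists>M\<ge>N. cyl y M \<inter> (UNIV - G - H) = {}"
    proof (cases "cyl x N \<inter> G = {}")
      case True
      then show ?thesis using cH[of x N] cyl_self[of x N] by blast
    next
      case False
      then obtain y where y: "y \<in> cyl x N" "y \<in> G" by blast
      then obtain M where "cyl y M \<subseteq> G" using G(1) unfolding openin_cantor_space_cyl by blast
      then have "cyl y (max M N) \<subseteq> G" using cyl_antimono[of M "max M N" y] by auto
      then have "cyl y (max M N) \<inter> (UNIV - G - H) = {}" by blast
      then show ?thesis using y(1) by (metis max.cobounded2)
    qed
  qed
  then have "UNIV - G - H \<in> meagre_ideal" by (rule nowhere_dense_meagre)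
  then have "(G - a) \<union> (UNIV - G - H) \<in> meagre_ideal" using G(3) by (rule meagre_Un[rotated])
  then have "UNIV - a - H \<in> meagre_ideal" by (rule meagre_subset) blast
  moreover have "H - (UNIV - a) \<in> meagre_ideal"
  proof (rule meagre_subset[OF G(2)])
    have "x \<notin> G" if "x \<in> H" for x using that cyl_self unfolding H_def by blast
    then show "H - (UNIV - a) \<subseteq> a - G" by blast
  qed
  ultimately show ?case by auto
next
  case (Union a)
  then obtain G where G: "\<And>n. openin (cantor_space UNIV) (G n)"
    "\<And>n. a n - G n \<in> meagre_ideal" "\<And>n. G n - a n \<in> meagre_ideal" by metis
  have "openin (cantor_space UNIV) (\<Union>n. G n)" using G(1) by blast
  moreover have "(\<Union>n. a n) - (\<Union>n. G n) \<in> meagre_ideal"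
    by (rule meagre_subset[OF meagre_UN[of "\<lambda>n. a n - G n", OF G(2)]]) blast
  moreover have "(\<Union>n. G n) - (\<Union>n. a n) \<in> meagre_ideal"
    by (rule meagre_subset[OF meagre_UN[of "\<lambda>n. G n - a n", OF G(3)]]) blast
  ultimately show ?case by blast
qed

text \<open>Up to a meagre set \<open>X\<close> is an open set \<open>G\<close>. If \<open>G\<close>
  were nonempty, its pullback would contain a cylinder and could not be meagre.\<close>

lemma meagre_pullback_rev:
  assumes e: "inj e" and X: "X \<in> clopen_sigma UNIV" and m: "{g. g \<circ> e \<in> X} \<in> meagre_ideal"
  shows "X \<in> meagre_ideal"
proof -
  obtain G where G: "openin (cantor_space UNIV) G" "X - G \<in> meagre_ideal" "G - X \<in> meagre_ideal"
    using baire_property[OF X] by blast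
  have "{g. g \<circ> e \<in> X} \<union> {g. g \<circ> e \<in> G - X} \<in> meagre_ideal"
    using m meagre_pullback[OF e G(3)] by (rule meagre_Un)
  then have mG: "{g. g \<circ> e \<in> G} \<in> meagre_ideal" by (rule meagre_subset) blast
  have "G = {}"
  proof (rule ccontr)
    assume "G \<noteq> {}"
    then obtain x N where x: "cyl x N \<subseteq> G" using G(1) unfolding openin_cantor_space_cyl by blast
    define x' where "x' i = x (inv e i)" for i
    have "cyl x' (\<Sum>j<N. Suc (e j)) \<subseteq> {g. g \<circ> e \<in> G}"
    proof
      fix g assume g: "g \<in> cyl x' (\<Sum>j<N. Suc (e j))"
      have "g (e j) = x j" if "j < N" for j
      proof -
        have "Suc (e j) \<le> (\<Sum>j<N. Suc (e j))" using that by (intro member_le_sum) auto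
        then show ?thesis using g e by (simp add: cyl_def x'_def)
      qed
      then show "g \<in> {g. g \<circ> e \<in> G}" using x by (auto simp: cyl_def)
    qed
    then show False using cyl_not_meagre meagre_subset[OF mG] by blast
  qed
  then show ?thesis using G(2) by simp
qed

lemma cantor_ideal_meagre: "cantor_ideal_omega meagre_ideal"
proof (intro cantor_ideal_omega.intro cantor_ideal.intro)
  have "cyl (\<lambda>_. True) 0 = UNIV" by (simp add: cyl_def)
  then show "UNIV \<notin> meagre_ideal" using cyl_not_meagre[of "\<lambda>_. True" 0] by simp
  fix B :: "(nat \<Rightarrow> bool) set set"
  assume B: "B \<subseteq> clopen_sigma UNIV" "{} \<in> B"
    "\<And>X. (\<And>n::nat. X n \<in> B) \<Longrightarrow> (\<Union>n. X n) \<in> B"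
    "\<And>X Y. X \<in> clopen_sigma UNIV \<Longrightarrow> X - Y \<in> meagre_ideal \<Longrightarrow> Y \<in> B \<Longrightarrow> X \<in> B"
  let ?c = "\<lambda>s :: bool list. cyl (\<lambda>i. i < length s \<and> s ! i) (length s)"
  have list: "\<exists>s. cyl x N = ?c s" for x N
    by (rule exI[of _ "map x [0..<N]"]) (auto simp: cyl_def)
  \<comment> \<open>The essential union consists of the countably many cylinders in
    \<open>B\<close>. Each \<open>X \<in> B\<close> is open up to a meagre set, and every cylinder
    inside that open set is almost below \<open>X\<close>, hence in \<open>B\<close>.\<close>
  define S where "S = (\<Union>n. if ?c (from_nat n) \<in> B then ?c (from_nat n) else {})"
  have "S \<in> B" unfolding S_def using B(2) by (intro B(3)) auto
  moreover have "X - S \<in> meagre_ideal" if "X \<in> B" for X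
  proof -
    have "X \<in> clopen_sigma UNIV" using that B(1) by blast
    then obtain G where G: "openin (cantor_space UNIV) G" "X - G \<in> meagre_ideal" "G - X \<in> meagre_ideal"
      using baire_property by blast
    have "G \<subseteq> S"
    proof
      fix x assume "x \<in> G"
      then obtain N where N: "cyl x N \<subseteq> G" using G(1) unfolding openin_cantor_space_cyl by blast
      have "closedin (cantor_space UNIV) (cyl x N)"
      proof -
        have "openin (cantor_space UNIV) (UNIV - cyl x N)"
          unfolding openin_cantor_space_cyl
        proof
          fix y assume "y \<in> UNIV - cyl x N"
          then have "cyl y N \<subseteq> UNIV - cyl x N" by (auto simp: cyl_def)
          then show "\<exists>N'. cyl y N' \<subseteq> UNIV - cyl x N" by blast
        qed
        then show ?thesis by (simp add: closedin_def)
      qed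
      then have "cyl x N \<in> clopen_sigma UNIV" using openin_cyl clopen_sigma_basic by blast
      moreover have "cyl x N - X \<in> meagre_ideal" by (rule meagre_subset[OF G(3)]) (use N in blast)
      ultimately have "cyl x N \<in> B" using B(4) that by blast
      moreover obtain s where "cyl x N = ?c s" using list by blast
      ultimately show "x \<in> S"
        unfolding S_def using cyl_self[of x N] by (intro UN_I[of "to_nat s"]) auto
    qed
    then show ?thesis by (intro meagre_subset[OF G(2)]) blast
  qed
  ultimately show "\<exists>S\<in>B. \<forall>X\<in>B. X - S \<in> meagre_ideal" by blast
qed (fact meagre_subset meagre_UN meagre_pullback meagre_pullback_rev nowhere_dense_meagre[OF nowhere_dense_singleton])+

section \<open>The null ideal\<close>

abbreviation mu :: "(nat \<Rightarrow> bool) set \<Rightarrow> real" where "mu \<equiv> measure cantor_measure"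

interpretation cm: prob_space cantor_measure
  unfolding cantor_measure_def by (intro prob_space_PiM prob_space_uniform_count_measure) auto

lemma space_cantor_measure [simp]: "space cantor_measure = UNIV"
  by (simp add: cantor_measure_def space_PiM space_uniform_count_measure)

lemma sets_cantor_measure: "sets cantor_measure = clopen_sigma UNIV"
proof
  have "{x. x i} \<in> sets cantor_measure" for i
  proof -
    have "(\<lambda>x. x i) \<in> measurable cantor_measure (uniform_count_measure UNIV)"
      unfolding cantor_measure_def by (rule measurable_component_singleton) simp
    then have "(\<lambda>x. x i) -` {True} \<inter> space cantor_measure \<in> sets cantor_measure"
      by (rule measurable_sets) simp
    moreover have "(\<lambda>x. x i) -` {True} \<inter> space cantor_measure = {x. x i}" by auto
    ultimately show ?thesis by simp
  qed
  then have "sigma_sets UNIV ((\<lambda>i. {x. x i}) ` UNIV) \<subseteq> sets cantor_measure"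
    by (intro sets.sigma_sets_subset[of _ cantor_measure, simplified]) auto
  then show "clopen_sigma UNIV \<subseteq> sets cantor_measure"
    using clopen_sigma_coordinates[of "UNIV :: nat set"] by simp
next
  interpret b: sigma_algebra UNIV "clopen_sigma (UNIV :: nat set)"
    using sigma_algebra_clopen_sigma[of "UNIV :: nat set"] by simp
  have h: "{x :: nat \<Rightarrow> bool. x i \<in> a} \<in> clopen_sigma UNIV" for i a
  proof -
    have "{x. x i \<in> a} = (\<Union>e\<in>a. {x. x i = e})" by auto
    moreover have "(\<Union>e\<in>a. {x :: nat \<Rightarrow> bool. x i = e}) \<in> clopen_sigma UNIV"
      using coordinate_in_borel by (intro b.finite_UN) auto
    ultimately show ?thesis by simp
  qed
  have eq: "(\<Pi>\<^sub>E i\<in>(UNIV :: nat set). space (uniform_count_measure (UNIV :: bool set))) = UNIV"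
    by (simp add: space_uniform_count_measure)
  show "sets cantor_measure \<subseteq> clopen_sigma UNIV"
    unfolding cantor_measure_def sets_PiM_single eq by (rule b.sigma_sets_subset) (auto intro: h)
qed

lemma measure_fixed_coordinates:
  assumes "finite J"
  shows "mu {x. \<forall>i\<in>J. x i = s i} = (1/2) ^ card J"
proof -
  interpret product_prob_space "\<lambda>_::nat. uniform_count_measure (UNIV :: bool set)" UNIV
    by (intro product_prob_spaceI prob_space_uniform_count_measure) auto
  have "measure (PiM UNIV (\<lambda>_::nat. uniform_count_measure (UNIV :: bool set)))
      (prod_emb UNIV (\<lambda>_. uniform_count_measure UNIV) J (Pi\<^sub>E J (\<lambda>i. {s i}))) =
      (\<Prod>i\<in>J. measure (uniform_count_measure UNIV) {s i})"
    by (rule measure_PiM_emb) (use assms in auto)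
  also have "\<dots> = (1/2) ^ card J"
    by (simp add: measure_uniform_count_measure)
  also have "prod_emb UNIV (\<lambda>_. uniform_count_measure UNIV) J (Pi\<^sub>E J (\<lambda>i. {s i})) = {x. \<forall>i\<in>J. x i = s i}"
    by (rule Set.set_eqI) (simp add: prod_emb_def space_uniform_count_measure restrict_PiE_iff Pi_iff)
  finally show ?thesis unfolding cantor_measure_def .
qed

lemma null_ideal_iff: "X \<in> clopen_sigma UNIV \<Longrightarrow> X \<in> null_ideal \<longleftrightarrow> mu X = 0"
proof
  assume X: "X \<in> clopen_sigma UNIV" "X \<in> null_ideal"
  then obtain N where "N \<in> null_sets cantor_measure" "X \<subseteq> N" unfolding null_ideal_def by blast
  then have "mu N = 0" "N \<in> sets cantor_measure" by (simp_all add: null_sets_def measure_def)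
  then have "mu X \<le> 0" using cm.finite_measure_mono[OF \<open>X \<subseteq> N\<close>] by simp
  then show "mu X = 0" by (simp add: measure_le_0_iff)
next
  assume "X \<in> clopen_sigma UNIV" "mu X = 0"
  then have "X \<in> null_sets cantor_measure"
    by (simp add: null_sets_def cm.emeasure_eq_measure sets_cantor_measure)
  then show "X \<in> null_ideal" unfolding null_ideal_def by blast
qed

lemma null_ideal_cover:
  assumes "X \<in> null_ideal"
  obtains N where "X \<subseteq> N" "N \<in> clopen_sigma UNIV" "mu N = 0"
proof -
  obtain N where N: "N \<in> null_sets cantor_measure" "X \<subseteq> N" using assms unfolding null_ideal_def by blast
  then have "N \<in> clopen_sigma UNIV" "mu N = 0"
    by (auto simp: null_sets_def measure_def sets_cantor_measure)
  then show thesis using that N(2) by blast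
qed

lemma null_subset: "X \<in> null_ideal \<Longrightarrow> Y \<subseteq> X \<Longrightarrow> Y \<in> null_ideal"
  unfolding null_ideal_def by blast

lemma null_UN:
  assumes "\<And>n::nat. X n \<in> null_ideal"
  shows "(\<Union>n. X n) \<in> null_ideal"
proof -
  have "\<forall>n. \<exists>N. N \<in> null_sets cantor_measure \<and> X n \<subseteq> N" using assms unfolding null_ideal_def by blast
  then obtain N where N: "\<And>n. N n \<in> null_sets cantor_measure" "\<And>n. X n \<subseteq> N n" by metis
  then have "(\<Union>n. N n) \<in> null_sets cantor_measure" by auto
  moreover have "(\<Union>n. X n) \<subseteq> (\<Union>n. N n)" using N(2) by (intro UN_mono) auto
  ultimately show ?thesis unfolding null_ideal_def by blast
qed

interpretation bo: sigma_algebra UNIV "clopen_sigma (UNIV :: nat set)"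
  using sigma_algebra_clopen_sigma[of "UNIV :: nat set"] by simp

lemma cyl_Inter: "cyl x N = {y. \<forall>i\<in>{..<N}. y i = x i}"
  by (simp add: cyl_def Ball_def)

lemma measure_cyl: "mu (cyl x N) = (1/2) ^ N"
  unfolding cyl_Inter by (subst measure_fixed_coordinates) auto

lemma cyl_borel: "cyl x N \<in> clopen_sigma UNIV"
  using cantor_ideal_omega.cyl_in_borel[OF cantor_ideal_meagre] .

lemma UN_borel: "(\<And>n::nat. X n \<in> clopen_sigma (UNIV :: nat set)) \<Longrightarrow> (\<Union>n\<in>N. X n) \<in> clopen_sigma UNIV"
  using cantor_ideal_omega.UN_in_borel[OF cantor_ideal_meagre] .

lemma null_singleton: "{z} \<in> null_ideal"
proof -
  have eq: "{z} = (\<Inter>n. cyl z n)" unfolding cyl_def by auto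
  have b: "(\<Inter>n. cyl z n) \<in> clopen_sigma UNIV" using cyl_borel by blast
  have "mu (\<Inter>n. cyl z n) \<le> (1/2) ^ n" for n
    using cm.finite_measure_mono[of "\<Inter>n. cyl z n" "cyl z n"] cyl_borel
    by (auto simp: measure_cyl sets_cantor_measure)
  then have "mu (\<Inter>n. cyl z n) \<le> 0"
    by (intro LIMSEQ_le_const[OF LIMSEQ_realpow_zero[of "1/2"]]) auto
  then have "mu (\<Inter>n. cyl z n) = 0" by (simp add: measure_le_0_iff)
  then show ?thesis using null_ideal_iff[OF b] eq by simp
qed

text \<open>The coordinates selected by an injection are again independent fair coin tosses.\<close>

lemma mu_pullback:
  assumes e: "inj e" and X: "X \<in> clopen_sigma UNIV"
  shows "{g. g \<circ> e \<in> X} \<in> clopen_sigma UNIV" "mu {g. g \<circ> e \<in> X} = mu X"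
proof -
  have d: "distr cantor_measure cantor_measure (\<lambda>g. g \<circ> e) = cantor_measure"
    using distr_PiM_reindex[of UNIV "\<lambda>_. uniform_count_measure (UNIV :: bool set)" e UNIV] e
      prob_space_uniform_count_measure[of "UNIV :: bool set"]
    unfolding cantor_measure_def by (simp add: comp_def restrict_def)
  have m: "(\<lambda>g. g \<circ> e) \<in> measurable cantor_measure cantor_measure"
    unfolding cantor_measure_def comp_def
    by (rule measurable_PiM_single') (auto intro!: measurable_component_singleton simp: space_uniform_count_measure)
  have pre: "{g. g \<circ> e \<in> X} = (\<lambda>g. g \<circ> e) -` X \<inter> space cantor_measure" by auto
  show "{g. g \<circ> e \<in> X} \<in> clopen_sigma UNIV"
    unfolding pre using measurable_sets[OF m, of X] X by (simp add: sets_cantor_measure)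
  show "mu {g. g \<circ> e \<in> X} = mu X"
    unfolding pre using measure_distr[OF m, of X] X d by (simp add: sets_cantor_measure)
qed

lemma cantor_ideal_null: "cantor_ideal_omega null_ideal"
proof (intro cantor_ideal_omega.intro cantor_ideal.intro)
  show "UNIV \<notin> null_ideal" using null_ideal_iff[OF bo.top] cm.prob_space by simp
  show "{g. g \<circ> e \<in> Y} \<in> null_ideal" if e: "inj e" and Y: "Y \<in> null_ideal" for e Y
  proof -
    obtain N where N: "Y \<subseteq> N" "N \<in> clopen_sigma UNIV" "mu N = 0" using null_ideal_cover[OF Y] .
    have "{g. g \<circ> e \<in> N} \<in> null_ideal"
      using mu_pullback[OF e N(2)] N(3) null_ideal_iff by simp
    then show ?thesis by (rule null_subset) (use N(1) in auto)
  qed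
  show "X \<in> null_ideal" if e: "inj e" and X: "X \<in> clopen_sigma UNIV" "{g. g \<circ> e \<in> X} \<in> null_ideal" for e X
    using mu_pullback[OF e X(1)] X null_ideal_iff by simp
  fix B :: "(nat \<Rightarrow> bool) set set"
  assume B: "B \<subseteq> clopen_sigma UNIV" "{} \<in> B"
    "\<And>X. (\<And>n::nat. X n \<in> B) \<Longrightarrow> (\<Union>n. X n) \<in> B"
    "\<And>X Y. X \<in> clopen_sigma UNIV \<Longrightarrow> X - Y \<in> null_ideal \<Longrightarrow> Y \<in> B \<Longrightarrow> X \<in> B"
  \<comment> \<open>Exhaustion: a countable union of members whose measures approach the supremum
    leaves no room for a further member of positive measure.\<close>
  define r where "r = (SUP X\<in>B. mu X)"
  have bdd: "bdd_above (mu ` B)" by (intro bdd_aboveI[of _ 1]) auto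
  have le: "mu X \<le> r" if "X \<in> B" for X unfolding r_def using that bdd by (rule cSUP_upper)
  have "\<exists>X\<in>B. r - 1 / Suc n < mu X" for n
    using less_cSUP_iff[OF _ bdd, of "r - 1 / Suc n"] B(2) by (auto simp: r_def)
  then obtain X where X: "\<And>n. X n \<in> B" "\<And>n. r - 1 / Suc n < mu (X n)" by metis
  define S where "S = (\<Union>n. X n)"
  have S: "S \<in> B" unfolding S_def using X(1) by (rule B(3))
  have "r \<le> mu S"
  proof (rule field_le_epsilon)
    fix e :: real assume "e > 0"
    then obtain n where n: "1 / Suc n < e" using nat_approx_posE by blast
    have "mu (X n) \<le> mu S"
      using X(1) S B(1) by (intro cm.finite_measure_mono) (auto simp: S_def sets_cantor_measure)
    then show "r \<le> mu S + e" using X(2)[of n] n by linarith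
  qed
  have "Y - S \<in> null_ideal" if Y: "Y \<in> B" for Y
  proof -
    have "(\<Union>n::nat. if n = 0 then Y else S) \<in> B" using Y S by (intro B(3)) auto
    moreover have "(\<Union>n::nat. if n = 0 then Y else S) = Y \<union> S" by (auto split: if_splits)
    ultimately have "mu (Y \<union> S) \<le> mu S" using le \<open>r \<le> mu S\<close> by force
    moreover have "mu (Y \<union> S) = mu S + mu (Y - S)"
      using cm.finite_measure_Union[of S "Y - S"] Y S B(1) by (auto simp: sets_cantor_measure Un_commute)
    ultimately have "mu (Y - S) = 0" by (simp add: measure_le_0_iff)
    then show ?thesis using null_ideal_iff[of "Y - S"] Y S B(1) by auto
  qed
  then show "\<exists>S\<in>B. \<forall>X\<in>B. X - S \<in> null_ideal" using S by blast
qed (fact null_subset null_UN null_singleton)+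

section \<open>Clopen sets, regularity and covers of null sets\<close>

definition clop :: "(nat \<Rightarrow> bool) set \<Rightarrow> bool" where
  "clop C \<longleftrightarrow> (\<exists>N. \<forall>x\<in>C. cyl x N \<subseteq> C)"

lemma clopI: "(\<And>x y. x \<in> C \<Longrightarrow> y \<in> cyl x N \<Longrightarrow> y \<in> C) \<Longrightarrow> clop C"
  unfolding clop_def by blast

lemma clop_level:
  assumes "clop C"
  obtains N where "\<And>x y M. N \<le> M \<Longrightarrow> y \<in> cyl x M \<Longrightarrow> y \<in> C \<longleftrightarrow> x \<in> C"
proof -
  obtain N where N: "\<forall>x\<in>C. cyl x N \<subseteq> C" using assms unfolding clop_def by blast
  show thesis
  proof (rule that)
    fix x y M assume M: "N \<le> M" "y \<in> cyl x M"
    then have "y \<in> cyl x N" "x \<in> cyl y N" by (auto simp: cyl_def)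
    then show "y \<in> C \<longleftrightarrow> x \<in> C" using N by blast
  qed
qed

lemma clop_cyl: "clop (cyl x N)"
  by (rule clopI[of _ N]) (simp add: cyl_def)

lemma clop_Un: assumes "clop C" "clop D" shows "clop (C \<union> D)"
proof -
  obtain N where N: "\<And>x y M. N \<le> M \<Longrightarrow> y \<in> cyl x M \<Longrightarrow> y \<in> C \<longleftrightarrow> x \<in> C" using clop_level[OF assms(1)] by blast
  obtain N' where N': "\<And>x y M. N' \<le> M \<Longrightarrow> y \<in> cyl x M \<Longrightarrow> y \<in> D \<longleftrightarrow> x \<in> D" using clop_level[OF assms(2)] by blast
  show ?thesis
    by (rule clopI[of _ "max N N'"]) (use N[of "max N N'"] N'[of "max N N'"] in auto)
qed

lemma clop_Diff: assumes "clop C" "clop D" shows "clop (C - D)"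
proof -
  obtain N where N: "\<And>x y M. N \<le> M \<Longrightarrow> y \<in> cyl x M \<Longrightarrow> y \<in> C \<longleftrightarrow> x \<in> C" using clop_level[OF assms(1)] by blast
  obtain N' where N': "\<And>x y M. N' \<le> M \<Longrightarrow> y \<in> cyl x M \<Longrightarrow> y \<in> D \<longleftrightarrow> x \<in> D" using clop_level[OF assms(2)] by blast
  show ?thesis
    by (rule clopI[of _ "max N N'"]) (use N[of "max N N'"] N'[of "max N N'"] in auto)
qed

lemma clop_UNIV: "clop UNIV" by (rule clopI) simp

lemma clop_Int: "clop C \<Longrightarrow> clop D \<Longrightarrow> clop (C \<inter> D)"
  using clop_Diff[of C "UNIV - D"] clop_Diff[OF clop_UNIV] by (simp add: Diff_Diff_Int Int_absorb1 double_diff Diff_Compl Compl_eq_Diff_UNIV[symmetric])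

lemma clop_UN: "finite J \<Longrightarrow> (\<And>j. j \<in> J \<Longrightarrow> clop (C j)) \<Longrightarrow> clop (\<Union>j\<in>J. C j)"
proof (induction J rule: finite_induct)
  case empty
  show ?case by (rule clopI) simp
next
  case (insert j J)
  then show ?case by (simp add: clop_Un)
qed

lemma clop_openin: "clop C \<Longrightarrow> openin (cantor_space UNIV) C"
  unfolding clop_def openin_cantor_space_cyl by blast

lemma clop_borel: assumes "clop C" shows "C \<in> clopen_sigma UNIV"
proof (rule clopen_sigma_basic)
  show "openin (cantor_space UNIV) C" by (rule clop_openin[OF assms])
  have "openin (cantor_space UNIV) (UNIV - C)"
    by (rule clop_openin[OF clop_Diff[OF clop_UNIV assms]])
  then show "closedin (cantor_space UNIV) C" by (simp add: closedin_def)
qed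

text \<open>A level \<open>N\<close> and a finite set of initial segments of length \<open>N\<close>
  determine the set.\<close>

lemma countable_clop: "countable {C. clop C}"
proof -
  have "{C. clop C} \<subseteq> (\<lambda>(N, F). {x. map x [0..<N] \<in> F}) ` (UNIV \<times> {F. finite F})"
  proof
    fix C assume "C \<in> {C. clop C}"
    then obtain N where N: "\<And>x y M. N \<le> M \<Longrightarrow> y \<in> cyl x M \<Longrightarrow> y \<in> C \<longleftrightarrow> x \<in> C"
      using clop_level by blast
    let ?F = "(\<lambda>x. map x [0..<N]) ` C"
    have "?F \<subseteq> {xs. set xs \<subseteq> UNIV \<and> length xs = N}" by auto
    then have "finite ?F" by (rule finite_subset) (rule finite_lists_length_eq, simp)
    moreover have "C = {x. map x [0..<N] \<in> ?F}"
    proof (intro equalityI subsetI)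
      fix y assume "y \<in> {x. map x [0..<N] \<in> ?F}"
      then obtain x where x: "x \<in> C" "map y [0..<N] = map x [0..<N]" by blast
      then have "y \<in> cyl x N" by (simp add: cyl_def map_eq_conv)
      then show "y \<in> C" using N[of N y x] x(1) by simp
    qed (intro CollectI imageI)
    ultimately show "C \<in> (\<lambda>(N, F). {x. map x [0..<N] \<in> F}) ` (UNIV \<times> {F. finite F})"
      by (intro image_eqI[of _ _ "(N, ?F)"]) auto
  qed
  moreover have "countable {F :: bool list set. finite F}" by (rule countable_Collect_finite)
  ultimately show ?thesis by (meson countable_SIGMA countable_image countable_subset uncountable_def countableI_type)
qed

text \<open>The levels form an increasing exhaustion of an open \<open>G\<close> by clopen sets;
  covers of null sets are later cut from them.\<close>

definition interior_level :: "(nat \<Rightarrow> bool) set \<Rightarrow> nat \<Rightarrow> (nat \<Rightarrow> bool) set" where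
  "interior_level G j = {x. cyl x j \<subseteq> G}"

lemma clop_interior_level: "clop (interior_level G j)"
  by (rule clopI[of _ j]) (simp add: interior_level_def cyl_eq)

lemma interior_level_mono: "i \<le> j \<Longrightarrow> interior_level G i \<subseteq> interior_level G j"
  unfolding interior_level_def using cyl_antimono by blast

lemma interior_level_UN: "openin (cantor_space (UNIV :: nat set)) G \<Longrightarrow> (\<Union>j. interior_level G j) = G"
  unfolding openin_cantor_space_cyl interior_level_def using cyl_self by auto

lemma open_borel: "openin (cantor_space (UNIV :: nat set)) G \<Longrightarrow> G \<in> clopen_sigma UNIV"
  using UN_borel[of "interior_level G" UNIV] clop_borel[OF clop_interior_level] interior_level_UN by simp

text \<open>Covering \<open>X\<close> and its complement by open sets with small overlap makes the
  complement step a swap of \<open>G\<close> and \<open>H\<close>. For a union only finitely many of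
  the \<open>H n\<close> may be intersected, so the sets \<open>G n\<close> are cut off once they
  nearly exhaust their union.\<close>

lemma regularity:
  assumes "X \<in> clopen_sigma (UNIV :: nat set)"
  shows "\<forall>\<epsilon>>0. \<exists>G H. openin (cantor_space UNIV) G \<and> openin (cantor_space UNIV) H \<and>
    X \<subseteq> G \<and> UNIV - X \<subseteq> H \<and> mu (G \<inter> H) < \<epsilon>"
  using assms unfolding clopen_sigma_def
proof induction
  case (Basic a)
  show ?case
  proof (intro allI impI exI conjI)
    fix \<epsilon> :: real assume "\<epsilon> > 0"
    show "openin (cantor_space UNIV) a" "openin (cantor_space UNIV) (UNIV - a)"
      using Basic by (auto simp: closedin_def)
    show "a \<subseteq> a" "UNIV - a \<subseteq> UNIV - a" by auto
    show "mu (a \<inter> (UNIV - a)) < \<epsilon>" using \<open>\<epsilon> > 0\<close> by simp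
  qed
next
  case Empty
  show ?case by (intro allI impI exI[of _ "{}"] exI[of _ UNIV]) (auto simp: openin_cantor_space_cyl)
next
  case (Compl a)
  show ?case
  proof (intro allI impI)
    fix \<epsilon> :: real assume "\<epsilon> > 0"
    with Compl.IH obtain G H where "openin (cantor_space UNIV) G" "openin (cantor_space UNIV) H"
      "a \<subseteq> G" "UNIV - a \<subseteq> H" "mu (G \<inter> H) < \<epsilon>" by (elim allE[of _ \<epsilon>] impE exE conjE) 
    then show "\<exists>G H. openin (cantor_space UNIV) G \<and> openin (cantor_space UNIV) H \<and>
      topspace (cantor_space UNIV) - a \<subseteq> G \<and> UNIV - (topspace (cantor_space UNIV) - a) \<subseteq> H \<and> mu (G \<inter> H) < \<epsilon>"
      by (intro exI[of _ H] exI[of _ G]) (auto simp: Int_commute)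
  qed
next
  case (Union a)
  show ?case
  proof (intro allI impI)
    fix \<epsilon> :: real assume \<epsilon>: "\<epsilon> > 0"
    \<comment> \<open>The overlaps sum to at most half of \<open>\<epsilon>\<close>; the other half
      is reserved for the tail of the union.\<close>
    have "\<exists>G H. openin (cantor_space UNIV) G \<and> openin (cantor_space UNIV) H \<and>
        a n \<subseteq> G \<and> UNIV - a n \<subseteq> H \<and> mu (G \<inter> H) < \<epsilon> / 2 * (1/2) ^ Suc n" for n
      using Union.IH[of n, rule_format, of "\<epsilon> / 2 * (1/2) ^ Suc n"] \<epsilon> by simp
    then obtain G H where GH: "\<And>n. openin (cantor_space UNIV) (G n)" "\<And>n. openin (cantor_space UNIV) (H n)"
      "\<And>n. a n \<subseteq> G n" "\<And>n. UNIV - a n \<subseteq> H n" "\<And>n. mu (G n \<inter> H n) < \<epsilon> / 2 * (1/2) ^ Suc n" by metis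
    note Gb = open_borel[OF GH(1)] and Hb = open_borel[OF GH(2)]
    let ?G = "\<Union>n. G n"
    have Gb': "?G \<in> clopen_sigma UNIV" by (rule UN_borel[OF Gb])
    have fb: "(\<Union>n<N. G n) \<in> clopen_sigma UNIV" for N by (rule UN_borel[OF Gb])
    have "(\<lambda>N. mu (\<Union>n<N. G n)) \<longlonglongrightarrow> mu (\<Union>N. \<Union>n<N. G n)"
    proof (rule cm.finite_Lim_measure_incseq)
      show "incseq (\<lambda>N. \<Union>n<N. G n)" by (rule incseq_SucI) (auto simp: lessThan_Suc)
    qed (use fb in \<open>auto simp: sets_cantor_measure\<close>)
    moreover have "(\<Union>N. \<Union>n<N. G n) = ?G" by blast
    ultimately have "(\<lambda>N. mu (\<Union>n<N. G n)) \<longlonglongrightarrow> mu ?G" by simp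
    then have "\<forall>\<^sub>F N in sequentially. mu ?G - \<epsilon> / 2 < mu (\<Union>n<N. G n)"
      using \<epsilon> by (intro order_tendstoD(1)) auto
    then obtain N where N: "mu ?G - \<epsilon> / 2 < mu (\<Union>n<N. G n)" by (auto simp: eventually_sequentially)
    let ?H = "UNIV \<inter> (\<Inter>n\<in>{..<N}. H n)"
    have "openin (cantor_space UNIV) ?H"
    proof (cases "N = 0")
      case False
      then have "openin (cantor_space UNIV) (\<Inter>n\<in>{..<N}. H n)" using GH(2) by (intro openin_INT2) auto
      then show ?thesis by simp
    qed (auto simp: openin_cantor_space_cyl)
    moreover have "openin (cantor_space UNIV) ?G" using GH(1) by blast
    moreover have "(\<Union>n. a n) \<subseteq> ?G" using GH(3) by blast
    moreover have "UNIV - (\<Union>n. a n) \<subseteq> ?H" using GH(4) by blast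
    moreover have "mu (?G \<inter> ?H) < \<epsilon>"
    proof -
      have m1: "?G - (\<Union>n<N. G n) \<in> sets cantor_measure" using Gb' fb by (auto simp: sets_cantor_measure)
      have m2: "(\<Union>n<N. G n \<inter> H n) \<in> sets cantor_measure"
        unfolding sets_cantor_measure by (rule UN_borel) (use Gb Hb in auto)
      have "?G \<inter> ?H \<subseteq> (?G - (\<Union>n<N. G n)) \<union> (\<Union>n<N. G n \<inter> H n)" by auto
      then have "mu (?G \<inter> ?H) \<le> mu ((?G - (\<Union>n<N. G n)) \<union> (\<Union>n<N. G n \<inter> H n))"
        using m1 m2 by (intro cm.finite_measure_mono) auto
      also have "\<dots> \<le> mu (?G - (\<Union>n<N. G n)) + mu (\<Union>n<N. G n \<inter> H n)"
        using m1 m2 by (rule measure_Un_le)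
      also have "mu (?G - (\<Union>n<N. G n)) = mu ?G - mu (\<Union>n<N. G n)"
        using Gb' fb by (intro cm.finite_measure_Diff) (auto simp: sets_cantor_measure)
      also have "mu (\<Union>n<N. G n \<inter> H n) \<le> (\<Sum>n<N. mu (G n \<inter> H n))"
        using Gb Hb by (intro measure_UNION_le) (auto simp: sets_cantor_measure)
      also have "(\<Sum>n<N. mu (G n \<inter> H n)) \<le> (\<Sum>n<N. \<epsilon> / 2 * (1/2) ^ Suc n)"
        using GH(5) by (intro sum_mono less_imp_le)
      also have "(\<Sum>n<N. \<epsilon> / 2 * (1/2) ^ Suc n) = \<epsilon> / 2 * (1 - (1/2) ^ N)"
        by (induction N) (auto simp: field_simps)
      also have "\<epsilon> / 2 * (1 - (1/2) ^ N) \<le> \<epsilon> / 2" using \<epsilon> by (simp add: field_simps)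
      finally show ?thesis using N by simp
    qed
    ultimately show "\<exists>G H. openin (cantor_space UNIV) G \<and> openin (cantor_space UNIV) H \<and>
      (\<Union>n. a n) \<subseteq> G \<and> UNIV - (\<Union>n. a n) \<subseteq> H \<and> mu (G \<inter> H) < \<epsilon>" by blast
  qed
qed

lemma null_open_cover:
  assumes "X \<in> null_ideal" "\<epsilon> > 0"
  obtains G where "openin (cantor_space UNIV) G" "X \<subseteq> G" "mu G < \<epsilon>"
proof -
  obtain N where N: "X \<subseteq> N" "N \<in> clopen_sigma UNIV" "mu N = 0" using null_ideal_cover[OF assms(1)] .
  obtain G H where GH: "openin (cantor_space UNIV) G" "openin (cantor_space UNIV) H"
      "N \<subseteq> G" "UNIV - N \<subseteq> H" "mu (G \<inter> H) < \<epsilon>"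
    using regularity[OF N(2), rule_format, OF assms(2)] by (elim exE conjE)
  note b = open_borel[OF GH(1)] open_borel[OF GH(2)] N(2)
  have "mu G \<le> mu (N \<union> (G \<inter> H))"
    using b GH(4) by (intro cm.finite_measure_mono) (auto simp: sets_cantor_measure)
  also have "\<dots> \<le> mu N + mu (G \<inter> H)" using b by (intro measure_Un_le) (auto simp: sets_cantor_measure)
  finally have "mu G < \<epsilon>" using N(3) GH(5) by simp
  then show thesis using that[OF GH(1)] GH(3) N(1) by blast
qed

lemma limsup_null:
  assumes C: "\<And>n::nat. C n \<in> clopen_sigma UNIV" and s: "summable (\<lambda>n. mu (C n))"
  shows "{x. \<exists>\<^sub>\<infinity>n. x \<in> C n} \<in> null_ideal"
proof -
  have "limsup C \<in> null_sets cantor_measure"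
    by (rule borel_cantelli_limsup1) (use C s in \<open>auto simp: sets_cantor_measure cm.emeasure_eq_measure\<close>)
  moreover have "{x. \<exists>\<^sub>\<infinity>n. x \<in> C n} \<subseteq> limsup C"
    by (auto simp: limsup_INF_SUP INFM_nat_le)
  ultimately show ?thesis unfolding null_ideal_def by blast
qed

text \<open>With levels \<open>j n\<close> growing fast enough, the sets \<open>C n\<close> collect the part of \<open>G n\<close> seen at level
  \<open>j n\<close> and the parts of the earlier \<open>G k\<close> newly seen between levels \<open>j (n - 1)\<close> and \<open>j n\<close>.\<close>

lemma null_clop_limsup:
  assumes X: "X \<in> null_ideal" and \<epsilon>: "\<And>n. \<epsilon> n > 0"
  obtains C where "\<And>n::nat. clop (C n)" "\<And>n. mu (C n) \<le> \<epsilon> n" "X \<subseteq> {x. \<exists>\<^sub>\<infinity>n. x \<in> C n}"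
proof -
  \<comment> \<open>\<open>C n\<close> will have one part of measure below \<open>\<delta> n\<close>
    and \<open>n\<close> parts of measure at most \<open>\<delta> n\<close>; together these fit into
    \<open>\<epsilon> n\<close>.\<close>
  define \<delta> where "\<delta> n = \<epsilon> n / (2 * Suc n)" for n
  have \<delta>: "\<delta> n > 0" "\<delta> n \<le> \<epsilon> n / 2" "n * \<delta> n \<le> \<epsilon> n / 2" for n
    using \<epsilon>[of n] by (auto simp: \<delta>_def field_simps)
  have "\<exists>G. openin (cantor_space UNIV) G \<and> X \<subseteq> G \<and> mu G < \<delta> n" for n
    by (rule null_open_cover[OF X \<delta>(1)[of n]]) blast
  then obtain G where G: "\<And>n. openin (cantor_space UNIV) (G n)" "\<And>n. X \<subseteq> G n" "\<And>n. mu (G n) < \<delta> n"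
    by metis
  let ?A = "\<lambda>k j. interior_level (G k) j"
  have Ab: "?A k j \<in> sets cantor_measure" for k j
    unfolding sets_cantor_measure by (rule clop_borel[OF clop_interior_level])
  have Gb: "G k \<in> sets cantor_measure" for k
    unfolding sets_cantor_measure by (rule open_borel[OF G(1)])
  have AG: "?A k j \<subseteq> G k" for k j using interior_level_UN[OF G(1)[of k]] by blast
  \<comment> \<open>What remains unseen of each \<open>G k\<close> after step \<open>n\<close> must
    be below the tolerance of the next step, whence \<open>\<delta> (Suc n)\<close>.\<close>
  have "\<exists>j\<ge>n. \<forall>k\<in>{..n}. mu (G k) - \<delta> (Suc n) < mu (?A k j)" for n
  proof -
    have "\<forall>\<^sub>F j in sequentially. mu (G k) - \<delta> (Suc n) < mu (?A k j)" for k
    proof -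
      have "(\<lambda>j. mu (?A k j)) \<longlonglongrightarrow> mu (\<Union>j. ?A k j)"
        by (intro cm.finite_Lim_measure_incseq) (use Ab interior_level_mono in \<open>auto simp: incseq_def\<close>)
      then show ?thesis using \<delta>(1)[of "Suc n"] interior_level_UN[OF G(1)[of k]]
        by (intro order_tendstoD(1)) auto
    qed
    then have "\<forall>\<^sub>F j in sequentially. \<forall>k\<in>{..n}. mu (G k) - \<delta> (Suc n) < mu (?A k j)"
      by (intro eventually_ball_finite) auto
    then obtain J where "\<And>j. j \<ge> J \<Longrightarrow> \<forall>k\<in>{..n}. mu (G k) - \<delta> (Suc n) < mu (?A k j)"
      by (auto simp: eventually_sequentially)
    then show ?thesis by (intro exI[of _ "max n J"]) auto
  qed
  then obtain j where j: "\<And>n. n \<le> j n" "\<And>n k. k \<le> n \<Longrightarrow> mu (G k) - \<delta> (Suc n) < mu (?A k (j n))"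
    by (metis atMost_iff)
  define C where "C n = ?A n (j n) \<union> (\<Union>k<n. ?A k (j n) - ?A k (j (n - 1)))" for n
  show thesis
  proof (rule that)
    show "clop (C n)" for n
      unfolding C_def by (intro clop_Un clop_UN clop_Diff clop_interior_level) auto
    show "mu (C n) \<le> \<epsilon> n" for n
    proof -
      have "mu (?A k (j n) - ?A k (j (n - 1))) \<le> \<delta> n" if "k < n" for k
      proof -
        have "k \<le> n - 1" using that by simp
        have "mu (?A k (j n) - ?A k (j (n - 1))) \<le> mu (G k - ?A k (j (n - 1)))"
          using AG Ab Gb by (intro cm.finite_measure_mono) auto
        also have "\<dots> = mu (G k) - mu (?A k (j (n - 1)))"
          using AG Ab Gb by (intro cm.finite_measure_Diff) auto
        also have "\<dots> \<le> \<delta> n" using j(2)[of k "n - 1", OF \<open>k \<le> n - 1\<close>] that by simp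
        finally show ?thesis .
      qed
      then have "(\<Sum>k<n. mu (?A k (j n) - ?A k (j (n - 1)))) \<le> (\<Sum>k<n. \<delta> n)" by (intro sum_mono) auto
      moreover have "mu (\<Union>k<n. ?A k (j n) - ?A k (j (n - 1))) \<le> (\<Sum>k<n. mu (?A k (j n) - ?A k (j (n - 1))))"
        using Ab by (intro measure_UNION_le) auto
      moreover have "mu (?A n (j n)) \<le> mu (G n)" using AG Ab Gb by (intro cm.finite_measure_mono) auto
      moreover have "mu (C n) \<le> mu (?A n (j n)) + mu (\<Union>k<n. ?A k (j n) - ?A k (j (n - 1)))"
        unfolding C_def using Ab by (intro measure_Un_le) auto
      ultimately show ?thesis using G(3)[of n] \<delta>(2,3)[of n] by simp
    qed
    show "X \<subseteq> {x. \<exists>\<^sub>\<infinity>n. x \<in> C n}"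
    proof
      fix x assume x: "x \<in> X"
      have "\<exists>n\<ge>k. x \<in> C n" for k
      proof -
        have "x \<in> (\<Union>i. ?A k i)" using G(1,2) x interior_level_UN by blast
        then obtain i where "x \<in> ?A k i" by blast
        then have "x \<in> ?A k (j (max i k))"
          using interior_level_mono[of i "j (max i k)" "G k"] j(1)[of "max i k"] by auto
        then have ex: "k \<le> max i k \<and> x \<in> ?A k (j (max i k))" by simp
        \<comment> \<open>At the first such step \<open>x\<close> is either in the part of
          \<open>G k\<close> seen at step \<open>k\<close> itself, or newly seen; both are contained
          in \<open>C n\<close>.\<close>
        define n where "n = (LEAST n. k \<le> n \<and> x \<in> ?A k (j n))"
        have n: "k \<le> n" "x \<in> ?A k (j n)"
          unfolding n_def using LeastI[of "\<lambda>n. k \<le> n \<and> x \<in> ?A k (j n)", OF ex] by auto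
        have least: "\<not> (k \<le> n' \<and> x \<in> ?A k (j n'))" if "n' < n" for n'
          using not_less_Least[of n' "\<lambda>n. k \<le> n \<and> x \<in> ?A k (j n)"] that unfolding n_def by blast
        have "x \<in> C n"
        proof (cases "n = k")
          case True
          then show ?thesis using n unfolding C_def by blast
        next
          case False
          then have "k < n" using n(1) by simp
          then have "x \<notin> ?A k (j (n - 1))" using least[of "n - 1"] by auto
          then show ?thesis using n(2) \<open>k < n\<close> unfolding C_def by blast
        qed
        then show ?thesis using n(1) by blast
      qed
      then show "x \<in> {x. \<exists>\<^sub>\<infinity>n. x \<in> C n}" by (simp add: INFM_nat_le)
    qed
  qed
qed

section \<open>Slaloms from base elements\<close>

text \<open>Expand \<open>\<integral>(Y - c 1\<^sub>P)\<^sup>2 \<ge> 0\<close> for \<open>Y = \<Sum>i\<in>J. g - 1\<^bsub>G i\<^esub>\<close> with the optimal \<open>c = card J * g / 2\<close>;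
  pairwise independence makes the summands of \<open>Y\<close> orthogonal.\<close>

lemma (in prob_space) pairwise_independent_card_bound:
  fixes g :: real
  assumes J: "finite J" and G: "\<And>i. i \<in> J \<Longrightarrow> G i \<in> events" "\<And>i. i \<in> J \<Longrightarrow> prob (G i) = g"
    "\<And>i j. i \<in> J \<Longrightarrow> j \<in> J \<Longrightarrow> i \<noteq> j \<Longrightarrow> prob (G i \<inter> G j) = g * g"
    and P: "P \<in> events" and g: "0 < g" and small: "\<And>i. i \<in> J \<Longrightarrow> prob (P \<inter> G i) \<le> g * prob P / 2"
  shows "real (card J) * g * prob P \<le> 4"
proof -
  define K where "K = real (card J)"
  define d where "d i x = g - (indicator (G i) x :: real)" for i x
  define Y where "Y x = (\<Sum>i\<in>J. d i x)" for x
  define c where "c = K * g / 2"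
  define p where "p = prob P"
  have ind: "integrable M (indicator A :: 'a \<Rightarrow> real)" if "A \<in> events" for A
    using that by (simp add: emeasure_eq_measure)
  have indI: "integral\<^sup>L M (indicator A :: 'a \<Rightarrow> real) = prob A" if "A \<in> events" for A
    using that sets.sets_into_space[OF that] by (simp add: Int_absorb1)
  have dd_eq: "d i x * d j x = g * g - g * indicator (G i) x - g * indicator (G j) x + indicator (G i \<inter> G j) x" for i j x
    by (auto simp: d_def indicator_def algebra_simps)
  have dd: "integrable M (\<lambda>x. d i x * d j x)" "(\<integral>x. d i x * d j x \<partial>M) = prob (G i \<inter> G j) - g * g"
    if "i \<in> J" "j \<in> J" for i j
  proof -
    have 1: "integrable M (indicator (G i) :: 'a \<Rightarrow> real)" "integrable M (indicator (G j) :: 'a \<Rightarrow> real)"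
      "integrable M (indicator (G i \<inter> G j) :: 'a \<Rightarrow> real)" using that G(1) by (auto intro!: ind)
    then show "integrable M (\<lambda>x. d i x * d j x)" unfolding dd_eq by simp
    have "(\<integral>x. d i x * d j x \<partial>M) = g * g - g * prob (G i) - g * prob (G j) + prob (G i \<inter> G j)"
      unfolding dd_eq using 1 that G(1) by (simp add: indI prob_space)
    then show "(\<integral>x. d i x * d j x \<partial>M) = prob (G i \<inter> G j) - g * g" using G(2) that by simp
  qed
  have YY_eq: "Y x * Y x = (\<Sum>i\<in>J. \<Sum>j\<in>J. d i x * d j x)" for x by (simp add: Y_def sum_product)
  have YY_int: "integrable M (\<lambda>x. Y x * Y x)"
    unfolding YY_eq using dd(1) by (intro Bochner_Integration.integrable_sum)
  have "(\<integral>x. Y x * Y x \<partial>M) = (\<Sum>i\<in>J. \<Sum>j\<in>J. \<integral>x. d i x * d j x \<partial>M)"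
    unfolding YY_eq using dd(1)
    by (subst Bochner_Integration.integral_sum)
       (auto intro!: sum.cong Bochner_Integration.integral_sum Bochner_Integration.integrable_sum)
  also have "\<dots> = (\<Sum>i\<in>J. \<Sum>j\<in>J. if i = j then g - g * g else 0)"
    using dd(2) G(2,3) by (intro sum.cong refl) auto
  also have "\<dots> = K * (g - g * g)" using J by (simp add: K_def)
  also have "\<dots> \<le> K * g" by (rule mult_left_mono) (auto simp: K_def)
  finally have YY: "(\<integral>x. Y x * Y x \<partial>M) \<le> K * g" .
  have PY_eq: "indicator P x * Y x = (\<Sum>i\<in>J. g * indicator P x - indicator (P \<inter> G i) x)" for x
    unfolding Y_def sum_distrib_left by (intro sum.cong refl) (auto simp: d_def indicator_def algebra_simps)
  have PG: "integrable M (indicator (P \<inter> G i) :: 'a \<Rightarrow> real)" "integrable M (indicator P :: 'a \<Rightarrow> real)" if "i \<in> J" for i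
    using that G(1) P by (auto intro!: ind)
  have PY_int: "integrable M (\<lambda>x. indicator P x * Y x)"
    unfolding PY_eq using PG by (intro Bochner_Integration.integrable_sum) simp
  have "(\<integral>x. indicator P x * Y x \<partial>M) = (\<Sum>i\<in>J. \<integral>x. (g * indicator P x - indicator (P \<inter> G i) x) \<partial>M)"
    unfolding PY_eq using PG by (intro Bochner_Integration.integral_sum) simp
  also have "\<dots> = (\<Sum>i\<in>J. g * p - prob (P \<inter> G i))"
  proof (intro sum.cong refl)
    fix i assume "i \<in> J"
    then show "(\<integral>x. (g * indicator P x - indicator (P \<inter> G i) x) \<partial>M) = g * p - prob (P \<inter> G i)"
      using PG[of i] indI[OF P] indI[of "P \<inter> G i"] P G(1) by (simp add: p_def)
  qed
  finally have "(\<integral>x. indicator P x * Y x \<partial>M) = (\<Sum>i\<in>J. g * p - prob (P \<inter> G i))" .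
  moreover have "(\<Sum>i\<in>J. g * p / 2) \<le> (\<Sum>i\<in>J. g * p - prob (P \<inter> G i))"
    using small by (intro sum_mono) (force simp: p_def)
  ultimately have PY: "K * (g * p / 2) \<le> (\<integral>x. indicator P x * Y x \<partial>M)" by (simp add: K_def)
  have c0: "0 \<le> c" using g by (simp add: c_def K_def)
  have sq_eq: "(Y x - c * indicator P x) ^ 2 = Y x * Y x - 2 * c * (indicator P x * Y x) + c * c * indicator P x" for x
    by (auto simp: indicator_def power2_eq_square algebra_simps)
  have "0 \<le> (\<integral>x. (Y x - c * indicator P x) ^ 2 \<partial>M)" by (rule integral_nonneg_AE) simp
  also have "\<dots> = (\<integral>x. Y x * Y x \<partial>M) - 2 * c * (\<integral>x. indicator P x * Y x \<partial>M) + c * c * p"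
    unfolding sq_eq using YY_int PY_int ind[OF P] indI[OF P] by (simp add: p_def)
  also have "\<dots> \<le> K * g - 2 * c * (K * (g * p / 2)) + c * c * p"
    using YY mult_left_mono[OF PY, of "2 * c"] c0 by linarith
  also have "\<dots> = K * g * (1 - K * g * p / 4)" by (simp add: c_def algebra_simps)
  finally have *: "0 \<le> K * g * (1 - K * g * p / 4)" .
  show ?thesis
  proof (cases "K = 0")
    case False
    then have "0 < K * g" using g by (simp add: K_def)
    then have "0 \<le> 1 - K * g * p / 4" using * by (simp add: zero_le_mult_iff)
    then show ?thesis by (simp add: K_def p_def)
  qed (simp add: K_def)
qed

section \<open>Blocks and parity sets\<close>

definition block :: "nat \<Rightarrow> nat \<Rightarrow> (nat \<Rightarrow> bool) set" where
  "block n i = {x. \<forall>j\<in>{i * (n * n)..<Suc i * (n * n)}. x j = True}"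

lemma clop_block: "clop (block n i)"
  by (rule clopI[of _ "Suc i * (n * n)"]) (simp add: block_def cyl_def)

lemma block_borel [simp]: "block n i \<in> clopen_sigma UNIV"
  by (rule clop_borel[OF clop_block])

lemma mu_block: "mu (block n i) = (1/2) ^ (n * n)"
  unfolding block_def by (subst measure_fixed_coordinates) auto

lemma mu_block_Int:
  assumes "i \<noteq> l"
  shows "mu (block n i \<inter> block n l) = (1/2) ^ (n * n) * (1/2) ^ (n * n)"
proof -
  let ?S = "\<lambda>i. {i * (n * n)..<Suc i * (n * n)}"
  have "?S i \<inter> ?S l = {}" if "i < l" for i l
  proof -
    have "Suc i * (n * n) \<le> l * (n * n)" using that by (intro mult_right_mono) auto
    then show ?thesis by auto
  qed
  then have "?S i \<inter> ?S l = {}" using assms by (metis inf_commute linorder_neqE_nat)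
  then have "card (?S i \<union> ?S l) = n * n + n * n" by (subst card_Un_disjoint) auto
  moreover have "block n i \<inter> block n l = {x. \<forall>j\<in>?S i \<union> ?S l. x j = True}"
    unfolding block_def ball_Un by (rule Collect_conj_eq[symmetric])
  ultimately show ?thesis
    using measure_fixed_coordinates[of "?S i \<union> ?S l" "\<lambda>_. True"] by (simp add: power_add)
qed

text \<open>A null intersection is certainly at most half the measure that independence would
  predict, so \<open>cm.pairwise_independent_card_bound\<close> limits the number of such
  \<open>i\<close>.\<close>

lemma positive_block_finite:
  assumes P: "P \<in> clopen_sigma UNIV" "0 < mu P"
  shows "finite {i. mu (P \<inter> block n i) = 0}"
proof -
  define g :: real where "g = (1/2) ^ (n * n)"
  have g: "0 < g" by (simp add: g_def)
  have "card J \<le> nat \<lceil>4 / (g * mu P)\<rceil>" if J: "J \<subseteq> {i. mu (P \<inter> block n i) = 0}" "finite J" for J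
  proof -
    have "real (card J) * g * mu P \<le> 4"
      by (rule cm.pairwise_independent_card_bound[where G = "block n", OF J(2)])
         (use J(1) P g in \<open>auto simp: sets_cantor_measure mu_block mu_block_Int g_def\<close>)
    then have "real (card J) \<le> 4 / (g * mu P)" using g P(2) by (simp add: field_simps)
    then show ?thesis by linarith
  qed
  then show ?thesis by (intro finite_if_finite_subsets_card_bdd[THEN conjunct1]) blast
qed

text \<open>One of \<open>p\<close> and \<open>q\<close> has measure at least \<open>m / 2\<close>.
  In the first case the pairwise independent blocks are counted against \<open>p\<close>; in the
  second their complements, again pairwise independent, are counted against
  \<open>q\<close>.\<close>

lemma block_half_bound:
  assumes b: "p \<in> clopen_sigma UNIV" "q \<in> clopen_sigma UNIV" and n: "0 < n" and J: "finite J"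
    and m: "0 \<le> m" "m \<le> mu p + mu q"
    and small: "\<And>i. i \<in> J \<Longrightarrow> mu (p \<inter> block n i) \<le> (1/2) ^ (n * n) * m / 4"
      "\<And>i. i \<in> J \<Longrightarrow> mu (q - block n i) \<le> (1/2) ^ (n * n) * m / 4"
  shows "card J * (1/2) ^ (n * n) * m \<le> 8"
proof -
  define g :: real where "g = (1/2) ^ (n * n)"
  \<comment> \<open>From \<open>g \<le> 1 / 2\<close> follows \<open>g \<le> 1 - g\<close>, so the
    bounds stated with \<open>g\<close> also serve for the complements, of measure
    \<open>1 - g\<close>.\<close>
  have "(1/2 :: real) ^ (n * n) \<le> (1/2) ^ 1" using n by (intro power_decreasing) auto
  then have g: "0 < g" "g \<le> 1 / 2" by (auto simp: g_def)
  consider "m / 2 \<le> mu p" | "m / 2 \<le> mu q" using m(2) by linarith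
  then have "card J * g * m \<le> 8"
  proof cases
    case 1
    have "g * (m / 2) \<le> g * mu p" using 1 g by (intro mult_left_mono) auto
    then have "mu (p \<inter> block n i) \<le> g * mu p / 2" if "i \<in> J" for i
      using small(1)[OF that, folded g_def] by (simp add: algebra_simps)
    then have "real (card J) * g * mu p \<le> 4"
      using b g
      by (intro cm.pairwise_independent_card_bound[where G = "block n", OF J])
         (simp_all add: sets_cantor_measure mu_block mu_block_Int g_def)
    moreover have "real (card J) * g * (m / 2) \<le> real (card J) * g * mu p"
      using 1 g by (intro mult_left_mono) auto
    ultimately show ?thesis by simp
  next
    case 2
    have compl: "mu (UNIV - block n i) = 1 - g" for i
      using cm.prob_compl[of "block n i"] by (simp add: sets_cantor_measure mu_block g_def)
    have pair: "mu ((UNIV - block n i) \<inter> (UNIV - block n l)) = (1 - g) * (1 - g)" if "i \<noteq> l" for i l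
    proof -
      have "mu (block n i \<union> block n l) = mu (block n i) + mu (block n l) - mu (block n i \<inter> block n l)"
        by (rule measure_Un3) (auto simp: cm.fmeasurable_eq_sets sets_cantor_measure)
      then have "mu (block n i \<union> block n l) = 2 * g - g * g"
        using that by (simp add: mu_block mu_block_Int g_def)
      moreover have "(UNIV - block n i) \<inter> (UNIV - block n l) = space cantor_measure - (block n i \<union> block n l)" by auto
      moreover have "mu (space cantor_measure - (block n i \<union> block n l)) = 1 - mu (block n i \<union> block n l)"
        by (rule cm.prob_compl) (auto simp: sets_cantor_measure)
      ultimately show ?thesis by (simp add: algebra_simps)
    qed
    have "g * (m / 2) \<le> (1 - g) * mu q" using 2 g m(1) by (intro mult_mono) auto
    moreover have "q \<inter> (UNIV - block n i) = q - block n i" for i by auto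
    ultimately have "mu (q \<inter> (UNIV - block n i)) \<le> (1 - g) * mu q / 2" if "i \<in> J" for i
      using small(2)[OF that] by (simp add: g_def)
    then have "real (card J) * (1 - g) * mu q \<le> 4"
      using b g compl pair
      by (intro cm.pairwise_independent_card_bound[where G = "\<lambda>i. UNIV - block n i", OF J])
         (auto simp: sets_cantor_measure)
    moreover have "real (card J) * g * (m / 2) \<le> real (card J) * (1 - g) * mu q"
      using 2 g m(1) by (intro mult_mono) auto
    ultimately show ?thesis by simp
  qed
  then show ?thesis by (simp add: g_def)
qed

text \<open>Histories are lists of values with the most recent one first.\<close>

primrec parity :: "nat list \<Rightarrow> (nat \<Rightarrow> bool) set" where
  "parity [] = {}"
| "parity (i # s) = (parity s - block (length s) i) \<union> (block (length s) i - parity s)"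

primrec hist :: "(nat \<Rightarrow> nat) \<Rightarrow> nat \<Rightarrow> nat list" where
  "hist f 0 = []"
| "hist f (Suc n) = f n # hist f n"

text \<open>The threshold exceeds the total measure of all later blocks once
  \<open>16 * (1/2) ^ length s < mu d\<close>. A next value outside this set thus leaves
  \<open>parity_limit\<close> undecided by \<open>d\<close>.\<close>

definition bad :: "(nat \<Rightarrow> bool) set \<Rightarrow> nat list \<Rightarrow> nat set" where
  "bad d s = {i. mu (d - parity (i # s)) < (1/2) ^ (length s * length s) * mu d / 4} \<union>
     {i. mu (d \<inter> parity (i # s)) < (1/2) ^ (length s * length s) * mu d / 4}"

text \<open>Membership changes at every block containing the point. The liminf therefore omits the
  points lying in infinitely many of the blocks, whose parity never settles.\<close>

definition parity_limit :: "(nat \<Rightarrow> nat) \<Rightarrow> (nat \<Rightarrow> bool) set" where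
  "parity_limit f = (\<Union>n. \<Inter>m. parity (hist f (n + m)))"

lemma length_hist [simp]: "length (hist f n) = n"
  by (induction n) auto

lemma parity_borel [simp]: "parity s \<in> clopen_sigma UNIV"
proof (induction s)
  case (Cons i s)
  then show ?case unfolding parity.simps by (intro bo.Un bo.Diff block_borel)
qed simp

lemma parity_limit_borel: "parity_limit f \<in> clopen_sigma UNIV"
proof -
  have "(\<Inter>m. parity (hist f (n + m))) \<in> clopen_sigma UNIV" for n using parity_borel by blast
  then show ?thesis unfolding parity_limit_def by (rule UN_borel)
qed

lemma parity_limit_tail:
  assumes x: "\<And>m. n \<le> m \<Longrightarrow> x \<notin> block m (f m)"
  shows "x \<in> parity_limit f \<longleftrightarrow> x \<in> parity (hist f n)"
proof -
  have *: "x \<in> parity (hist f (n + k)) \<longleftrightarrow> x \<in> parity (hist f n)" for k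
    by (induction k) (use x in auto)
  show ?thesis
  proof
    assume "x \<in> parity_limit f"
    then obtain l where "\<And>m. x \<in> parity (hist f (l + m))" unfolding parity_limit_def by blast
    from this[of n] show "x \<in> parity (hist f n)" using *[of l] by (simp add: add.commute)
  next
    assume "x \<in> parity (hist f n)"
    then have "x \<in> (\<Inter>m. parity (hist f (n + m)))" using * by simp
    then show "x \<in> parity_limit f" unfolding parity_limit_def by blast
  qed
qed

text \<open>The squares in the exponent make all later blocks together smaller than a block of step
  \<open>n\<close> by a further factor \<open>(1/2) ^ n\<close>, which is eventually below any fixed
  fraction of \<open>mu d\<close>.\<close>

lemma mu_block_tail: "mu (\<Union>k. block (Suc n + k) (f (Suc n + k))) \<le> (1/2) ^ (n * n) * (1/2) ^ n"
proof -
  let ?c = "(1/2 :: real) ^ (n * n) * (1/2) ^ n"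
  have le: "mu (block (Suc n + k) (f (Suc n + k))) \<le> ?c * (1/2) ^ Suc k" for k
  proof -
    have "n * n + n + Suc k \<le> (Suc n + k) * (Suc n + k)" by (simp add: algebra_simps)
    then have "(1/2 :: real) ^ ((Suc n + k) * (Suc n + k)) \<le> (1/2) ^ (n * n + n + Suc k)"
      by (intro power_decreasing) auto
    also have "\<dots> = ?c * (1/2) ^ Suc k" by (simp add: power_add)
    finally show ?thesis by (simp add: mu_block)
  qed
  have s: "(\<lambda>k. ?c * (1/2) ^ Suc k) sums (?c * 1)"
    by (rule sums_mult[OF power_half_series])
  have su: "summable (\<lambda>k. mu (block (Suc n + k) (f (Suc n + k))))"
    by (rule summable_comparison_test'[OF sums_summable[OF s], of 0]) (use le in auto)
  have "mu (\<Union>k. block (Suc n + k) (f (Suc n + k))) \<le> (\<Sum>k. mu (block (Suc n + k) (f (Suc n + k))))"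
    by (rule cm.finite_measure_subadditive_countably[OF _ su]) (auto simp: sets_cantor_measure)
  also have "\<dots> \<le> (\<Sum>k. ?c * (1/2) ^ Suc k)" by (rule suminf_le[OF le su sums_summable[OF s]])
  also have "\<dots> = ?c" using sums_unique[OF s] by simp
  finally show ?thesis .
qed

text \<open>Write \<open>?p\<close> and \<open>?q\<close> for the parts of \<open>d\<close> inside
  and outside \<open>parity s\<close>. Then \<open>d - parity (i # s)\<close> consists of
  \<open>?p \<inter> block n i\<close> and \<open>?q - block n i\<close>, and for
  \<open>d \<inter> parity (i # s)\<close> the roles are swapped, so \<open>block_half_bound\<close>
  counts each kind of bad value. With \<open>16 * g < mu d\<close> each count is at most
  \<open>1 / (2 * g * g)\<close>, half of \<open>4 ^ (n * n)\<close>.\<close>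

lemma card_bad:
  assumes d: "d \<in> clopen_sigma UNIV" and big: "16 * (1/2) ^ length s < mu d"
  shows "finite (bad d s)" "card (bad d s) \<le> 4 ^ (length s * length s)"
proof -
  define n where "n = length s"
  define g :: real where "g = (1/2) ^ (n * n)"
  have n: "0 < n"
  proof (rule ccontr)
    assume "\<not> 0 < n"
    then have "16 < mu d" using big by (simp add: n_def)
    then show False using cm.prob_le_1[of d] by simp
  qed
  have "(1/2 :: real) ^ (n * n) \<le> (1/2) ^ n" using n by (intro power_decreasing) auto
  then have gm: "16 * g < mu d" using big unfolding g_def n_def by linarith
  have g: "0 < g" by (simp add: g_def)
  let ?p = "d \<inter> parity s" and ?q = "d - parity s"
  have b: "?p \<in> clopen_sigma UNIV" "?q \<in> clopen_sigma UNIV" using d by auto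
  have sum: "mu ?p + mu ?q = mu d"
  proof -
    have "mu (?p \<union> ?q) = mu ?p + mu ?q"
      using b by (intro cm.finite_measure_Union) (auto simp: sets_cantor_measure)
    moreover have "?p \<union> ?q = d" by auto
    ultimately show ?thesis by simp
  qed
  have gg: "g * g * 4 ^ (n * n) = 1"
    unfolding g_def by (simp add: power_mult_distrib[symmetric])
  have bound: "card J \<le> 4 ^ (n * n) div 2" if J: "card J * g * mu d \<le> 8" for J :: "nat set"
  proof -
    have "real (card J) * g * (16 * g) \<le> real (card J) * g * mu d"
      using gm g by (intro mult_left_mono) auto
    then have "2 * real (card J) * (g * g) \<le> 1" using J by (simp add: algebra_simps)
    then have "2 * real (card J) * (g * g) * 4 ^ (n * n) \<le> 1 * 4 ^ (n * n)"
      by (intro mult_right_mono) auto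
    moreover have "2 * real (card J) * (g * g) * 4 ^ (n * n) = 2 * real (card J) * (g * g * 4 ^ (n * n))"
      by (simp add: algebra_simps)
    ultimately have "2 * real (card J) \<le> 4 ^ (n * n)" using gg by simp
    then have "real (2 * card J) \<le> real (4 ^ (n * n))" by simp
    then have "2 * card J \<le> 4 ^ (n * n)" by (simp only: of_nat_le_iff)
    then show ?thesis by simp
  qed
  let ?J1 = "{i. mu (d - parity (i # s)) < (1/2) ^ (length s * length s) * mu d / 4}"
  let ?J2 = "{i. mu (d \<inter> parity (i # s)) < (1/2) ^ (length s * length s) * mu d / 4}"
  have mono: "mu X \<le> mu Y" if "X \<subseteq> Y" "Y \<in> clopen_sigma UNIV" for X Y
    using that by (intro cm.finite_measure_mono) (auto simp: sets_cantor_measure)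
  have pb: "d - parity t \<in> clopen_sigma UNIV" "d \<inter> parity t \<in> clopen_sigma UNIV" for t using d by auto
  have "card J \<le> 4 ^ (n * n) div 2" if J: "J \<subseteq> ?J1" "finite J" for J
  proof (rule bound)
    have "mu (?p \<inter> block n i) \<le> (1/2) ^ (n * n) * mu d / 4 \<and> mu (?q - block n i) \<le> (1/2) ^ (n * n) * mu d / 4"
      if "i \<in> J" for i
    proof -
      have "mu (?p \<inter> block n i) \<le> mu (d - parity (i # s))" "mu (?q - block n i) \<le> mu (d - parity (i # s))"
        by ((rule mono[OF _ pb(1)]; auto simp: n_def)+)
      moreover have "mu (d - parity (i # s)) < (1/2) ^ (n * n) * mu d / 4" using J(1) that by (auto simp: n_def)
      ultimately show ?thesis by linarith
    qed
    then show "card J * g * mu d \<le> 8"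
      unfolding g_def using sum by (intro block_half_bound[OF b n J(2)]) auto
  qed
  then have 1: "finite ?J1 \<and> card ?J1 \<le> 4 ^ (n * n) div 2" by (rule finite_if_finite_subsets_card_bdd) 
  have "card J \<le> 4 ^ (n * n) div 2" if J: "J \<subseteq> ?J2" "finite J" for J
  proof (rule bound)
    have "mu (?q \<inter> block n i) \<le> (1/2) ^ (n * n) * mu d / 4 \<and> mu (?p - block n i) \<le> (1/2) ^ (n * n) * mu d / 4"
      if "i \<in> J" for i
    proof -
      have "mu (?q \<inter> block n i) \<le> mu (d \<inter> parity (i # s))" "mu (?p - block n i) \<le> mu (d \<inter> parity (i # s))"
        by ((rule mono[OF _ pb(2)]; auto simp: n_def)+)
      moreover have "mu (d \<inter> parity (i # s)) < (1/2) ^ (n * n) * mu d / 4" using J(1) that by (auto simp: n_def)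
      ultimately show ?thesis by linarith
    qed
    then show "card J * g * mu d \<le> 8"
      unfolding g_def using sum by (intro block_half_bound[OF b(2,1) n J(2)]) auto
  qed
  then have 2: "finite ?J2 \<and> card ?J2 \<le> 4 ^ (n * n) div 2" by (rule finite_if_finite_subsets_card_bdd)
  show "finite (bad d s)" unfolding bad_def using 1 2 by simp
  have "card (bad d s) \<le> card ?J1 + card ?J2" unfolding bad_def by (rule card_Un_le)
  also have "\<dots> \<le> 4 ^ (n * n)" using 1 2 by linarith
  finally show "card (bad d s) \<le> 4 ^ (length s * length s)" by (simp add: n_def)
qed

text \<open>Off the later blocks, \<open>parity_limit f\<close> agrees with the parity set reached
  after step \<open>n\<close>. If \<open>d\<close> decides the former, one of the two parts cut by
  the latter is covered, up to a null set, by the later blocks.\<close>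

lemma hist_bad:
  assumes d: "d \<in> clopen_sigma UNIV" and big: "16 * (1/2) ^ n < mu d"
    and dec: "mu (d - parity_limit f) = 0 \<or> mu (d \<inter> parity_limit f) = 0"
  shows "f n \<in> bad d (hist f n)"
proof -
  let ?T = "\<Union>k. block (Suc n + k) (f (Suc n + k))"
  let ?B = "parity_limit f" and ?p = "parity (hist f (Suc n))"
  have Tb: "?T \<in> clopen_sigma UNIV" by (rule UN_borel) simp
  note b = d Tb parity_limit_borel[of f] parity_borel[of "hist f (Suc n)"]
  have tail: "x \<in> ?B \<longleftrightarrow> x \<in> ?p" if "x \<notin> ?T" for x
  proof (rule parity_limit_tail)
    fix m assume "Suc n \<le> m"
    then obtain k where "m = Suc n + k" using le_Suc_ex by blast
    then show "x \<notin> block m (f m)" using that by blast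
  qed
  have "mu ?T < (1/2) ^ (n * n) * mu d / 4"
  proof -
    have "(1/2) ^ (n * n) * (1/2) ^ n < (1/2) ^ (n * n) * (mu d / 4)"
    proof (rule mult_strict_left_mono)
      have "0 \<le> (1/2 :: real) ^ n" by simp
      then show "(1/2) ^ n < mu d / 4" using big by linarith
    qed simp
    then have "(1/2) ^ (n * n) * (1/2) ^ n < (1/2) ^ (n * n) * mu d / 4"
      by (simp only: times_divide_eq_right)
    then show ?thesis by (rule order.strict_trans1[OF mu_block_tail[of n f]])
  qed
  moreover have "mu (d - ?p) \<le> mu (d - ?B) + mu ?T"
  proof -
    have "mu (d - ?p) \<le> mu ((d - ?B) \<union> ?T)"
      using b tail by (intro cm.finite_measure_mono) (auto simp: sets_cantor_measure)
    also have "\<dots> \<le> mu (d - ?B) + mu ?T" using b by (intro measure_Un_le) (auto simp: sets_cantor_measure)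
    finally show ?thesis .
  qed
  moreover have "mu (d \<inter> ?p) \<le> mu (d \<inter> ?B) + mu ?T"
  proof -
    have "mu (d \<inter> ?p) \<le> mu ((d \<inter> ?B) \<union> ?T)"
      using b tail by (intro cm.finite_measure_mono) (auto simp: sets_cantor_measure)
    also have "\<dots> \<le> mu (d \<inter> ?B) + mu ?T" using b by (intro measure_Un_le) (auto simp: sets_cantor_measure)
    finally show ?thesis .
  qed
  ultimately have "mu (d - ?p) < (1/2) ^ (n * n) * mu d / 4 \<or> mu (d \<inter> ?p) < (1/2) ^ (n * n) * mu d / 4"
    using dec by linarith
  then show ?thesis unfolding bad_def by simp
qed

section \<open>Trees of bad values and slaloms\<close>

primrec reach :: "(nat \<Rightarrow> bool) set \<Rightarrow> nat list \<Rightarrow> nat \<Rightarrow> nat list set" where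
  "reach d s 0 = {s}"
| "reach d s (Suc j) = (\<Union>t\<in>reach d s j. (\<lambda>i. i # t) ` bad d t)"

text \<open>The bad values at step \<open>n\<close> depend on the history and thus on
  \<open>f\<close>. Collecting them over all histories reachable through bad values removes this
  dependence: only \<open>d\<close> and the starting history remain, and there are countably many
  starting histories.\<close>

definition slalom :: "(nat \<Rightarrow> bool) set \<Rightarrow> nat list \<Rightarrow> nat \<Rightarrow> nat set" where
  "slalom d s n = (if length s \<le> n then hd ` reach d s (Suc (n - length s)) else {})"

lemma length_reach: "t \<in> reach d s j \<Longrightarrow> length t = length s + j"
  by (induction j arbitrary: t) auto

lemma big_mono: "16 * (1/2 :: real) ^ n < m \<Longrightarrow> n \<le> k \<Longrightarrow> 16 * (1/2) ^ k < m"
proof -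
  assume "16 * (1/2 :: real) ^ n < m" "n \<le> k"
  then have "(1/2 :: real) ^ k \<le> (1/2) ^ n" by (intro power_decreasing) auto
  with \<open>16 * (1/2) ^ n < m\<close> show ?thesis by linarith
qed

text \<open>Passing step \<open>n\<close> multiplies the number of histories by at most
  \<open>4 ^ (n * n)\<close>, and \<open>n ^ 3 + n * n \<le> Suc n ^ 3\<close>. The bound depends on
  the length reached, not on \<open>d\<close>.\<close>

lemma card_reach:
  assumes d: "d \<in> clopen_sigma UNIV" and big: "16 * (1/2) ^ length s < mu d"
  shows "finite (reach d s j) \<and> card (reach d s j) \<le> 4 ^ ((length s + j) ^ 3)"
proof (induction j)
  case (Suc j)
  define n where "n = length s + j"
  have bad: "finite (bad d t)" "card (bad d t) \<le> 4 ^ (n * n)" if "t \<in> reach d s j" for t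
  proof -
    have "16 * (1/2) ^ length t < mu d" using big_mono[OF big] length_reach[OF that] by simp
    from card_bad[OF d this] show "finite (bad d t)" "card (bad d t) \<le> 4 ^ (n * n)"
      using length_reach[OF that] by (simp_all add: n_def)
  qed
  have "card (reach d s (Suc j)) \<le> (\<Sum>t\<in>reach d s j. card ((\<lambda>i. i # t) ` bad d t))"
    using Suc by (auto intro: card_UN_le)
  also have "\<dots> \<le> (\<Sum>t\<in>reach d s j. 4 ^ (n * n))"
    using bad by (intro sum_mono order_trans[OF card_image_le])
  also have "\<dots> = card (reach d s j) * 4 ^ (n * n)" by simp
  also have "\<dots> \<le> 4 ^ (n ^ 3) * 4 ^ (n * n)" using Suc by (simp add: n_def)
  also have "\<dots> = 4 ^ (n ^ 3 + n * n)" by (simp add: power_add)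
  also have "\<dots> \<le> 4 ^ (Suc n ^ 3)"
    by (intro power_increasing) (auto simp: power3_eq_cube algebra_simps)
  finally show ?case using Suc bad by (simp add: n_def)
qed simp

lemma card_slalom:
  assumes "d \<in> clopen_sigma UNIV" "16 * (1/2) ^ length s < mu d"
  shows "finite (slalom d s n)" "card (slalom d s n) \<le> 4 ^ (Suc n ^ 3)"
proof -
  have "finite (slalom d s n) \<and> card (slalom d s n) \<le> 4 ^ (Suc n ^ 3)"
  proof (cases "length s \<le> n")
    case True
    then show ?thesis
      using card_reach[OF assms, of "Suc (n - length s)"] card_image_le[of "reach d s (Suc (n - length s))" hd]
      unfolding slalom_def by auto
  qed (simp add: slalom_def)
  then show "finite (slalom d s n)" "card (slalom d s n) \<le> 4 ^ (Suc n ^ 3)" by auto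
qed

lemma slalom_captures:
  assumes d: "d \<in> clopen_sigma UNIV" and big: "16 * (1/2) ^ n0 < mu d"
    and dec: "mu (d - parity_limit f) = 0 \<or> mu (d \<inter> parity_limit f) = 0" and "n0 \<le> n"
  shows "f n \<in> slalom d (hist f n0) n"
proof -
  have r: "hist f (n0 + j) \<in> reach d (hist f n0) j" for j
  proof (induction j)
    case (Suc j)
    have "f (n0 + j) \<in> bad d (hist f (n0 + j))"
      using hist_bad[OF d big_mono[OF big] dec] by simp
    then show ?case using Suc by auto
  qed simp
  show ?thesis using r[of "Suc (n - n0)"] \<open>n0 \<le> n\<close> unfolding slalom_def by (force intro: image_eqI[rotated])
qed

section \<open>The inequalities\<close>

interpretation nul: cantor_ideal_omega null_ideal by (rule cantor_ideal_null)

interpretation mea: cantor_ideal_omega meagre_ideal by (rule cantor_ideal_meagre)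

section \<open>From ultrafilter bases to cofinal families of null sets\<close>

lemma limsup_null_geometric:
  assumes C: "\<And>n::nat. C n \<in> clopen_sigma UNIV" and le: "\<And>n. mu (C n) \<le> (1/2) ^ n"
  shows "{x. \<exists>\<^sub>\<infinity>n. x \<in> C n} \<in> null_ideal"
proof (rule limsup_null[OF C])
  show "summable (\<lambda>n. mu (C n))"
    by (rule summable_comparison_test'[where g = "\<lambda>n. (1/2 :: real) ^ n" and N = 0])
       (use le in \<open>simp_all add: summable_geometric\<close>)
qed

text \<open>A slalom may contain indices of large clopen sets; these are filtered out, and the
  allowed measure is scaled by the width of the slalom so that Borel-Cantelli applies.\<close>

lemma null_limsup_card:
  fixes T :: "nat \<Rightarrow> nat set"
  assumes T: "\<And>n. finite (T n)" "\<And>n. card (T n) \<le> 4 ^ (Suc n ^ 3)"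
    and E: "\<And>i. E i \<in> clopen_sigma UNIV"
  shows "{x. \<exists>\<^sub>\<infinity>n. x \<in> (\<Union>i\<in>{i \<in> T n. mu (E i) \<le> (1/2) ^ n / 4 ^ (Suc n ^ 3)}. E i)} \<in> null_ideal"
proof (rule limsup_null_geometric)
  let ?T = "\<lambda>n. {i \<in> T n. mu (E i) \<le> (1/2) ^ n / 4 ^ (Suc n ^ 3)}"
  show "(\<Union>i\<in>?T n. E i) \<in> clopen_sigma UNIV" for n by (rule UN_borel[OF E])
  show "mu (\<Union>i\<in>?T n. E i) \<le> (1/2) ^ n" for n
  proof -
    have "mu (\<Union>i\<in>?T n. E i) \<le> (\<Sum>i\<in>?T n. mu (E i))"
      using T(1) E by (intro measure_UNION_le) (auto simp: sets_cantor_measure)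
    also have "\<dots> \<le> (\<Sum>i\<in>?T n. (1/2) ^ n / 4 ^ (Suc n ^ 3))" by (intro sum_mono) auto
    also have "\<dots> = real (card (?T n)) * ((1/2) ^ n / 4 ^ (Suc n ^ 3))" by simp
    also have "\<dots> \<le> real (4 ^ (Suc n ^ 3)) * ((1/2) ^ n / 4 ^ (Suc n ^ 3))"
    proof (rule mult_right_mono)
      have "card (?T n) \<le> card (T n)" using T(1) by (intro card_mono) auto
      then show "real (card (?T n)) \<le> real (4 ^ (Suc n ^ 3))" using T(2)[of n] by (simp only: of_nat_le_iff)
    qed simp
    also have "\<dots> = (1/2) ^ n" by simp
    finally show ?thesis .
  qed
qed

lemma clop_enumeration:
  obtains E :: "nat \<Rightarrow> (nat \<Rightarrow> bool) set" where "range E = {C. clop C}"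
proof
  have "{C. clop C} \<noteq> {}" using clop_UNIV by blast
  then show "range (from_nat_into {C. clop C}) = {C. clop C}" using countable_clop by simp
qed

lemma base_uncountable:
  assumes P: "nul.set_ultrafilter P" and D: "nul.filter_base P D"
  shows "uncountable D"
proof -
  obtain z where z: "\<And>k. cyl z k \<in> P" using nul.ultrafilter_point[OF P] by blast
  note V = nul.fin_ultrafilter_projection[OF P D z]
  have "uncountable (nul.support z ` D)" using fin_base_uncountable[OF V] .
  then show ?thesis by blast
qed

text \<open>Each base element \<open>d\<close>, together with a starting history long enough for the measure of \<open>d\<close>,
  gives a slalom; the base element deciding \<open>parity_limit f\<close> gives a slalom capturing \<open>f\<close>.\<close>

lemma cof_null_le_ultrafilter_number: "cof_null \<le>o ultrafilter_number nul.Q"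
proof -
  obtain P D where P: "nul.set_ultrafilter P" and D: "nul.filter_base P D" and c: "|D| \<le>o ultrafilter_number nul.Q"
    using nul.base_exists_omega .
  note PD = nul.set_filterD[OF nul.set_ultrafilterD(1)[OF P]]
  have DP: "d \<in> P" if "d \<in> D" for d using D that by (auto simp: nul.filter_base_def)
  have Db: "d \<in> clopen_sigma UNIV" if "d \<in> D" for d using PD(1) DP that by blast
  obtain E :: "nat \<Rightarrow> (nat \<Rightarrow> bool) set" where E: "range E = {C. clop C}" by (rule clop_enumeration)
  have Eb: "E i \<in> clopen_sigma UNIV" for i using E clop_borel by blast
  define Z where "Z p = {x. \<exists>\<^sub>\<infinity>n. x \<in> (\<Union>i\<in>{i \<in> slalom (fst p) (snd p) n. mu (E i) \<le> (1/2) ^ n / 4 ^ (Suc n ^ 3)}. E i)}" for p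
  define W where "W = {(d, s :: nat list). d \<in> D \<and> 16 * (1/2) ^ length s < mu d}"
  have "cofinal_in null_ideal (\<subseteq>) (Z ` W)"
    unfolding cofinal_in_def
  proof (intro conjI ballI subsetI)
    fix X assume "X \<in> Z ` W"
    then obtain d s where ds: "d \<in> D" "16 * (1/2) ^ length s < mu d" "X = Z (d, s)" unfolding W_def by blast
    show "X \<in> null_ideal"
      unfolding ds(3) Z_def fst_conv snd_conv
      by (intro null_limsup_card card_slalom[OF Db[OF ds(1)] ds(2)] Eb)
  next
    fix X assume X: "X \<in> null_ideal"
    \<comment> \<open>Cover \<open>X\<close> by clopen sets small enough to pass the filter in
      \<open>Z\<close>. Their indices form the function \<open>f\<close> to be captured by a
      slalom.\<close>
    have "\<exists>C. (\<forall>n. clop (C n)) \<and> (\<forall>n. mu (C n) \<le> (1/2) ^ n / 4 ^ (Suc n ^ 3)) \<and> X \<subseteq> {x. \<exists>\<^sub>\<infinity>n. x \<in> C n}"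
      by (rule null_clop_limsup[OF X, of "\<lambda>n. (1/2) ^ n / 4 ^ (Suc n ^ 3)"]) (simp, blast)
    then obtain C where C: "\<And>n. clop (C n)" "\<And>n. mu (C n) \<le> (1/2) ^ n / 4 ^ (Suc n ^ 3)"
      "X \<subseteq> {x. \<exists>\<^sub>\<infinity>n. x \<in> C n}" by blast
    have "\<exists>i. E i = C n" for n using E C(1)[of n] by (metis (mono_tags) mem_Collect_eq imageE)
    then obtain f where f: "\<And>n. E (f n) = C n" by metis
    let ?B = "parity_limit f"
    have "\<exists>d\<in>D. mu (d - ?B) = 0 \<or> mu (d \<inter> ?B) = 0"
    proof (cases "?B \<in> P")
      case True
      then obtain d where d: "d \<in> D" "d - ?B \<in> null_ideal" using D unfolding nul.filter_base_def by blast
      then have "mu (d - ?B) = 0" using null_ideal_iff[of "d - ?B"] Db parity_limit_borel bo.Diff by blast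
      then show ?thesis using d(1) by blast
    next
      case False
      then have "UNIV - ?B \<in> P" by (rule nul.set_ultrafilterD(2)[OF P parity_limit_borel])
      then obtain d where d: "d \<in> D" "d - (UNIV - ?B) \<in> null_ideal" using D unfolding nul.filter_base_def by blast
      moreover have "d - (UNIV - ?B) = d \<inter> ?B" by auto
      ultimately have "mu (d \<inter> ?B) = 0" using null_ideal_iff[of "d \<inter> ?B"] Db parity_limit_borel bo.Int by simp
      then show ?thesis using d(1) by blast
    qed
    then obtain d where d: "d \<in> D" "mu (d - ?B) = 0 \<or> mu (d \<inter> ?B) = 0" by blast
    have "mu d \<noteq> 0" using PD(3)[OF DP[OF d(1)]] null_ideal_iff[OF Db[OF d(1)]] by blast
    then have pos: "0 < mu d / 16" by (simp add: zero_less_measure_iff)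
    obtain n0 where "(1/2 :: real) ^ n0 < mu d / 16" using real_arch_pow_inv[OF pos, of "1/2"] by auto
    then have n0: "16 * (1/2) ^ n0 < mu d" by simp
    have "X \<subseteq> Z (d, hist f n0)"
    proof
      fix x assume "x \<in> X"
      then have x: "\<exists>n\<ge>k. x \<in> C n" for k using C(3) by (auto simp: INFM_nat_le)
      have "\<exists>n\<ge>k. x \<in> (\<Union>i\<in>{i \<in> slalom d (hist f n0) n. mu (E i) \<le> (1/2) ^ n / 4 ^ (Suc n ^ 3)}. E i)" for k
      proof -
        obtain n where n: "max k n0 \<le> n" "x \<in> C n" using x by blast
        have "f n \<in> slalom d (hist f n0) n"
          using n(1) by (intro slalom_captures[OF Db[OF d(1)] n0 d(2)]) simp
        then show ?thesis using n f[of n] C(2)[of n] by (intro exI[of _ n] conjI UN_I[of "f n"]) auto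
      qed
      then show "x \<in> Z (d, hist f n0)" unfolding Z_def by (simp add: INFM_nat_le)
    qed
    moreover have "(d, hist f n0) \<in> W" using d(1) n0 by (simp add: W_def)
    ultimately show "\<exists>Y\<in>Z ` W. X \<subseteq> Y" by blast
  qed
  then have "cof_null \<le>o |Z ` W|" unfolding cof_null_def by (rule cof_le)
  also have "|Z ` W| \<le>o |W|" by (rule card_of_image)
  also have "|W| \<le>o |D \<times> (UNIV :: nat list set)|" by (rule card_of_mono1) (auto simp: W_def)
  \<comment> \<open>Since \<open>D\<close> is infinite, the countably many starting histories do not
    raise the cardinality.\<close>
  also have "|D \<times> (UNIV :: nat list set)| \<le>o |D|"
  proof -
    have unc: "uncountable D" by (rule base_uncountable[OF P D])
    have "|UNIV :: nat list set| \<le>o natLeq"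
      using card_of_ordLeq[of "UNIV :: nat list set" "UNIV :: nat set"] inj_to_nat card_of_nat ordLeq_ordIso_trans by blast
    moreover have "natLeq \<le>o |D|"
      using infinite_iff_natLeq_ordLeq unc countable_finite by blast
    ultimately have "|UNIV :: nat list set| \<le>o |D|" by (rule ordLeq_transitive)
    then show ?thesis
      using card_of_Times_infinite[of D "UNIV :: nat list set"] unc countable_finite ordIso_imp_ordLeq by blast
  qed
  also note c
  finally show ?thesis .
qed

section \<open>Inequalities among \<aleph>1, the dominating number, non(N) and cof(N)\<close>

lemma cof_null_attained:
  obtains \<C> where "cofinal_in null_ideal (\<subseteq>) \<C>" "cof_null = |\<C>|"
  by (rule cof_attained[of null_ideal "(\<subseteq>)" null_ideal]) (auto simp: cofinal_in_def cof_null_def)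

lemma non_null_attained:
  obtains X where "X \<notin> null_ideal" "non_null = |X|"
proof -
  have "non_null \<in> { |X| | X. X \<notin> null_ideal}"
    unfolding non_null_def
    by (rule min_card(1)) (use nul.UNIV_notin in \<open>auto simp: card_of_Card_order\<close>)
  then show thesis using that by blast
qed

lemma non_null_le: "X \<notin> null_ideal \<Longrightarrow> non_null \<le>o |X|"
  unfolding non_null_def by (rule min_card(2)) (auto simp: card_of_Card_order)

lemma aleph1_le_non_null: "aleph1 \<le>o non_null"
proof -
  obtain X where X: "X \<notin> null_ideal" "non_null = |X|" by (rule non_null_attained)
  have "uncountable X"
  proof
    assume "countable X"
    have "X \<noteq> {}" using X(1) nul.empty_in by blast
    then have "range (from_nat_into X) = X" using \<open>countable X\<close> by simp
    then have "X = (\<Union>n. {from_nat_into X n})" by blast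
    then show False using X(1) null_UN[OF null_singleton, of "from_nat_into X"] by simp
  qed
  then show ?thesis unfolding X(2) aleph1_le_iff .
qed

text \<open>A point chosen outside each member of a cofinal family gives a set that no member can
  contain.\<close>

lemma non_null_le_cof_null: "non_null \<le>o cof_null"
proof -
  obtain \<C> where C: "cofinal_in null_ideal (\<subseteq>) \<C>" "cof_null = |\<C>|" by (rule cof_null_attained)
  have "\<exists>x. x \<notin> c" if "c \<in> \<C>" for c
    using that C(1) nul.UNIV_notin unfolding cofinal_in_def by (metis UNIV_eq_I subsetD)
  then obtain p where p: "\<And>c. c \<in> \<C> \<Longrightarrow> p c \<notin> c" by metis
  have "p ` \<C> \<notin> null_ideal"
  proof
    assume "p ` \<C> \<in> null_ideal"
    then obtain c where "c \<in> \<C>" "p ` \<C> \<subseteq> c" using C(1) unfolding cofinal_in_def by blast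
    then show False using p by blast
  qed
  then have "non_null \<le>o |p ` \<C>|" by (rule non_null_le)
  then show ?thesis unfolding C(2) using card_of_image ordLeq_transitive by blast
qed

lemma aleph1_le_dominating_number: "aleph1 \<le>o dominating_number"
proof -
  let ?R = "\<lambda>f g :: nat \<Rightarrow> nat. \<forall>\<^sub>F n in sequentially. f n \<le> g n"
  have "cofinal_in UNIV ?R UNIV" unfolding cofinal_in_def
  proof (intro conjI ballI)
    show "\<exists>c\<in>UNIV. ?R d c" for d by (rule bexI[of _ d]) simp_all
  qed simp
  then obtain C where C: "cofinal_in UNIV ?R C" "cof UNIV ?R = |C|" by (rule cof_attained)
  have "uncountable C"
  proof
    assume "countable C"
    have "C \<noteq> {}" using C(1) unfolding cofinal_in_def by blast
    define g where "g = from_nat_into C"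
    have g: "range g = C" unfolding g_def using \<open>C \<noteq> {}\<close> \<open>countable C\<close> by simp
    \<comment> \<open>From stage \<open>i\<close> on the sum includes \<open>g i n\<close>, so
      \<open>f\<close> is eventually strictly above each member of the enumerated family.\<close>
    define f where "f n = Suc (\<Sum>i\<le>n. g i n)" for n
    obtain h where "h \<in> C" "?R f h" using C(1) unfolding cofinal_in_def by blast
    then obtain i where "?R f (g i)" using g by blast
    then obtain N where N: "\<And>n. n \<ge> N \<Longrightarrow> f n \<le> g i n" by (auto simp: eventually_sequentially)
    define n where "n = max N i"
    have "g i n \<le> (\<Sum>j\<le>n. g j n)" by (rule member_le_sum) (auto simp: n_def)
    then show False using N[of n] by (simp add: f_def n_def)
  qed
  then show ?thesis unfolding dominating_number_def C(2) aleph1_le_iff .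
qed

text \<open>At a level beyond the one determining \<open>C\<close>, countably many cylinders
  partition \<open>C\<close>; if all were null in \<open>K\<close>, so would be
  \<open>C\<close>.\<close>

lemma positive_cyl:
  assumes K: "K \<in> clopen_sigma UNIV" and C: "clop C" and pos: "mu (K \<inter> C) \<noteq> 0"
  obtains x M where "N < M" "cyl x M \<subseteq> C" "mu (K \<inter> cyl x M) \<noteq> 0"
proof -
  obtain L where L: "\<And>x y M. L \<le> M \<Longrightarrow> y \<in> cyl x M \<Longrightarrow> y \<in> C \<longleftrightarrow> x \<in> C" using clop_level[OF C] by blast
  define M where "M = Suc (max L N)"
  have sub: "cyl x M \<subseteq> C" if "x \<in> C" for x using L[of M _ x] that by (auto simp: M_def)
  have "\<exists>x\<in>C. mu (K \<inter> cyl x M) \<noteq> 0"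
  proof (rule ccontr)
    assume "\<not> (\<exists>x\<in>C. mu (K \<inter> cyl x M) \<noteq> 0)"
    then have 0: "mu (K \<inter> cyl x M) = 0" if "x \<in> C" for x using that by blast
    let ?F = "(\<lambda>x. cyl x M) ` C"
    have "countable ?F" by (rule countable_subset[OF _ countable_clop]) (use clop_cyl in blast)
    moreover have "K \<inter> c \<in> null_sets cantor_measure" if c: "c \<in> ?F" for c
    proof -
      obtain x where "x \<in> C" "c = cyl x M" using c by blast
      then show ?thesis
        using 0 K cyl_borel[of x M] by (simp add: null_sets_def sets_cantor_measure cm.emeasure_eq_measure bo.Int)
    qed
    ultimately have "(\<Union>c\<in>?F. K \<inter> c) \<in> null_sets cantor_measure" by (intro null_sets_UN')
    moreover have "K \<inter> C = (\<Union>c\<in>?F. K \<inter> c)" using sub cyl_self by fast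
    ultimately have "mu (K \<inter> C) = 0" by (simp add: null_sets_def measure_def)
    then show False using pos by simp
  qed
  then obtain x where "x \<in> C" "mu (K \<inter> cyl x M) \<noteq> 0" by blast
  then show thesis using that[of M x] sub by (simp add: M_def)
qed

text \<open>A fusion argument: if no clopen set \<open>C\<close> that is positive in the closed set \<open>UNIV - G\<close> eventually
  avoids the blocks there, a point of \<open>UNIV - G\<close> lying in infinitely many blocks can be constructed.\<close>

lemma block_avoiding_clop:
  assumes G: "openin (cantor_space UNIV) G" "mu (UNIV - G) \<noteq> 0"
    and f: "{x. \<exists>\<^sub>\<infinity>n. x \<in> block n (f n)} \<subseteq> G"
  obtains C n0 where "clop C" "mu ((UNIV - G) \<inter> C) \<noteq> 0"
    "\<And>n. n0 \<le> n \<Longrightarrow> mu ((UNIV - G) \<inter> C \<inter> block n (f n)) = 0"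
proof (rule ccontr)
  assume "\<not> thesis"
  note avoid = that
  let ?K = "UNIV - G"
  have Kb: "?K \<in> clopen_sigma UNIV" using open_borel[OF G(1)] bo.Diff bo.top by blast
  have ex: "\<exists>n\<ge>n0. mu (?K \<inter> C \<inter> block n (f n)) \<noteq> 0" if C: "clop C" "mu (?K \<inter> C) \<noteq> 0" for C n0
    using avoid[OF C, of n0] \<open>\<not> thesis\<close> by blast
  \<comment> \<open>A fusion step passes to a smaller cylinder that is still positive in
    \<open>?K\<close> and lies inside a block of index at least \<open>j\<close>.\<close>
  define R where "R j q p \<longleftrightarrow> mu (?K \<inter> cyl (fst p) (snd p)) \<noteq> 0 \<and> snd q < snd p \<and>
      cyl (fst p) (snd p) \<subseteq> cyl (fst q) (snd q) \<and> (\<exists>n\<ge>j. cyl (fst p) (snd p) \<subseteq> block n (f n))" for j q p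
  have R: "\<exists>p. R j q p" if q: "mu (?K \<inter> cyl (fst q) (snd q)) \<noteq> 0" for j q
  proof -
    obtain n where n: "j \<le> n" "mu (?K \<inter> cyl (fst q) (snd q) \<inter> block n (f n)) \<noteq> 0"
      using ex[OF clop_cyl q] by blast
    have "clop (cyl (fst q) (snd q) \<inter> block n (f n))" by (intro clop_Int clop_cyl clop_block)
    then obtain x M where "snd q < M" "cyl x M \<subseteq> cyl (fst q) (snd q) \<inter> block n (f n)" "mu (?K \<inter> cyl x M) \<noteq> 0"
      by (rule positive_cyl[OF Kb]) (use n(2) in \<open>simp add: Int_assoc\<close>)
    then have "R j q (x, M)" unfolding R_def using n(1) by auto
    then show ?thesis by blast
  qed
  define s where "s = rec_nat (\<lambda>_. True, 0) (\<lambda>j q. SOME p. R j q p)"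
  have s0: "s 0 = (\<lambda>_. True, 0)" and sS: "s (Suc j) = (SOME p. R j (s j) p)" for j by (simp_all add: s_def)
  have "mu (?K \<inter> cyl (fst (s j)) (snd (s j))) \<noteq> 0 \<and> R j (s j) (s (Suc j))" for j
  proof (induction j)
    case 0
    have "mu (?K \<inter> cyl (fst (s 0)) (snd (s 0))) \<noteq> 0" using G(2) s0 by (simp add: cyl_def)
    then show ?case using someI_ex[OF R] sS by simp
  next
    case (Suc j)
    then have "mu (?K \<inter> cyl (fst (s (Suc j))) (snd (s (Suc j)))) \<noteq> 0" by (simp add: R_def)
    then show ?case using someI_ex[OF R] sS by simp
  qed
  then have pos: "\<And>j. mu (?K \<inter> cyl (fst (s j)) (snd (s j))) \<noteq> 0" and Rs: "\<And>j. R j (s j) (s (Suc j))" by auto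
  have "fst (s (Suc j)) \<in> cyl (fst (s j)) (snd (s j))" "snd (s j) < snd (s (Suc j))" for j
    using Rs[of j] cyl_self unfolding R_def by blast+
  then obtain w where w: "\<And>j. w \<in> cyl (fst (s j)) (snd (s j))"
    using nested_cyls[of "\<lambda>j. fst (s j)" "\<lambda>j. snd (s j)"] by blast
  have "\<exists>n\<ge>j. w \<in> block n (f n)" for j using Rs[of j] w[of "Suc j"] unfolding R_def by blast
  then have "w \<in> G" using f by (auto simp: INFM_nat_le)
  \<comment> \<open>Openness of \<open>G\<close> gives the contradiction: a late fusion cylinder
    around \<open>w\<close> lies inside \<open>G\<close>, yet it meets \<open>?K\<close> in positive
    measure.\<close>
  then obtain N where N: "cyl w N \<subseteq> G" using G(1) unfolding openin_cantor_space_cyl by blast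
  have mono: "strict_mono (\<lambda>j. snd (s j))" unfolding strict_mono_Suc_iff using Rs by (simp add: R_def)
  have "cyl (fst (s N)) (snd (s N)) = cyl w (snd (s N))" using cyl_eq[OF w] by simp
  also have "\<dots> \<subseteq> cyl w N" using strict_mono_imp_increasing[OF mono, of N] by (rule cyl_antimono)
  finally have "?K \<inter> cyl (fst (s N)) (snd (s N)) = {}" using N by blast
  then show False using pos[of N] by simp
qed

lemma dominating_number_le_cof_null: "dominating_number \<le>o cof_null"
proof -
  obtain \<C> where C: "cofinal_in null_ideal (\<subseteq>) \<C>" "cof_null = |\<C>|" by (rule cof_null_attained)
  obtain E :: "nat \<Rightarrow> (nat \<Rightarrow> bool) set" where E: "range E = {C. clop C}" by (rule clop_enumeration)
  have Ec: "clop (E i)" for i using E by blast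
  have "\<exists>G. openin (cantor_space UNIV) G \<and> c \<subseteq> G \<and> mu G < 1" if "c \<in> \<C>" for c
  proof -
    have "c \<in> null_ideal" using that C(1) unfolding cofinal_in_def by blast
    then show ?thesis by (rule null_open_cover[of c 1]) auto
  qed
  then obtain G where G: "\<And>c. c \<in> \<C> \<Longrightarrow> openin (cantor_space UNIV) (G c)" "\<And>c. c \<in> \<C> \<Longrightarrow> c \<subseteq> G c"
    "\<And>c. c \<in> \<C> \<Longrightarrow> mu (G c) < 1" by metis
  define S where "S c m n = {i. mu ((UNIV - G c) \<inter> E m \<inter> block n i) = 0}" for c m n
  \<comment> \<open>The clopen set supplied by \<open>block_avoiding_clop\<close> depends on
    \<open>f\<close>. Taking all \<open>E m\<close> with \<open>m \<le> n\<close> that are positive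
    in \<open>UNIV - G c\<close> makes \<open>g c\<close> depend on \<open>c\<close> alone, and
    keeps the maximum over a finite set by \<open>positive_block_finite\<close>.\<close>
  define g where "g c n = Max (\<Union>m\<in>{m. m \<le> n \<and> mu ((UNIV - G c) \<inter> E m) \<noteq> 0}. S c m n)" for c n
  have "cofinal_in UNIV (\<lambda>f g. \<forall>\<^sub>F n in sequentially. f n \<le> g n) (g ` \<C>)"
    unfolding cofinal_in_def
  proof (intro conjI ballI)
    fix f :: "nat \<Rightarrow> nat"
    have "mu (block n (f n)) \<le> (1/2) ^ n" for n
      unfolding mu_block by (cases n) (auto intro!: power_decreasing)
    then have "{x. \<exists>\<^sub>\<infinity>n. x \<in> block n (f n)} \<in> null_ideal" by (intro limsup_null_geometric block_borel)
    then obtain c where c: "c \<in> \<C>" "{x. \<exists>\<^sub>\<infinity>n. x \<in> block n (f n)} \<subseteq> c"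
      using C(1) unfolding cofinal_in_def by blast
    let ?K = "UNIV - G c"
    have Kb: "?K \<in> clopen_sigma UNIV" using open_borel[OF G(1)[OF c(1)]] bo.Diff bo.top by blast
    have "mu ?K \<noteq> 0"
      using G(3)[OF c(1)] cm.prob_compl[of "G c"] open_borel[OF G(1)[OF c(1)]] by (simp add: sets_cantor_measure)
    moreover have "{x. \<exists>\<^sub>\<infinity>n. x \<in> block n (f n)} \<subseteq> G c" using c(2) G(2)[OF c(1)] by (rule subset_trans)
    ultimately obtain D n0 where D: "clop D" "mu (?K \<inter> D) \<noteq> 0"
        "\<And>n. n0 \<le> n \<Longrightarrow> mu (?K \<inter> D \<inter> block n (f n)) = 0"
      by (rule block_avoiding_clop[OF G(1)[OF c(1)]]) blast
    have "D \<in> range E" unfolding E using D(1) by simp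
    then obtain m where m: "D = E m" by blast
    have "f n \<le> g c n" if n: "max n0 m \<le> n" for n
    proof -
      have "finite (S c m' n)" if "mu (?K \<inter> E m') \<noteq> 0" for m'
        unfolding S_def using Kb clop_borel[OF Ec] that
        by (intro positive_block_finite) (auto simp: zero_less_measure_iff)
      then have "finite (\<Union>m\<in>{m. m \<le> n \<and> mu (?K \<inter> E m) \<noteq> 0}. S c m n)" by auto
      moreover have "f n \<in> (\<Union>m\<in>{m. m \<le> n \<and> mu (?K \<inter> E m) \<noteq> 0}. S c m n)"
        using D(2) D(3)[of n] n m by (intro UN_I[of m]) (auto simp: S_def)
      ultimately show ?thesis unfolding g_def by (rule Max_ge)
    qed
    then show "\<exists>h\<in>g ` \<C>. \<forall>\<^sub>F n in sequentially. f n \<le> h n"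
      using c(1) by (intro bexI[of _ "g c"]) (auto simp: eventually_sequentially intro!: exI[of _ "max n0 m"])
  qed simp
  then have "dominating_number \<le>o |g ` \<C>|" unfolding dominating_number_def by (rule cof_le)
  then show ?thesis unfolding C(2) using card_of_image ordLeq_transitive by blast
qed

section \<open>The algebras over \<open>omega1\<close> and the conclusion\<close>

lemma infinite_omega1: "infinite omega1"
  unfolding omega1_def using cardSuc_finite[OF natLeq_Card_order] by (simp add: Field_natLeq)

interpretation nul1: cantor_ideal_at null_ideal omega1
  using nul.cantor_ideal_axioms infinite_omega1 by (simp add: cantor_ideal_at_def cantor_ideal_at_axioms_def)

interpretation mea1: cantor_ideal_at meagre_ideal omega1
  using mea.cantor_ideal_axioms infinite_omega1 by (simp add: cantor_ideal_at_def cantor_ideal_at_axioms_def)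

theorem theorem3p3:
  shows "(aleph1 \<le>o ultrafilter_number_omega \<and> aleph1 \<le>o dominating_number \<and> aleph1 \<le>o non_null) \<and>
    (dominating_number \<le>o cof_null \<and> non_null \<le>o cof_null) \<and>
    (ultrafilter_number_omega \<le>o ultrafilter_number (cohen_algebra omega) \<and>
     ultrafilter_number_omega \<le>o ultrafilter_number (random_algebra omega)) \<and>
    dominating_number \<le>o ultrafilter_number (cohen_algebra omega) \<and>
    cof_null \<le>o ultrafilter_number (random_algebra omega) \<and>
    (ultrafilter_number (cohen_algebra omega) \<le>o ultrafilter_number (cohen_algebra omega1) \<and>
     ultrafilter_number (cohen_algebra omega1) \<le>o continuum) \<and>
    (ultrafilter_number (random_algebra omega) \<le>o ultrafilter_number (random_algebra omega1) \<and>
     ultrafilter_number (random_algebra omega1) \<le>o continuum)"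
proof -
  have eq: "cohen_algebra omega = mea.Q" "random_algebra omega = nul.Q"
    "cohen_algebra omega1 = mea1.Q" "random_algebra omega1 = nul1.Q"
    unfolding cohen_algebra_def random_algebra_def by (simp_all only: mea.ideal_at_UNIV nul.ideal_at_UNIV)
  have "omega1 \<noteq> {}" using infinite_omega1 by auto
  then have "|clopen_sigma omega1| \<le>o continuum" by (rule card_clopen_sigma_le_continuum)
  then have "ultrafilter_number mea1.Q \<le>o continuum" "ultrafilter_number nul1.Q \<le>o continuum"
    by (rule ordLeq_transitive[OF mea1.ultrafilter_number_le_algebra],
        rule ordLeq_transitive[OF nul1.ultrafilter_number_le_algebra])
  then show ?thesis
    unfolding eq
    by (intro conjI nul.aleph1_le_ultrafilter_number_omega aleph1_le_dominating_number aleph1_le_non_null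
      dominating_number_le_cof_null non_null_le_cof_null mea.ultrafilter_number_omega_le_quotient
      nul.ultrafilter_number_omega_le_quotient mea.dominating_number_le_ultrafilter_number
      cof_null_le_ultrafilter_number mea1.ultrafilter_number_omega_le nul1.ultrafilter_number_omega_le)
qed

end
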